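(* Let $n,m\ge0$ be integers and let $f\colon X\to Y$ be a perfect surjection between paracompact spaces such that $\dim f\leq n$ and $\dim Y\leq m$. Then, for every open cover $\omega$ of $X$, the set $\{g\in C(X,\mathbb{I}^{2n+1+m}): f\times g \text{ is an } \omega\text{-map}\}$ is open and dense in $C(X,\mathbb{I}^{2n+1+m})$ with respect to the source limitation topology.
   Context: All maps are continuous; paracompact spaces are assumed Hausdorff. $\mathbb{I}=[0,1]$ and $\mathbb{I}^k$ is the $k$-dimensional cube with the Euclidean metric. $C(X,Z)$ is the set of continuous maps from $X$ to $Z$. For $g\colon X\to Z$, $f\times g\colon X\to Y\times Z$ denotes the map $x\mapsto (f(x),g(x))$. A map is perfect if it is closed with compact fibers. $\dim$ is the covering dimension, and $\dim f\le n$ means $\dim f^{-1}(y)\le n$ for every $y\in Y$. For an open cover $\omega$ of $X$, a map $h\colon X\to Z$ is an $\omega$-map if every $x\in X$ admits a neighborhood $V$ of $h(x)$ in $Z$ with $h^{-1}(V)\subset U$ for some $U\in\omega$. Source limitation topology: for a metric space $(Z,d)$, a set $U\subset C(X,Z)$ is open if for every $g\in U$ there is a continuous function $\alpha\colon X\to(0,\infty)$ with $\overline{B}(g,\alpha)\subset U$, where $\overline{B}(g,\alpha)=\{h\in C(X,Z): d(g(x),h(x))\le\alpha(x)\text{ for all }x\in X\}$. *)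

theory Defs
  imports "HOL-Analysis.Analysis"
begin

definition open_cover :: "'a topology \<Rightarrow> 'a set set \<Rightarrow> bool" where
  "open_cover X \<U> \<longleftrightarrow> (\<forall>U\<in>\<U>. openin X U) \<and> \<Union>\<U> = topspace X"

definition refines :: "'a set set \<Rightarrow> 'a set set \<Rightarrow> bool" where
  "refines \<V> \<U> \<longleftrightarrow> (\<forall>V\<in>\<V>. \<exists>U\<in>\<U>. V \<subseteq> U)"

text \<open>Paracompact spaces are Hausdorff by convention.\<close>

definition paracompact_space :: "'a topology \<Rightarrow> bool" where
  "paracompact_space X \<longleftrightarrow> Hausdorff_space X \<and>
     (\<forall>\<U>. open_cover X \<U> \<longrightarrow>
        (\<exists>\<V>. open_cover X \<V> \<and> refines \<V> \<U> \<and> locally_finite_in X \<V>))"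

text \<open>\<open>covering_dim_le X n\<close> is the relation \<open>dim X \<le> n\<close> for the Cech-Lebesgue covering dimension
  of a normal space: every finite open cover has a finite open refinement in which each point
  lies in at most \<open>n + 1\<close> members.  The empty space (of dimension \<open>-1\<close>) satisfies it for every \<open>n\<close>.\<close>

definition covering_dim_le :: "'a topology \<Rightarrow> nat \<Rightarrow> bool" where
  "covering_dim_le X n \<longleftrightarrow>
     (\<forall>\<U>. finite \<U> \<and> open_cover X \<U> \<longrightarrow>
        (\<exists>\<V>. finite \<V> \<and> open_cover X \<V> \<and> refines \<V> \<U> \<and>
              (\<forall>x\<in>topspace X. card {V \<in> \<V>. x \<in> V} \<le> n + 1)))"

definition map_dim_le :: "'a topology \<Rightarrow> 'b topology \<Rightarrow> ('a \<Rightarrow> 'b) \<Rightarrow> nat \<Rightarrow> bool" where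
  "map_dim_le X Y f n \<longleftrightarrow>
     (\<forall>y\<in>topspace Y. covering_dim_le (subtopology X {x \<in> topspace X. f x = y}) n)"

definition omega_map :: "'a topology \<Rightarrow> 'b topology \<Rightarrow> 'a set set \<Rightarrow> ('a \<Rightarrow> 'b) \<Rightarrow> bool" where
  "omega_map X Z \<omega> h \<longleftrightarrow> continuous_map X Z h \<and>
     (\<forall>x\<in>topspace X. \<exists>V. openin Z V \<and> h x \<in> V \<and>
        (\<exists>U\<in>\<omega>. {x' \<in> topspace X. h x' \<in> V} \<subseteq> U))"

text \<open>The set \<open>C(X, Z)\<close>; extensionality makes its elements correspond exactly to the continuous maps
  defined on the carrier of \<open>X\<close>, as in \<^const>\<open>cfunspace\<close> (but without boundedness).\<close>

definition cmaps :: "'a topology \<Rightarrow> 'b metric \<Rightarrow> ('a \<Rightarrow> 'b) set" where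
  "cmaps X Z = {g \<in> extensional (topspace X). continuous_map X (mtopology_of Z) g}"

definition sl_cball :: "'a topology \<Rightarrow> 'b metric \<Rightarrow> ('a \<Rightarrow> 'b) \<Rightarrow> ('a \<Rightarrow> real) \<Rightarrow> ('a \<Rightarrow> 'b) set" where
  "sl_cball X Z g \<alpha> = {h \<in> cmaps X Z. \<forall>x\<in>topspace X. mdist Z (g x) (h x) \<le> \<alpha> x}"

definition sl_open :: "'a topology \<Rightarrow> 'b metric \<Rightarrow> ('a \<Rightarrow> 'b) set \<Rightarrow> bool" where
  "sl_open X Z \<G> \<longleftrightarrow> \<G> \<subseteq> cmaps X Z \<and>
     (\<forall>g\<in>\<G>. \<exists>\<alpha>. continuous_map X euclideanreal \<alpha> \<and> (\<forall>x\<in>topspace X. 0 < \<alpha> x) \<and>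
        sl_cball X Z g \<alpha> \<subseteq> \<G>)"

definition source_limitation_topology :: "'a topology \<Rightarrow> 'b metric \<Rightarrow> ('a \<Rightarrow> 'b) topology" where
  "source_limitation_topology X Z = topology (sl_open X Z)"

lemma sl_openD:
  assumes "sl_open X Z \<G>" "g \<in> \<G>"
  obtains \<alpha> where "continuous_map X euclideanreal \<alpha>" "\<forall>x\<in>topspace X. 0 < \<alpha> x"
    "sl_cball X Z g \<alpha> \<subseteq> \<G>"
  using assms unfolding sl_open_def by blast

lemma sl_openI:
  assumes "\<G> \<subseteq> cmaps X Z"
    and "\<And>g. g \<in> \<G> \<Longrightarrow> \<exists>\<alpha>. continuous_map X euclideanreal \<alpha> \<and> (\<forall>x\<in>topspace X. 0 < \<alpha> x) \<and>
        sl_cball X Z g \<alpha> \<subseteq> \<G>"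
  shows "sl_open X Z \<G>"
  using assms unfolding sl_open_def by blast

lemma sl_open_subset: "sl_open X Z \<G> \<Longrightarrow> \<G> \<subseteq> cmaps X Z"
  unfolding sl_open_def by (rule conjunct1)

lemma istopology_sl_open: "istopology (sl_open X Z)"
  unfolding istopology_def
proof (intro conjI allI impI)
  fix \<G> \<H>
  assume G: "sl_open X Z \<G>" and H: "sl_open X Z \<H>"
  show "sl_open X Z (\<G> \<inter> \<H>)"
  proof (rule sl_openI)
    show "\<G> \<inter> \<H> \<subseteq> cmaps X Z"
      using sl_open_subset[OF G] by (rule le_infI1)
  next
    fix g assume "g \<in> \<G> \<inter> \<H>"
    then have g: "g \<in> \<G>" "g \<in> \<H>"
      by (rule IntD1, rule IntD2)
    obtain \<alpha> where \<alpha>: "continuous_map X euclideanreal \<alpha>" "\<forall>x\<in>topspace X. 0 < \<alpha> x"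
      "sl_cball X Z g \<alpha> \<subseteq> \<G>"
      by (rule sl_openD[OF G g(1)])
    obtain \<beta> where \<beta>: "continuous_map X euclideanreal \<beta>" "\<forall>x\<in>topspace X. 0 < \<beta> x"
      "sl_cball X Z g \<beta> \<subseteq> \<H>"
      by (rule sl_openD[OF H g(2)])
    have "sl_cball X Z g (\<lambda>x. min (\<alpha> x) (\<beta> x)) \<subseteq> sl_cball X Z g \<alpha> \<inter> sl_cball X Z g \<beta>"
      unfolding sl_cball_def by (simp add: subset_iff)
    also have "\<dots> \<subseteq> \<G> \<inter> \<H>"
      using \<alpha>(3) \<beta>(3) by (rule Int_mono)
    finally have "sl_cball X Z g (\<lambda>x. min (\<alpha> x) (\<beta> x)) \<subseteq> \<G> \<inter> \<H>" .
    moreover have "continuous_map X euclideanreal (\<lambda>x. min (\<alpha> x) (\<beta> x))"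
      using \<alpha>(1) \<beta>(1) by (rule continuous_map_real_min)
    moreover have "\<forall>x\<in>topspace X. 0 < min (\<alpha> x) (\<beta> x)"
      using \<alpha>(2) \<beta>(2) by simp
    ultimately show "\<exists>\<gamma>. continuous_map X euclideanreal \<gamma> \<and> (\<forall>x\<in>topspace X. 0 < \<gamma> x) \<and>
        sl_cball X Z g \<gamma> \<subseteq> \<G> \<inter> \<H>"
      by (intro exI[of _ "\<lambda>x. min (\<alpha> x) (\<beta> x)"] conjI)
  qed
next
  fix \<K>
  assume K: "\<forall>\<G>\<in>\<K>. sl_open X Z \<G>"
  show "sl_open X Z (\<Union>\<K>)"
  proof (rule sl_openI)
    show "\<Union>\<K> \<subseteq> cmaps X Z"
      using K sl_open_subset by (intro Union_least) blast
  next
    fix g assume "g \<in> \<Union>\<K>"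
    then obtain \<G> where \<G>: "\<G> \<in> \<K>" "g \<in> \<G>"
      by (rule UnionE)
    obtain \<alpha> where \<alpha>: "continuous_map X euclideanreal \<alpha>" "\<forall>x\<in>topspace X. 0 < \<alpha> x"
      "sl_cball X Z g \<alpha> \<subseteq> \<G>"
      by (rule sl_openD[OF bspec[OF K \<G>(1)] \<G>(2)])
    have "sl_cball X Z g \<alpha> \<subseteq> \<Union>\<K>"
      using \<alpha>(3) Union_upper[OF \<G>(1)] by (rule subset_trans)
    with \<alpha>(1,2) show "\<exists>\<alpha>. continuous_map X euclideanreal \<alpha> \<and> (\<forall>x\<in>topspace X. 0 < \<alpha> x) \<and>
        sl_cball X Z g \<alpha> \<subseteq> \<Union>\<K>"
      by (intro exI[of _ \<alpha>] conjI)
  qed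
qed

lemma openin_source_limitation_topology:
  "openin (source_limitation_topology X Z) = sl_open X Z"
  unfolding source_limitation_topology_def by (rule topology_inverse'[OF istopology_sl_open])

lemma topspace_source_limitation_topology [simp]:
  "topspace (source_limitation_topology X Z) = cmaps X Z"
proof (rule antisym)
  have "sl_cball X Z g (\<lambda>_. 1) \<subseteq> cmaps X Z" for g
    unfolding sl_cball_def by blast
  moreover have "continuous_map X euclideanreal (\<lambda>_. 1)" "\<forall>x\<in>topspace X. (0::real) < 1"
    by simp_all
  ultimately have "sl_open X Z (cmaps X Z)"
    by (intro sl_openI) (rule subset_refl, intro exI[of _ "\<lambda>_. 1"] conjI)
  then show "cmaps X Z \<subseteq> topspace (source_limitation_topology X Z)"
    by (intro openin_subset) (simp only: openin_source_limitation_topology)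
  have "sl_open X Z (topspace (source_limitation_topology X Z))"
    using openin_topspace[of "source_limitation_topology X Z"]
    by (simp only: openin_source_limitation_topology)
  then show "topspace (source_limitation_topology X Z) \<subseteq> cmaps X Z"
    by (rule sl_open_subset)
qed

text \<open>The cube \<open>[0,1]\<^sup>k\<close>, \<open>k = CARD('k)\<close>, with the Euclidean metric.\<close>

definition cube :: "(real ^ 'k) metric" where
  "cube = submetric euclidean_metric {x. \<forall>i. 0 \<le> x $ i \<and> x $ i \<le> 1}"

end

theory Submission
  imports Defs
begin

text \<open>Since \<open>f\<close> is perfect, \<open>f \<times> g\<close> is an \<open>\<omega>\<close>-map iff each fibre of \<open>g\<close> on each \<open>f\<^sup>-\<^sup>1(y)\<close> lies in a
  member of \<open>\<omega>\<close>; call \<open>q \<in> C(X, I\<^sup>k)\<close> good at \<open>y\<close> if it has this property at \<open>y\<close> and is close to \<open>g\<close> on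
  \<open>f\<^sup>-\<^sup>1(y)\<close>. By compactness goodness is stable under small changes of \<open>q\<close> and of \<open>y\<close>, which gives
  openness. For density it suffices to find a continuous \<open>\<theta>\<close> assigning to each \<open>y\<close> a map \<open>\<theta>(y)\<close>
  that is good at \<open>y\<close>, as one can then take \<open>h(x) = \<theta>(f(x))(x)\<close>.

  Families of good maps can be contracted: given maps \<open>q\<close> that are good at \<open>y\<close> and depend on \<open>s - 1\<close>
  parameters, slide \<open>q\<close> to its interpolation \<open>\<Sum>v. \<kappa>\<^sub>v q(\<xi>\<^sub>v)\<close> with respect to a fine partition of unity
  of order \<open>n + 1\<close> on \<open>f\<^sup>-\<^sup>1(y)\<close>, and then along a cone to an apex \<open>\<Sum>v. \<kappa>\<^sub>v b\<^sub>v\<close>. If a map on this cone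
  identifies points with different coefficients, then \<open>\<Sum>v. c\<^sub>v (b\<^sub>v + r q(\<xi>\<^sub>v)) = 0\<close> for some \<open>r \<ge> 0\<close> and
  some \<open>c \<noteq> 0\<close> of sum zero with at most \<open>2 n + 2\<close> nonzero entries. These are \<open>s + 2 n\<close> parameters
  up to scaling, so generic \<open>b\<close> avoid this if \<open>s + 2 n < k\<close>. As \<open>dim Y \<le> m\<close>, there are \<open>m + 1\<close> disjoint
  families of small open sets that together cover \<open>Y\<close>, and \<open>\<theta>\<close> is extended over one family at
  a time by such contractions, \<open>s = 0, \<dots>, m\<close>.\<close>

section \<open>Paracompact spaces\<close>

text \<open>The order of the choices shapes the proof. The apex for a new disjoint family has to be
  fixed before it is known which map \<open>\<theta>(y)\<close> will be contracted to it. So each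
  point of \<open>Y\<close> carries a finite set of maps parametrised by a cube that contains every
  possible value of \<open>\<theta>(y)\<close>, and the apex is put in general position to all of
  them at once. The first family needs no contraction; every later one adds a single parameter, the
  time. When family number s is treated there are thus s - 1 parameters, and with the factor r and 2
  n coefficients the bad apex vectors form a set of dimension at most s + 2 n. The last number is s
  = m, whence k = 2 n + 1 + m. General position is measured by null sets, so dependence on the
  parameters must be differentiable and not only continuous; the contractions are affine in the time
  and preserve this. For the same reason of order each stage prescribes only a cover
  \<open>\<Gamma>\<close>. The disjoint families are taken from the dimension of \<open>Y\<close> at
  the very end, when all demands on their smallness are known.\<close>

lemma paracompact_refinement:
  assumes "paracompact_space X" "open_cover X \<U>"
  obtains \<V> where "open_cover X \<V>" "refines \<V> \<U>" "locally_finite_in X \<V>"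
  using assms unfolding paracompact_space_def by blast

lemma locally_finite_in_fibre:
  assumes "locally_finite_in X \<U>" "x \<in> topspace X"
  shows "finite {U \<in> \<U>. x \<in> U}"
proof -
  obtain V where "x \<in> V" "finite {U \<in> \<U>. U \<inter> V \<noteq> {}}"
    using assms unfolding locally_finite_in_def by blast
  then show ?thesis by (elim finite_subset[rotated]) auto
qed

text \<open>The neighbourhoods of the points of \<open>S\<close> are refined to a locally finite
  family. The closure of each of its members that meet \<open>S\<close> misses \<open>T\<close>, and
  by local finiteness the union of these closures is closed, so its complement serves for
  \<open>T\<close>. Used with a point as \<open>T\<close> this yields regularity, and a second use
  then yields normality.\<close>

lemma paracompact_separation:
  assumes X: "paracompact_space X" and S: "closedin X S" and T: "T \<subseteq> topspace X"
    and sep: "\<And>s. s \<in> S \<Longrightarrow> \<exists>U V. openin X U \<and> openin X V \<and> s \<in> U \<and> T \<subseteq> V \<and> disjnt U V"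
  shows "\<exists>U V. openin X U \<and> openin X V \<and> S \<subseteq> U \<and> T \<subseteq> V \<and> disjnt U V"
proof -
  obtain U V where UV: "\<And>s. s \<in> S \<Longrightarrow>
      openin X (U s) \<and> openin X (V s) \<and> s \<in> U s \<and> T \<subseteq> V s \<and> disjnt (U s) (V s)"
    using sep by metis
  have "open_cover X (insert (topspace X - S) (U ` S))"
    unfolding open_cover_def
  proof (intro conjI ballI subset_antisym)
    show "openin X W" if "W \<in> insert (topspace X - S) (U ` S)" for W
      using that UV S by auto
    then show "\<Union>(insert (topspace X - S) (U ` S)) \<subseteq> topspace X"
      using openin_subset by blast
    show "topspace X \<subseteq> \<Union>(insert (topspace X - S) (U ` S))"
      using UV by auto
  qed
  then obtain \<V> where \<V>: "open_cover X \<V>" "refines \<V> (insert (topspace X - S) (U ` S))"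
      "locally_finite_in X \<V>"
    using X paracompact_refinement by blast
  define \<W> where "\<W> = {W \<in> \<V>. W \<inter> S \<noteq> {}}"
  have lf: "locally_finite_in X \<W>"
    by (rule locally_finite_in_subset[OF \<V>(3)]) (simp add: \<W>_def)
  have disj: "X closure_of W \<inter> T = {}" if W: "W \<in> \<W>" for W
  proof -
    obtain s where s: "s \<in> S" "W \<subseteq> U s"
      using W \<V>(2) unfolding \<W>_def refines_def by blast
    then have "V s \<inter> W = {}" using UV unfolding disjnt_def by blast
    then have "V s \<inter> X closure_of W = {}"
      using UV s by (simp add: openin_Int_closure_of_eq_empty)
    then show ?thesis using UV s by blast
  qed
  show ?thesis
  proof (intro exI conjI)
    show "openin X (\<Union>\<W>)"
      using \<V>(1) unfolding \<W>_def open_cover_def by blast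
    show "openin X (topspace X - \<Union>((\<lambda>W. X closure_of W) ` \<W>))"
      using closedin_Union_locally_finite_closure[OF lf] by blast
    show "S \<subseteq> \<Union>\<W>"
      using \<V>(1) closedin_subset[OF S] unfolding \<W>_def open_cover_def by blast
    show "T \<subseteq> topspace X - \<Union>((\<lambda>W. X closure_of W) ` \<W>)"
      using T disj by blast
    have "W \<subseteq> X closure_of W" if "W \<in> \<W>" for W
      using that \<V>(1) unfolding \<W>_def open_cover_def
      by (intro closure_of_subset) blast
    then show "disjnt (\<Union>\<W>) (topspace X - \<Union>((\<lambda>W. X closure_of W) ` \<W>))"
      unfolding disjnt_def by blast
  qed
qed

lemma paracompact_imp_normal_space:
  assumes "paracompact_space X"
  shows "normal_space X"
proof -
  have H: "Hausdorff_space X" using assms by (simp add: paracompact_space_def)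
  have reg: "\<exists>U V. openin X U \<and> openin X V \<and> S \<subseteq> U \<and> {t} \<subseteq> V \<and> disjnt U V"
    if "closedin X S" "t \<in> topspace X" "t \<notin> S" for S t
  proof (rule paracompact_separation[OF assms])
    fix s assume "s \<in> S"
    then have "s \<in> topspace X" "s \<noteq> t" using that closedin_subset by blast+
    then show "\<exists>U V. openin X U \<and> openin X V \<and> s \<in> U \<and> {t} \<subseteq> V \<and> disjnt U V"
      using H that unfolding Hausdorff_space_def by (metis empty_subsetI insert_subset)
  qed (use that in auto)
  show ?thesis
    unfolding normal_space_def
  proof (intro allI impI; elim conjE)
    fix S T assume ST: "closedin X S" "closedin X T" "disjnt S T"
    show "\<exists>U V. openin X U \<and> openin X V \<and> S \<subseteq> U \<and> T \<subseteq> V \<and> disjnt U V"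
    proof (rule paracompact_separation[OF assms ST(1)])
      fix s assume "s \<in> S"
      then have "s \<in> topspace X" "s \<notin> T"
        using ST closedin_subset unfolding disjnt_def by blast+
      then show "\<exists>U V. openin X U \<and> openin X V \<and> s \<in> U \<and> T \<subseteq> V \<and> disjnt U V"
        using reg[OF ST(2), of s] by (metis disjnt_sym insert_subset)
    qed (use ST closedin_subset in auto)
  qed
qed

lemma paracompact_closure_refinement:
  assumes X: "paracompact_space X" and \<U>: "open_cover X \<U>"
  obtains \<V> where "open_cover X \<V>" "locally_finite_in X \<V>"
    "\<And>V. V \<in> \<V> \<Longrightarrow> \<exists>U\<in>\<U>. X closure_of V \<subseteq> U"
proof -
  have H: "Hausdorff_space X" using X by (simp add: paracompact_space_def)
  define \<W> where "\<W> = {W. openin X W \<and> (\<exists>U\<in>\<U>. X closure_of W \<subseteq> U)}"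
  have "open_cover X \<W>"
    unfolding open_cover_def
  proof (intro conjI ballI subset_antisym subsetI)
    fix x assume x: "x \<in> topspace X"
    then obtain U where U: "U \<in> \<U>" "x \<in> U" "openin X U"
      using \<U> unfolding open_cover_def by blast
    have "closedin X {x}" using H x closedin_Hausdorff_singleton by metis
    then obtain W where "openin X W" "{x} \<subseteq> W" "X closure_of W \<subseteq> U"
      using paracompact_imp_normal_space[OF X] U unfolding normal_space_alt
      by (metis empty_subsetI insert_subset)
    then show "x \<in> \<Union>\<W>" using U unfolding \<W>_def by blast
  qed (use openin_subset in \<open>auto simp: \<W>_def\<close>)
  then obtain \<V> where \<V>: "open_cover X \<V>" "refines \<V> \<W>" "locally_finite_in X \<V>"
    using X paracompact_refinement by blast
  have "\<exists>U\<in>\<U>. X closure_of V \<subseteq> U" if "V \<in> \<V>" for V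
  proof -
    obtain W U where "V \<subseteq> W" "U \<in> \<U>" "X closure_of W \<subseteq> U"
      using \<V>(2) \<open>V \<in> \<V>\<close> unfolding refines_def \<W>_def by blast
    then show ?thesis
      using closure_of_mono[of V W X] by blast
  qed
  then show ?thesis using that \<V> by blast
qed

lemma compact_Hausdorff_imp_paracompact_space:
  assumes "compact_space X" "Hausdorff_space X"
  shows "paracompact_space X"
  unfolding paracompact_space_def
proof (intro conjI allI impI assms)
  fix \<U> assume \<U>: "open_cover X \<U>"
  then obtain \<V> where \<V>: "finite \<V>" "\<V> \<subseteq> \<U>" "topspace X \<subseteq> \<Union>\<V>"
    using assms(1) unfolding compact_space_alt open_cover_def by (metis subset_refl)
  then have "open_cover X \<V>"
    using \<U> unfolding open_cover_def by blast
  moreover have "locally_finite_in X \<V>"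
    using \<open>open_cover X \<V>\<close> finite_imp_locally_finite_in[OF \<V>(1), of X]
    unfolding open_cover_def by simp
  ultimately show "\<exists>\<V>. open_cover X \<V> \<and> refines \<V> \<U> \<and> locally_finite_in X \<V>"
    using \<V>(2) unfolding refines_def by blast
qed

text \<open>Near a given point only the finitely many members that meet a neighbourhood contribute,
  so there the sum is one fixed finite sum. The index set varies with \<open>x\<close> because
  \<open>sum\<close> over an infinite set is 0 by convention.\<close>

lemma continuous_map_locally_finite_sum:
  fixes \<phi> :: "'a set \<Rightarrow> 'a \<Rightarrow> 'c::real_normed_vector"
  assumes lf: "locally_finite_in X \<U>"
    and cont: "\<And>U. U \<in> \<U> \<Longrightarrow> continuous_map X euclidean (\<phi> U)"
    and zero: "\<And>U x. \<lbrakk>U \<in> \<U>; x \<in> topspace X; x \<notin> U\<rbrakk> \<Longrightarrow> \<phi> U x = 0"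
  shows "continuous_map X euclidean (\<lambda>x. \<Sum>U\<in>{U\<in>\<U>. x \<in> U}. \<phi> U x)"
proof -
  obtain V where V: "\<And>x. x \<in> topspace X \<Longrightarrow>
      openin X (V x) \<and> x \<in> V x \<and> finite {U \<in> \<U>. U \<inter> V x \<noteq> {}}"
    using lf unfolding locally_finite_in_def by metis
  have eq: "(\<Sum>U\<in>{U\<in>\<U>. x \<in> U}. \<phi> U x) = (\<Sum>U\<in>{U \<in> \<U>. U \<inter> V z \<noteq> {}}. \<phi> U x)"
    if "z \<in> topspace X" "x \<in> topspace X" "x \<in> V z" for x z
    using that V zero by (intro sum.mono_neutral_left) auto
  show ?thesis
  proof (rule pasting_lemma[where I = "topspace X" and T = V
        and f = "\<lambda>z x. \<Sum>U\<in>{U \<in> \<U>. U \<inter> V z \<noteq> {}}. \<phi> U x"])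
    show "continuous_map (subtopology X (V z)) euclidean
        (\<lambda>x. \<Sum>U\<in>{U \<in> \<U>. U \<inter> V z \<noteq> {}}. \<phi> U x)" if "z \<in> topspace X" for z
      using V[OF that] cont
      by (intro continuous_map_sum continuous_map_from_subtopology) auto
    show "(\<Sum>U\<in>{U \<in> \<U>. U \<inter> V i \<noteq> {}}. \<phi> U x) = (\<Sum>U\<in>{U \<in> \<U>. U \<inter> V j \<noteq> {}}. \<phi> U x)"
      if "i \<in> topspace X" "j \<in> topspace X" "x \<in> topspace X \<inter> V i \<inter> V j" for i j x
      using eq[of i x] eq[of j x] that by simp
  qed (use V eq in auto)
qed

lemma paracompact_partition_of_unity:
  assumes X: "paracompact_space X" and \<U>: "open_cover X \<U>" and lf: "locally_finite_in X \<U>"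
  obtains \<phi> :: "'a set \<Rightarrow> 'a \<Rightarrow> real" where
    "\<And>U. U \<in> \<U> \<Longrightarrow> continuous_map X euclideanreal (\<phi> U)"
    "\<And>U x. \<lbrakk>U \<in> \<U>; x \<in> topspace X\<rbrakk> \<Longrightarrow> 0 \<le> \<phi> U x"
    "\<And>U x. \<lbrakk>U \<in> \<U>; x \<in> topspace X; x \<notin> U\<rbrakk> \<Longrightarrow> \<phi> U x = 0"
    "\<And>x. x \<in> topspace X \<Longrightarrow> (\<Sum>U\<in>{U\<in>\<U>. x \<in> U}. \<phi> U x) = 1"
proof -
  obtain \<V> where \<V>: "open_cover X \<V>" "locally_finite_in X \<V>"
    "\<And>V. V \<in> \<V> \<Longrightarrow> \<exists>U\<in>\<U>. X closure_of V \<subseteq> U"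
    using paracompact_closure_refinement[OF X \<U>] by blast
  \<comment> \<open>A closed shrinking of the cover, closed by local finiteness. Since the sets
    \<open>C U\<close> still cover, Urysohn functions equal to 1 on them have a positive sum and can
    be normalised.\<close>
  define C where "C U = \<Union>((\<lambda>V. X closure_of V) ` {V \<in> \<V>. X closure_of V \<subseteq> U})" for U
  have clC: "closedin X (C U)" for U
    unfolding C_def
    by (rule closedin_Union_locally_finite_closure) (rule locally_finite_in_subset[OF \<V>(2)], blast)
  have CU: "C U \<subseteq> U" for U unfolding C_def by blast
  have cov: "\<exists>U\<in>\<U>. x \<in> C U" if x: "x \<in> topspace X" for x
  proof -
    obtain V where V: "V \<in> \<V>" "x \<in> V"
      using x \<V>(1) unfolding open_cover_def by blast
    then have "x \<in> X closure_of V"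
      using \<V>(1) x by (meson closure_of_subset open_cover_def openin_subset subsetD)
    then show ?thesis using \<V>(3)[OF V(1)] V unfolding C_def by blast
  qed
  have "\<exists>f. continuous_map X (top_of_set {0..1::real}) f \<and> f ` (topspace X - U) \<subseteq> {0} \<and> f ` C U \<subseteq> {1}"
    if "U \<in> \<U>" for U
  proof -
    have "closedin X (topspace X - U)"
      using \<U> that unfolding open_cover_def by blast
    then show ?thesis
      using Urysohn_lemma[OF paracompact_imp_normal_space[OF X], of "topspace X - U" "C U" 0 1]
        clC CU that by (metis DiffD2 disjnt_iff subsetD zero_le_one)
  qed
  then obtain f where f: "\<And>U. U \<in> \<U> \<Longrightarrow> continuous_map X (top_of_set {0..1::real}) (f U)
       \<and> f U ` (topspace X - U) \<subseteq> {0} \<and> f U ` C U \<subseteq> {1}"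
    by metis
  have fc: "continuous_map X euclideanreal (f U)" if "U \<in> \<U>" for U
    using f[OF that] by (simp add: continuous_map_in_subtopology)
  have f0: "f U x = 0" if "U \<in> \<U>" "x \<in> topspace X" "x \<notin> U" for U x
    using f[OF that(1)] that by blast
  have fpos: "0 \<le> f U x" if "U \<in> \<U>" "x \<in> topspace X" for U x
    using f[OF that(1)] that by (auto simp: continuous_map_in_subtopology image_subset_iff Pi_iff)
  define S where "S x = (\<Sum>U\<in>{U\<in>\<U>. x \<in> U}. f U x)" for x
  have Sc: "continuous_map X euclideanreal S"
    unfolding S_def using continuous_map_locally_finite_sum[OF lf fc f0] by auto
  have Spos: "S x > 0" if x: "x \<in> topspace X" for x
  proof -
    obtain U where U: "U \<in> \<U>" "x \<in> C U" using cov x by blast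
    then have "f U x = 1" using f by blast
    moreover have "f U x \<le> S x"
      unfolding S_def
      by (rule member_le_sum) (use U CU fpos x locally_finite_in_fibre[OF lf x] in auto)
    ultimately show ?thesis by linarith
  qed
  show ?thesis
  proof (rule that[of "\<lambda>U x. f U x / S x"])
    show "continuous_map X euclideanreal (\<lambda>x. f U x / S x)" if "U \<in> \<U>" for U
      using fc[OF that] Sc Spos by (intro continuous_map_real_divide) force+
    show "0 \<le> f U x / S x" if "U \<in> \<U>" "x \<in> topspace X" for U x
      using fpos Spos that by (simp add: less_imp_le)
    show "f U x / S x = 0" if "U \<in> \<U>" "x \<in> topspace X" "x \<notin> U" for U x
      using f0 that by simp
    show "(\<Sum>U\<in>{U\<in>\<U>. x \<in> U}. f U x / S x) = 1" if "x \<in> topspace X" for x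
      using Spos[OF that] unfolding sum_divide_distrib[symmetric] S_def by simp
  qed
qed

section \<open>Covering dimension and disjoint families\<close>

lemma openin_finite_Ball:
  assumes "finite I" "\<And>i. i \<in> I \<Longrightarrow> openin X {z \<in> topspace X. P i z}"
  shows "openin X {z \<in> topspace X. \<forall>i\<in>I. P i z}"
  using assms
proof (induction I)
  case (insert i I)
  have "{z \<in> topspace X. \<forall>j\<in>insert i I. P j z} =
      {z \<in> topspace X. P i z} \<inter> {z \<in> topspace X. \<forall>j\<in>I. P j z}" by blast
  then show ?case using insert by (simp add: openin_Int)
qed simp

lemma openin_less_continuous:
  assumes "continuous_map X euclideanreal f" "continuous_map X euclideanreal g"
  shows "openin X {z \<in> topspace X. f z < g z}"
proof -
  have "openin X {z \<in> topspace X. g z - f z \<in> {0<..}}"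
    by (intro openin_continuous_map_preimage[where Y = euclideanreal] continuous_map_diff assms) auto
  then show ?thesis by simp
qed

lemma closedin_le_continuous:
  assumes "continuous_map X euclideanreal f" "continuous_map X euclideanreal g"
  shows "closedin X {z \<in> topspace X. f z \<le> g z}"
proof -
  have "closedin X {z \<in> topspace X. g z - f z \<in> {0..}}"
    by (intro closedin_continuous_map_preimage[where Y = euclideanreal] continuous_map_diff assms) auto
  then show ?thesis by simp
qed

text \<open>The members are the open stars of the barycentres in the nerve of the cover: for a finite set
  of members, the points at which exactly these have the largest coordinates in a
  partition of unity.\<close>

lemma barycentric_disjoint_families:
  assumes Y: "paracompact_space Y" and \<U>: "open_cover Y \<U>" and lf: "locally_finite_in Y \<U>"
  shows "\<exists>D :: nat \<Rightarrow> 'b set set.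
    (\<forall>i. (\<forall>V\<in>D i. openin Y V) \<and> disjoint (D i) \<and> refines (D i) \<U>) \<and>
    (\<forall>y\<in>topspace Y. \<exists>i. i < card {U \<in> \<U>. y \<in> U} \<and> y \<in> \<Union>(D i))"
proof -
  obtain \<phi> where \<phi>c: "\<And>U. U \<in> \<U> \<Longrightarrow> continuous_map Y euclideanreal (\<phi> U)"
    and \<phi>pos: "\<And>U x. \<lbrakk>U \<in> \<U>; x \<in> topspace Y\<rbrakk> \<Longrightarrow> 0 \<le> \<phi> U x"
    and \<phi>0: "\<And>U x. \<lbrakk>U \<in> \<U>; x \<in> topspace Y; x \<notin> U\<rbrakk> \<Longrightarrow> \<phi> U x = 0"
    and \<phi>1: "\<And>x. x \<in> topspace Y \<Longrightarrow> (\<Sum>U\<in>{U\<in>\<U>. x \<in> U}. \<phi> U x) = (1::real)"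
    using paracompact_partition_of_unity[OF Y \<U> lf] by blast
  define B where "B T = {y \<in> topspace Y. (\<forall>U\<in>T. 0 < \<phi> U y) \<and>
      (\<forall>U\<in>T. \<forall>U'\<in>\<U> - T. \<phi> U' y < \<phi> U y)}" for T
  define D where "D i = B ` {T. T \<subseteq> \<U> \<and> finite T \<and> card T = Suc i}" for i
  have openB: "openin Y (B T)" if T: "T \<subseteq> \<U>" "finite T" for T
  proof (subst openin_subopen, intro ballI)
    fix y assume y: "y \<in> B T"
    then obtain N where N: "openin Y N" "y \<in> N" "finite {U \<in> \<U>. U \<inter> N \<noteq> {}}"
      using lf unfolding locally_finite_in_def B_def by blast
    \<comment> \<open>All members that miss \<open>N\<close> have \<phi> equal to 0 on
      \<open>N\<close>, so near \<open>y\<close> the infinitely many comparisons in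
      \<open>B T\<close> follow from the finitely many for \<open>F\<close> together with positivity
      on \<open>T\<close>.\<close>
    define F where "F = {U \<in> \<U>. U \<inter> N \<noteq> {}} - T"
    define O' where "O' = N \<inter> {z \<in> topspace Y. \<forall>U\<in>T. 0 < \<phi> U z} \<inter>
        {z \<in> topspace Y. \<forall>U\<in>T. z \<in> {z \<in> topspace Y. \<forall>U'\<in>F. \<phi> U' z < \<phi> U z}}"
    have F: "finite F" "F \<subseteq> \<U>" using N unfolding F_def by auto
    have "openin Y O'"
      unfolding O'_def
    proof (intro openin_Int N openin_finite_Ball T)
      fix U assume "U \<in> T"
      then have U: "U \<in> \<U>" using T by blast
      show "openin Y {z \<in> topspace Y. 0 < \<phi> U z}"
        by (rule openin_less_continuous) (use \<phi>c[OF U] in auto)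
      have "openin Y {z \<in> topspace Y. \<forall>U'\<in>F. \<phi> U' z < \<phi> U z}"
        by (intro openin_finite_Ball F openin_less_continuous \<phi>c U) (use F in blast)
      then show "openin Y {z \<in> topspace Y. z \<in> {z \<in> topspace Y. \<forall>U'\<in>F. \<phi> U' z < \<phi> U z}}"
        by simp
    qed
    moreover have "y \<in> O'"
      using y N F unfolding O'_def B_def F_def by auto
    moreover have "O' \<subseteq> B T"
    proof
      fix z assume z: "z \<in> O'"
      have "\<phi> U' z < \<phi> U z" if "U \<in> T" "U' \<in> \<U> - T" for U U'
      proof (cases "U' \<in> F")
        case False
        then have "\<phi> U' z = 0"
          using that z \<phi>0 unfolding O'_def F_def by blast
        then show ?thesis using that z unfolding O'_def by simp
      qed (use z that in \<open>auto simp: O'_def\<close>)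
      then show "z \<in> B T" using z unfolding O'_def B_def by blast
    qed
    ultimately show "\<exists>S. openin Y S \<and> y \<in> S \<and> S \<subseteq> B T" by blast
  qed
  show ?thesis
  proof (intro exI[of _ D] conjI allI ballI)
    show "openin Y V" if "V \<in> D i" for i V
      using that openB unfolding D_def by blast
    show "disjoint (D i)" for i
    proof (rule disjointI)
      fix V V' assume V: "V \<in> D i" "V' \<in> D i" "V \<noteq> V'"
      then obtain T T' where T: "V = B T" "T \<subseteq> \<U>" "finite T" "card T = Suc i"
          "V' = B T'" "T' \<subseteq> \<U>" "finite T'" "card T' = Suc i"
        unfolding D_def by blast
      \<comment> \<open>Distinct sets of the same size each have an element outside the other, and
        at a common point of \<open>B T\<close> and \<open>B T'\<close> each of the two coordinates
        would exceed the other.\<close>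
      have "\<not> T \<subseteq> T'" "\<not> T' \<subseteq> T"
        using T V(3) card_subset_eq by metis+
      then obtain U U' where "U \<in> T - T'" "U' \<in> T' - T" by blast
      then have "\<phi> U' y < \<phi> U y \<and> \<phi> U y < \<phi> U' y" if "y \<in> B T" "y \<in> B T'" for y
        using that T(2,6) unfolding B_def by blast
      then show "V \<inter> V' = {}" unfolding T by fastforce
    qed
    show "refines (D i) \<U>" for i
      unfolding refines_def
    proof
      fix V assume "V \<in> D i"
      then obtain T where T: "V = B T" "T \<subseteq> \<U>" "card T = Suc i" unfolding D_def by blast
      then obtain U where "U \<in> T" by (metis card.empty ex_in_conv nat.distinct(1))
      then have "B T \<subseteq> U" using \<phi>0 T unfolding B_def by fastforce
      then show "\<exists>U\<in>\<U>. V \<subseteq> U" using \<open>U \<in> T\<close> T by blast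
    qed
    fix y assume y: "y \<in> topspace Y"
    let ?F = "{U \<in> \<U>. y \<in> U}"
    \<comment> \<open>The support of the partition of unity at \<open>y\<close>. All other
      coordinates are 0 there, so \<open>y\<close> lies in \<open>B T\<close>; as \<open>T\<close>
      is part of \<open>?F\<close>, its index \<open>card T - 1\<close> is below the order of the
      cover at \<open>y\<close>.\<close>
    define T where "T = {U \<in> ?F. 0 < \<phi> U y}"
    have F: "finite ?F" by (rule locally_finite_in_fibre[OF lf y])
    have "T \<noteq> {}"
    proof
      assume "T = {}"
      then have "\<phi> U y = 0" if "U \<in> ?F" for U
        using that \<phi>pos[of U y] y unfolding T_def by force
      then show False using \<phi>1[OF y] by simp
    qed
    moreover have T: "finite T" "T \<subseteq> \<U>"
      using finite_subset[OF _ F, of T] unfolding T_def by auto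
    ultimately obtain i where i: "card T = Suc i"
      using card_gt_0_iff[of T] gr0_implies_Suc by blast
    have zero: "\<phi> U y = 0" if "U \<in> \<U> - T" for U
      using that \<phi>0[of U y] \<phi>pos[of U y] y unfolding T_def by force
    have pos: "0 < \<phi> U y" if "U \<in> T" for U
      using that unfolding T_def by blast
    have "\<phi> U' y < \<phi> U y" if "U \<in> T" "U' \<in> \<U> - T" for U U'
      using pos[OF that(1)] zero[OF that(2)] by simp
    then have "y \<in> B T"
      using y pos unfolding B_def by blast
    then have "y \<in> \<Union>(D i)" unfolding D_def using T i by blast
    moreover have "i < card ?F"
      using card_mono[OF F, of T] i unfolding T_def by fastforce
    ultimately show "\<exists>i. i < card {U \<in> \<U>. y \<in> U} \<and> y \<in> \<Union>(D i)" by blast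
  qed
qed

text \<open>The dimension speaks of finite covers only. On \<open>A\<close> just the first
  \<open>N\<close> members matter, and with the complement of \<open>A\<close> they form a finite
  cover, whose refinement of order \<open>m + 1\<close> replaces them on \<open>A\<close>. Off
  \<open>A\<close> nothing is lost, and since sets only shrink, order bounds reached earlier
  elsewhere persist.\<close>

lemma covering_dim_shrink_on_closed:
  fixes U :: "nat \<Rightarrow> 'b set"
  assumes dim: "covering_dim_le Y m" and A: "closedin Y A"
    and U: "\<And>j. openin Y (U j)" "(\<Union>j. U j) = topspace Y"
    and fin: "\<And>j. j \<ge> N \<Longrightarrow> U j \<inter> A = {}"
  shows "\<exists>U'. (\<forall>j. openin Y (U' j) \<and> U' j \<subseteq> U j \<and> U j - A \<subseteq> U' j) \<and> (\<Union>j. U' j) = topspace Y \<and>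
    (\<forall>y\<in>A. finite {j. y \<in> U' j} \<and> card {j. y \<in> U' j} \<le> m + 1)"
proof -
  define \<W> where "\<W> = insert (topspace Y - A) (U ` {..<N})"
  have cov: "open_cover Y \<W>"
    unfolding open_cover_def
  proof (intro conjI ballI subset_antisym)
    show op: "openin Y W" if "W \<in> \<W>" for W
      using that A U(1) unfolding \<W>_def by auto
    then show "\<Union>\<W> \<subseteq> topspace Y" using openin_subset by blast
    show "topspace Y \<subseteq> \<Union>\<W>"
    proof
      fix y assume y: "y \<in> topspace Y"
      then obtain j where "y \<in> U j" using U(2) by blast
      then show "y \<in> \<Union>\<W>"
        using y fin[of j] unfolding \<W>_def by (cases "j < N"; cases "y \<in> A") auto
    qed
  qed
  have "finite \<W>" unfolding \<W>_def by simp
  then have "\<exists>\<V>. finite \<V> \<and> open_cover Y \<V> \<and> refines \<V> \<W> \<and>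
      (\<forall>y\<in>topspace Y. card {V \<in> \<V>. y \<in> V} \<le> m + 1)"
    using dim[unfolded covering_dim_le_def, rule_format, of \<W>] cov by simp
  then obtain \<V> where \<V>: "finite \<V>" "open_cover Y \<V>" "refines \<V> \<W>"
      "\<And>y. y \<in> topspace Y \<Longrightarrow> card {V \<in> \<V>. y \<in> V} \<le> m + 1"
    by metis
  define \<V>' where "\<V>' = {V \<in> \<V>. \<not> V \<subseteq> topspace Y - A}"
  have "\<forall>V\<in>\<V>'. \<exists>j. V \<subseteq> U j"
    using \<V>(3) unfolding \<V>'_def refines_def \<W>_def by blast
  then obtain \<rho> where \<rho>: "\<And>V. V \<in> \<V>' \<Longrightarrow> V \<subseteq> U (\<rho> V)" by metis
  define U' where "U' j = (U j - A) \<union> \<Union>{V \<in> \<V>'. \<rho> V = j}" for j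
  have sub: "U' j \<subseteq> U j" for j using \<rho> unfolding U'_def by blast
  have op: "openin Y (U' j)" for j
    unfolding U'_def
    by (intro openin_Un openin_diff U A openin_Union) (use \<V>(2) in \<open>auto simp: \<V>'_def open_cover_def\<close>)
  have "topspace Y \<subseteq> (\<Union>j. U' j)"
  proof
    fix y assume y: "y \<in> topspace Y"
    show "y \<in> (\<Union>j. U' j)"
    proof (cases "y \<in> A")
      case True
      obtain V where "V \<in> \<V>" "y \<in> V" using y \<V>(2) unfolding open_cover_def by blast
      then have "V \<in> \<V>'" using True unfolding \<V>'_def by blast
      then show ?thesis using \<open>y \<in> V\<close> unfolding U'_def by blast
    qed (use y U(2) in \<open>auto simp: U'_def\<close>)
  qed
  moreover have "finite {j. y \<in> U' j} \<and> card {j. y \<in> U' j} \<le> m + 1" if "y \<in> A" for y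
  proof -
    have "y \<in> topspace Y" using A that closedin_subset by blast
    have sub: "{j. y \<in> U' j} \<subseteq> \<rho> ` {V \<in> \<V>. y \<in> V}"
      using that unfolding U'_def \<V>'_def by blast
    have fin: "finite {V \<in> \<V>. y \<in> V}" using \<V>(1) by simp
    have "card {j. y \<in> U' j} \<le> card {V \<in> \<V>. y \<in> V}"
      using sub fin by (meson card_image_le card_mono finite_imageI le_trans)
    then show ?thesis
      using \<V>(4)[OF \<open>y \<in> topspace Y\<close>] finite_subset[OF sub] fin by simp
  qed
  moreover have "U j - A \<subseteq> U' j" for j unfolding U'_def by blast
  ultimately show ?thesis
    using op sub openin_subset[OF op] by (intro exI[of _ U']) blast
qed

text \<open>The cover is shrunk successively on the closed shells \<open>{y. r \<le> g y \<le> r + 1}\<close> of a function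
  \<open>g\<close>, each of which meets only finitely many members; shrinking never increases the order.\<close>

lemma countable_cover_order:
  fixes C :: "nat \<Rightarrow> 'b set"
  assumes Y: "paracompact_space Y" and dim: "covering_dim_le Y m"
    and C: "\<And>i. openin Y (C i)" "(\<Union>i. C i) = topspace Y"
  shows "\<exists>E. (\<forall>i. E i \<subseteq> C i) \<and> open_cover Y (range E) \<and> locally_finite_in Y (range E) \<and>
    (\<forall>y\<in>topspace Y. card {V \<in> range E. y \<in> V} \<le> m + 1)"
proof -
  have "open_cover Y (range C)" using C unfolding open_cover_def by auto
  then obtain \<V> where \<V>: "open_cover Y \<V>" "refines \<V> (range C)" "locally_finite_in Y \<V>"
    using Y paracompact_refinement by blast
  then have "\<forall>V\<in>\<V>. \<exists>i. V \<subseteq> C i" unfolding refines_def by blast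
  then obtain \<rho> where \<rho>: "\<And>V. V \<in> \<V> \<Longrightarrow> V \<subseteq> C (\<rho> V)" by metis
  obtain \<phi> where \<phi>c: "\<And>U. U \<in> \<V> \<Longrightarrow> continuous_map Y euclideanreal (\<phi> U)"
    and \<phi>pos: "\<And>U x. \<lbrakk>U \<in> \<V>; x \<in> topspace Y\<rbrakk> \<Longrightarrow> 0 \<le> \<phi> U x"
    and \<phi>0: "\<And>U x. \<lbrakk>U \<in> \<V>; x \<in> topspace Y; x \<notin> U\<rbrakk> \<Longrightarrow> \<phi> U x = 0"
    and \<phi>1: "\<And>x. x \<in> topspace Y \<Longrightarrow> (\<Sum>U\<in>{U\<in>\<V>. x \<in> U}. \<phi> U x) = (1::real)"
    using paracompact_partition_of_unity[OF Y \<V>(1,3)] by blast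
  \<comment> \<open>The mean, with weights \<open>\<phi> V y\<close>, of the indices of the members
    around \<open>y\<close>. Some index of a member containing \<open>y\<close> is at most this
    mean, so the sets \<open>U j\<close> below still cover although each is cut down to
    \<open>real j - 1 < g y\<close>; the cut makes every set where \<open>g\<close> is below a
    constant meet only finitely many of them.\<close>
  define g where "g y = (\<Sum>V\<in>{V\<in>\<V>. y \<in> V}. real (\<rho> V) * \<phi> V y)" for y
  have gc: "continuous_map Y euclideanreal g"
    unfolding g_def
    by (rule continuous_map_locally_finite_sum[OF \<V>(3)]) (auto intro!: continuous_map_real_mult \<phi>c \<phi>0)
  have g0: "0 \<le> g y" if "y \<in> topspace Y" for y
    unfolding g_def using that \<phi>pos by (intro sum_nonneg) auto
  define U where "U j = {y \<in> topspace Y. real j - 1 < g y} \<inter> \<Union>{V \<in> \<V>. \<rho> V = j}" for j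
  have Uop: "openin Y (U j)" for j
    unfolding U_def using \<V>(1) gc
    by (intro openin_Int openin_less_continuous openin_Union) (auto simp: open_cover_def)
  have UC: "U j \<subseteq> C j" for j using \<rho> unfolding U_def by blast
  have Ucov: "(\<Union>j. U j) = topspace Y"
  proof (intro subset_antisym subsetI)
    fix y assume y: "y \<in> topspace Y"
    have "\<exists>V\<in>\<V>. y \<in> V \<and> real (\<rho> V) \<le> g y"
    proof (rule ccontr)
      assume "\<not> ?thesis"
      then have gt: "real (\<rho> V) - g y > 0" if "V \<in> \<V>" "y \<in> V" for V
        using that by force
      let ?F = "{V\<in>\<V>. y \<in> V}"
      have "(\<Sum>V\<in>?F. (real (\<rho> V) - g y) * \<phi> V y) =
          (\<Sum>V\<in>?F. real (\<rho> V) * \<phi> V y) - g y * (\<Sum>V\<in>?F. \<phi> V y)"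
        by (simp add: left_diff_distrib sum_subtractf sum_distrib_left)
      also have "\<dots> = g y - g y * (\<Sum>V\<in>?F. \<phi> V y)" unfolding g_def ..
      also have "\<dots> = 0" using \<phi>1[OF y] by simp
      finally have "(\<Sum>V\<in>?F. (real (\<rho> V) - g y) * \<phi> V y) = 0" .
      moreover have "0 \<le> (real (\<rho> V) - g y) * \<phi> V y" if "V \<in> ?F" for V
        using gt[of V] \<phi>pos[of V y] that y by (intro mult_nonneg_nonneg) auto
      ultimately have "\<forall>V\<in>?F. (real (\<rho> V) - g y) * \<phi> V y = 0"
        by (subst (asm) sum_nonneg_eq_0_iff) (auto simp: locally_finite_in_fibre[OF \<V>(3) y])
      then have "\<forall>V\<in>?F. \<phi> V y = 0" using gt by force
      then show False using \<phi>1[OF y] by simp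
    qed
    then show "y \<in> (\<Union>j. U j)" using y unfolding U_def by force
  qed (use openin_subset[OF Uop] in blast)
  define A where "A r = {y \<in> topspace Y. real r \<le> g y} \<inter> {y \<in> topspace Y. g y \<le> real r + 1}" for r
  have Acl: "closedin Y (A r)" for r
    unfolding A_def using gc by (intro closedin_Int closedin_le_continuous) auto
  have UA: "U j \<inter> A r = {}" if "j \<ge> r + 2" for j r
    using that unfolding U_def A_def by force
  define P where "P S \<longleftrightarrow> (\<forall>j. openin Y (S j) \<and> S j \<subseteq> U j) \<and> (\<Union>j. S j) = topspace Y" for S :: "nat \<Rightarrow> 'b set"
  define Q where "Q r S S' \<longleftrightarrow> (\<forall>j. S' j \<subseteq> S j \<and> S j - A r \<subseteq> S' j) \<and>
    (\<forall>y\<in>A r. finite {j. y \<in> S' j} \<and> card {j. y \<in> S' j} \<le> m + 1)" for r and S S' :: "nat \<Rightarrow> 'b set"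
  have "\<exists>S. \<forall>r. P (S r) \<and> Q r (S r) (S (Suc r))"
  proof (rule dependent_nat_choice)
    show "\<exists>S. P S" by (rule exI[of _ U]) (simp add: P_def Uop Ucov)
    fix S r assume S: "P S"
    have "S j \<inter> A r = {}" if "j \<ge> r + 2" for j
    proof -
      have "S j \<subseteq> U j" using S unfolding P_def by simp
      then show ?thesis using UA[OF that] by blast
    qed
    then have "\<exists>S'. (\<forall>j. openin Y (S' j) \<and> S' j \<subseteq> S j \<and> S j - A r \<subseteq> S' j) \<and>
        (\<Union>j. S' j) = topspace Y \<and>
        (\<forall>y\<in>A r. finite {j. y \<in> S' j} \<and> card {j. y \<in> S' j} \<le> m + 1)"
      using S unfolding P_def by (intro covering_dim_shrink_on_closed[OF dim Acl]) auto
    then obtain S' where S': "\<forall>j. openin Y (S' j) \<and> S' j \<subseteq> S j \<and> S j - A r \<subseteq> S' j"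
        "(\<Union>j. S' j) = topspace Y"
        "\<forall>y\<in>A r. finite {j. y \<in> S' j} \<and> card {j. y \<in> S' j} \<le> m + 1" by metis
    have "S' j \<subseteq> U j" for j using S S'(1) unfolding P_def by blast
    then have "P S' \<and> Q r S S'"
      using S' unfolding P_def Q_def by simp
    then show "\<exists>S'. P S' \<and> Q r S S'" by blast
  qed
  then obtain S where P: "\<And>r. P (S r)" and Q: "\<And>r. Q r (S r) (S (Suc r))" by blast
  have dec: "S r' j \<subseteq> S r j" if "r \<le> r'" for r r' j
    using lift_Suc_antimono_le[of "\<lambda>r. S r j"] Q that unfolding Q_def by blast
  \<comment> \<open>The limit of the successive shrinkings. Where \<open>g y < real R\<close>, the
    shells from number \<open>R\<close> on are not met and nothing changes after step
    \<open>R\<close>; this keeps the infinite intersections open and covering.\<close>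
  define E where "E j = (\<Inter>r. S r j)" for j
  have stab: "y \<in> E j" if y: "y \<in> S R j" "g y < real R" for y R j
  proof -
    have "y \<in> S r j" if "r \<ge> R" for r
      using that
    proof (induction r rule: dec_induct)
      case (step r)
      then have "y \<notin> A r" using y unfolding A_def by force
      then show ?case using step Q[of r] unfolding Q_def by blast
    qed (rule y)
    then have "y \<in> S r j" for r
      using dec[of r "max r R" j] max.cobounded1 max.cobounded2 by blast
    then show ?thesis unfolding E_def by blast
  qed
  have ES: "E j \<subseteq> S r j" for r j unfolding E_def by blast
  have EU: "E j \<subseteq> U j" for j using ES[of j 0] P[of 0] unfolding P_def by blast
  have Ltop: "openin Y {y \<in> topspace Y. g y < real R}" for R
    using gc by (intro openin_less_continuous) auto
  have Eop: "openin Y (E j)" for j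
  proof (subst openin_subopen, intro ballI)
    fix y assume y: "y \<in> E j"
    obtain R where R: "g y < real R" using reals_Archimedean2 by blast
    have "openin Y (S R j \<inter> {y \<in> topspace Y. g y < real R})"
      using P[of R] Ltop unfolding P_def by (intro openin_Int) auto
    moreover have "y \<in> S R j \<inter> {y \<in> topspace Y. g y < real R}"
      using y R ES EU Uop openin_subset by blast
    ultimately show "\<exists>T. openin Y T \<and> y \<in> T \<and> T \<subseteq> E j" using stab by blast
  qed
  have Ecov: "open_cover Y (range E)"
    unfolding open_cover_def
  proof (intro conjI ballI subset_antisym subsetI)
    fix y assume y: "y \<in> topspace Y"
    obtain R where R: "g y < real R" using reals_Archimedean2 by blast
    obtain j where "y \<in> S R j" using P[of R] y unfolding P_def by blast
    then show "y \<in> \<Union>(range E)" using stab R by blast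
  qed (use Eop openin_subset[OF Eop] in auto)
  show ?thesis
  proof (intro exI[of _ E] conjI allI ballI Ecov)
    show "E i \<subseteq> C i" for i using EU UC by blast
    show "locally_finite_in Y (range E)"
      unfolding locally_finite_in_def
    proof (intro conjI ballI)
      show "\<Union>(range E) \<subseteq> topspace Y" using Ecov unfolding open_cover_def by simp
      fix y assume y: "y \<in> topspace Y"
      obtain R where R: "g y < real R" using reals_Archimedean2 by blast
      let ?L = "{y \<in> topspace Y. g y < real R}"
      have disj: "E j \<inter> ?L = {}" if "j \<ge> R + 1" for j
      proof -
        have "E j \<subseteq> {y. real j - 1 < g y}" using EU unfolding U_def by blast
        then show ?thesis using that by force
      qed
      have "{V \<in> range E. V \<inter> ?L \<noteq> {}} \<subseteq> E ` {..<R + 1}"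
      proof (intro subsetI; elim CollectE conjE imageE)
        fix V j assume "V \<inter> ?L \<noteq> {}" "V = E j"
        then have "j < R + 1" using disj[of j] by (metis not_le)
        then show "V \<in> E ` {..<R + 1}" using \<open>V = E j\<close> by blast
      qed
      then have "finite {V \<in> range E. V \<inter> ?L \<noteq> {}}" by (rule finite_subset) simp
      then show "\<exists>V. openin Y V \<and> y \<in> V \<and> finite {U \<in> range E. U \<inter> V \<noteq> {}}"
        using Ltop[of R] y R by blast
    qed
    fix y assume y: "y \<in> topspace Y"
    define r where "r = nat \<lfloor>g y\<rfloor>"
    have "y \<in> A r" using y g0[OF y] unfolding A_def r_def by simp
    then have fin: "finite {j. y \<in> S (Suc r) j}" and card: "card {j. y \<in> S (Suc r) j} \<le> m + 1"
      using Q[of r] unfolding Q_def by auto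
    have "{V \<in> range E. y \<in> V} \<subseteq> E ` {j. y \<in> S (Suc r) j}" using ES by blast
    then have "card {V \<in> range E. y \<in> V} \<le> card {j. y \<in> S (Suc r) j}"
      using fin by (meson card_image_le card_mono finite_imageI le_trans)
    then show "card {V \<in> range E. y \<in> V} \<le> m + 1" using card by linarith
  qed
qed

text \<open>Barycentric families are formed twice. The first time they split an arbitrary locally
  finite refinement into countably many disjoint families, with no bound on their number. Their
  unions form a countable cover, to which the dimension does apply and whose order it reduces to
  \<open>m + 1\<close>. The second time they turn this cover into \<open>m + 1\<close> disjoint
  families, whose members are large and must still be cut into small pieces.\<close>

theorem covering_dim_disjoint_families:
  assumes Y: "paracompact_space Y" and dim: "covering_dim_le Y m" and \<Gamma>: "open_cover Y \<Gamma>"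
  obtains D :: "nat \<Rightarrow> 'b set set" where
    "\<And>i V. V \<in> D i \<Longrightarrow> openin Y V" "\<And>i. disjoint (D i)" "\<And>i. refines (D i) \<Gamma>"
    "topspace Y \<subseteq> (\<Union>i\<le>m. \<Union>(D i))"
proof -
  obtain \<U> where \<U>: "open_cover Y \<U>" "refines \<U> \<Gamma>" "locally_finite_in Y \<U>"
    using paracompact_refinement[OF Y \<Gamma>] by blast
  obtain D1 :: "nat \<Rightarrow> 'b set set" where
    D1_: "\<forall>i. (\<forall>V\<in>D1 i. openin Y V) \<and> disjoint (D1 i) \<and> refines (D1 i) \<U>"
      "\<forall>y\<in>topspace Y. \<exists>i. i < card {U \<in> \<U>. y \<in> U} \<and> y \<in> \<Union>(D1 i)"
    using barycentric_disjoint_families[OF Y \<U>(1,3)] by (elim exE conjE)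
  then have D1: "\<And>i V. V \<in> D1 i \<Longrightarrow> openin Y V" "\<And>i. disjoint (D1 i)" "\<And>i. refines (D1 i) \<U>"
    "\<And>y. y \<in> topspace Y \<Longrightarrow> \<exists>i. i < card {U \<in> \<U>. y \<in> U} \<and> y \<in> \<Union>(D1 i)"
    by simp_all
  have op: "openin Y (\<Union>(D1 i))" for i using D1(1) by blast
  have "(\<Union>i. \<Union>(D1 i)) = topspace Y"
  proof
    show "(\<Union>i. \<Union>(D1 i)) \<subseteq> topspace Y" using openin_subset[OF op] by blast
    show "topspace Y \<subseteq> (\<Union>i. \<Union>(D1 i))" using D1(4) by blast
  qed
  from countable_cover_order[OF Y dim op this] obtain E where E_: "\<forall>i. E i \<subseteq> \<Union>(D1 i)" "open_cover Y (range E)" "locally_finite_in Y (range E)"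
    "\<forall>y\<in>topspace Y. card {V \<in> range E. y \<in> V} \<le> m + 1"
    by (elim exE conjE)
  note E = E_(1)[rule_format] E_(2,3) E_(4)[rule_format]
  obtain D2 :: "nat \<Rightarrow> 'b set set" where
    D2_: "\<forall>i. (\<forall>V\<in>D2 i. openin Y V) \<and> disjoint (D2 i) \<and> refines (D2 i) (range E)"
      "\<forall>y\<in>topspace Y. \<exists>i. i < card {U \<in> range E. y \<in> U} \<and> y \<in> \<Union>(D2 i)"
    using barycentric_disjoint_families[OF Y E(2,3)] by (elim exE conjE)
  then have D2: "\<And>i V. V \<in> D2 i \<Longrightarrow> openin Y V" "\<And>i. disjoint (D2 i)" "\<And>i. refines (D2 i) (range E)"
    "\<And>y. y \<in> topspace Y \<Longrightarrow> \<exists>i. i < card {U \<in> range E. y \<in> U} \<and> y \<in> \<Union>(D2 i)"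
    by simp_all
  have "\<forall>S\<in>(\<Union>i. D2 i). \<exists>k. S \<subseteq> E k" using D2(3) unfolding refines_def by blast
  then obtain \<rho> where "\<forall>S\<in>(\<Union>i. D2 i). S \<subseteq> E (\<rho> S)" by metis
  then have \<rho>: "S \<subseteq> E (\<rho> S)" if "S \<in> D2 i" for i S using that by blast
  \<comment> \<open>Each \<open>S\<close> lies in the union of the single disjoint family
    \<open>D1 (\<rho> S)\<close>. Cutting \<open>S\<close> along that family makes the pieces small
    and keeps them disjoint, while the index \<open>i\<close> comes from the second pass and is
    therefore bounded by \<open>m\<close>.\<close>
  define D where "D i = {S \<inter> T | S T. S \<in> D2 i \<and> T \<in> D1 (\<rho> S)}" for i
  show ?thesis
  proof (rule that[of D])
    show "openin Y V" if "V \<in> D i" for i V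
      using that D1(1) D2(1) unfolding D_def by blast
    show "disjoint (D i)" for i
    proof (rule disjointI)
      fix V V' assume V: "V \<in> D i" "V' \<in> D i" "V \<noteq> V'"
      then obtain S T S' T' where *: "V = S \<inter> T" "S \<in> D2 i" "T \<in> D1 (\<rho> S)"
        "V' = S' \<inter> T'" "S' \<in> D2 i" "T' \<in> D1 (\<rho> S')"
        unfolding D_def by blast
      show "V \<inter> V' = {}"
      proof (cases "S = S'")
        case True
        then have "T \<inter> T' = {}" using * V(3) D1(2) disjointD by metis
        then show ?thesis using * by blast
      next
        case False
        then have "S \<inter> S' = {}" using * D2(2) disjointD by metis
        then show ?thesis using * by blast
      qed
    qed
    show "refines (D i) \<Gamma>" for i
      unfolding refines_def
    proof
      fix V assume "V \<in> D i"
      then obtain T k where "V \<subseteq> T" "T \<in> D1 k" unfolding D_def by blast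
      then obtain U where "V \<subseteq> U" "U \<in> \<U>" using D1(3) unfolding refines_def by (metis subset_trans)
      then show "\<exists>G\<in>\<Gamma>. V \<subseteq> G" using \<U>(2) unfolding refines_def by (metis subset_trans)
    qed
    show "topspace Y \<subseteq> (\<Union>i\<le>m. \<Union>(D i))"
    proof
      fix y assume y: "y \<in> topspace Y"
      then obtain i S where i: "i < card {U \<in> range E. y \<in> U}" "S \<in> D2 i" "y \<in> S"
        using D2(4) by blast
      then obtain T where "T \<in> D1 (\<rho> S)" "y \<in> T" using \<rho> E(1) by blast
      then have "y \<in> \<Union>(D i)" using i unfolding D_def by blast
      moreover have "i \<le> m" using i E(4)[OF y] by linarith
      ultimately show "y \<in> (\<Union>i\<le>m. \<Union>(D i))" by blast
    qed
  qed
qed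

section \<open>General position\<close>

text \<open>The vectors to be avoided at a new index form finitely many differentiable images of a
  hyperplane, whose points encode (in the coordinates \<open>1, 2, \<dots>\<close> of an enumeration \<open>e\<close> of the
  index type) the at most \<open>s - 1\<close> essential parameters of \<open>u\<close>, the factor \<open>r\<close> and \<open>2 n\<close> free
  coefficients.\<close>

lemma general_position:
  fixes e :: "nat \<Rightarrow> 'k::finite" and \<U> :: "(real^'k \<Rightarrow> 'v \<Rightarrow> real^'k) set" and G :: "'v \<Rightarrow> (real^'k) set"
  assumes e: "bij_betw e {..<CARD('k)} UNIV" and k: "s + 2 * n < CARD('k)"
    and \<U>: "finite \<U>"
    and diff: "\<And>u v. \<lbrakk>u \<in> \<U>; v \<in> \<V>\<rbrakk> \<Longrightarrow> (\<lambda>p. u p v) differentiable_on UNIV"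
    and dep: "\<And>u p q. \<lbrakk>u \<in> \<U>; \<And>i. \<lbrakk>1 \<le> i; i < s\<rbrakk> \<Longrightarrow> p $ e i = q $ e i\<rbrakk> \<Longrightarrow> u p = u q"
    and \<V>: "finite \<V>" and G: "\<And>v. v \<in> \<V> \<Longrightarrow> open (G v) \<and> G v \<noteq> {}"
  shows "\<exists>a. (\<forall>v\<in>\<V>. a v \<in> G v) \<and>
    (\<forall>c. (\<Sum>v\<in>\<V>. c v) = 0 \<and> (\<exists>v\<in>\<V>. c v \<noteq> 0) \<and> card {v \<in> \<V>. c v \<noteq> 0} \<le> 2 * n + 2 \<longrightarrow>
      (\<forall>u\<in>\<U>. \<forall>p r. (s = 0 \<longrightarrow> r = 0) \<longrightarrow> (\<Sum>v\<in>\<V>. c v *\<^sub>R (a v + r *\<^sub>R u p v)) \<noteq> 0))"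
  using \<V> diff G
proof (induction \<V>)
  case (insert x T)
  have "\<exists>a. (\<forall>v\<in>T. a v \<in> G v) \<and>
    (\<forall>c. (\<Sum>v\<in>T. c v) = 0 \<and> (\<exists>v\<in>T. c v \<noteq> 0) \<and> card {v \<in> T. c v \<noteq> 0} \<le> 2 * n + 2 \<longrightarrow>
      (\<forall>u\<in>\<U>. \<forall>p r. (s = 0 \<longrightarrow> r = 0) \<longrightarrow> (\<Sum>v\<in>T. c v *\<^sub>R (a v + r *\<^sub>R u p v)) \<noteq> 0))"
    using insert.prems by (intro insert.IH) blast+
  then obtain a where aG: "\<forall>v\<in>T. a v \<in> G v"
    and a: "\<forall>c. (\<Sum>v\<in>T. c v) = 0 \<and> (\<exists>v\<in>T. c v \<noteq> 0) \<and> card {v \<in> T. c v \<noteq> 0} \<le> 2 * n + 2 \<longrightarrow>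
      (\<forall>u\<in>\<U>. \<forall>p r. (s = 0 \<longrightarrow> r = 0) \<longrightarrow> (\<Sum>v\<in>T. c v *\<^sub>R (a v + r *\<^sub>R u p v)) \<noteq> 0)"
    by (elim exE conjE)
  \<comment> \<open>The target space doubles as the parameter space, with coordinate
    \<open>e 0\<close> given up. The domain is then a null set of the same ambient dimension, so its
    differentiable images are null.\<close>
  define H where "H = {P :: real^'k. P $ e 0 = 0}"
  have "H = {P. P \<bullet> axis (e 0) 1 = 0}" by (simp add: H_def cart_eq_inner_axis)
  then have negH: "negligible H" by (simp add: negligible_standard_hyperplane)
  have "\<exists>\<iota>. bij_betw \<iota> S {..<card S}" if "S \<subseteq> T" for S
    using ex_bij_betw_finite_nat[of S] finite_subset[OF that] insert.hyps
    by (simp add: atLeast0LessThan)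
  then obtain \<iota> where \<iota>: "\<And>S. S \<subseteq> T \<Longrightarrow> bij_betw (\<iota> S) S {..<card S}" by metis
  \<comment> \<open>The forbidden equation solved for the vector at \<open>x\<close>. Coordinate
    \<open>e s\<close> of \<open>P\<close> is the factor r, the coordinates after it are the
    coefficients on \<open>S\<close>, and \<open>u\<close> reads only coordinates before it. The
    coefficient of \<open>v1\<close> is eliminated, since the normalised coefficients have sum
    1.\<close>
  define F where "F u v1 S P = - (P $ e s) *\<^sub>R u P x + (a v1 + (P $ e s) *\<^sub>R u P v1) +
      (\<Sum>v\<in>S. (P $ e (Suc s + \<iota> S v)) *\<^sub>R ((a v + (P $ e s) *\<^sub>R u P v) - (a v1 + (P $ e s) *\<^sub>R u P v1)))"
    for u v1 S and P :: "real^'k"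
  define Bad where "Bad = (\<Union>(u, v1, S) \<in> \<U> \<times> T \<times> Pow T. F u v1 S ` H)"
  have coord: "(\<lambda>P. P $ i) differentiable (at P within A)" for i :: 'k and P :: "real^'k" and A
    by (rule bounded_linear_imp_differentiable[OF bounded_linear_vec_nth])
  have "negligible (F u v1 S ` H)" if "u \<in> \<U>" "v1 \<in> T" "S \<subseteq> T" for u v1 S
  proof (rule negligible_differentiable_image_negligible[OF order_refl negH])
    have du: "(\<lambda>P. u P v) differentiable (at P within H)" if "v \<in> insert x T" for v P
      using insert.prems(1)[OF \<open>u \<in> \<U>\<close> that] unfolding differentiable_on_def
      by (meson UNIV_I differentiable_at_withinI)
    show "F u v1 S differentiable_on H"
      unfolding differentiable_on_def F_def
      using that insert.hyps(1)
      by (intro ballI differentiable_add differentiable_scaleR differentiable_minus differentiable_sum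
          differentiable_diff differentiable_const coord du) (auto intro: finite_subset)
  qed
  then have "negligible Bad"
    unfolding Bad_def using \<U> insert.hyps(1)
    by (intro negligible_Union) auto
  moreover have "\<not> negligible (G x)" using insert.prems(2) open_not_negligible by blast
  ultimately obtain z where z: "z \<in> G x" "z \<notin> Bad"
    using negligible_subset by blast
  show ?case
  proof (intro exI[of _ "a(x := z)"] conjI ballI allI impI; (elim conjE)?)
    show "(a(x := z)) v \<in> G v" if "v \<in> insert x T" for v
      using that z aG by auto
    fix c :: "'v \<Rightarrow> real" and u and p :: "real^'k" and r :: real
    assume c: "(\<Sum>v\<in>insert x T. c v) = 0" "\<exists>v\<in>insert x T. c v \<noteq> 0"
        "card {v \<in> insert x T. c v \<noteq> 0} \<le> 2 * n + 2" and u: "u \<in> \<U>" and r: "s = 0 \<longrightarrow> r = 0"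
    have fin: "finite T" and xT: "x \<notin> T" using insert.hyps by auto
    let ?w = "\<lambda>v. a v + r *\<^sub>R u p v"
    have sumT: "(\<Sum>v\<in>insert x T. c v *\<^sub>R ((a(x := z)) v + r *\<^sub>R u p v)) =
        c x *\<^sub>R (z + r *\<^sub>R u p x) + (\<Sum>v\<in>T. c v *\<^sub>R ?w v)"
      using fin xT by (simp, intro sum.cong) auto
    show "(\<Sum>v\<in>insert x T. c v *\<^sub>R ((a(x := z)) v + r *\<^sub>R u p v)) \<noteq> 0"
    proof (cases "c x = 0")
      case True
      then have "{v \<in> insert x T. c v \<noteq> 0} = {v \<in> T. c v \<noteq> 0}" by auto
      then have "(\<Sum>v\<in>T. c v *\<^sub>R ?w v) \<noteq> 0"
        using True c fin xT u r by (intro a[rule_format]) auto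
      then show ?thesis using True sumT by simp
    next
      case False
      show ?thesis
      proof
        assume "(\<Sum>v\<in>insert x T. c v *\<^sub>R ((a(x := z)) v + r *\<^sub>R u p v)) = 0"
        then have eq: "c x *\<^sub>R (z + r *\<^sub>R u p x) = - (\<Sum>v\<in>T. c v *\<^sub>R ?w v)"
          unfolding sumT by (simp add: eq_neg_iff_add_eq_0)
        define b where "b v = - c v / c x" for v
        have "z + r *\<^sub>R u p x = (1 / c x) *\<^sub>R (c x *\<^sub>R (z + r *\<^sub>R u p x))" using False by simp
        also have "\<dots> = (\<Sum>v\<in>T. b v *\<^sub>R ?w v)"
          unfolding eq b_def by (simp add: scaleR_sum_right sum_negf[symmetric])
        finally have z_eq: "z = - r *\<^sub>R u p x + (\<Sum>v\<in>T. b v *\<^sub>R ?w v)"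
          by (simp add: algebra_simps)
        have "c x * (\<Sum>v\<in>T. b v) = - (\<Sum>v\<in>T. c v)"
          using False unfolding b_def by (simp add: sum_distrib_left sum_negf)
        also have "\<dots> = c x" using c(1) fin xT by simp
        finally have b1: "(\<Sum>v\<in>T. b v) = 1" using False by simp
        then obtain v1 where v1: "v1 \<in> T" "b v1 \<noteq> 0"
          by (metis sum.neutral zero_neq_one)
        \<comment> \<open>Of the at most \<open>2 * n + 2\<close> nonzero entries of
          \<open>c\<close>, two belong to \<open>x\<close> and \<open>v1\<close>; at most
          \<open>2 * n\<close> coefficients remain, for which there is room after coordinate
          \<open>e s\<close>.\<close>
        define S where "S = {v \<in> T. b v \<noteq> 0} - {v1}"
        have S: "S \<subseteq> T" "finite S" "v1 \<notin> S" using fin unfolding S_def by auto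
        have "{v \<in> insert x T. c v \<noteq> 0} = insert x (insert v1 S)"
          using False v1 unfolding S_def b_def by auto
        moreover have "x \<notin> insert v1 S" using xT v1 S by blast
        ultimately have cS: "card S \<le> 2 * n"
          using c(3) S by simp
        have "(\<Sum>v\<in>T. b v) = (\<Sum>v\<in>insert v1 S. b v)"
          using v1 fin unfolding S_def by (intro sum.mono_neutral_right) auto
        then have bv1: "b v1 = 1 - (\<Sum>v\<in>S. b v)" using b1 S by simp
        have "(\<Sum>v\<in>T. b v *\<^sub>R ?w v) = (\<Sum>v\<in>insert v1 S. b v *\<^sub>R ?w v)"
          using v1 fin unfolding S_def by (intro sum.mono_neutral_right) auto
        also have "\<dots> = b v1 *\<^sub>R ?w v1 + (\<Sum>v\<in>S. b v *\<^sub>R ?w v)"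
          using S by simp
        also have "\<dots> = ?w v1 + (\<Sum>v\<in>S. b v *\<^sub>R (?w v - ?w v1))"
          unfolding bv1 by (simp add: scaleR_diff_left scaleR_diff_right sum_subtractf
              scaleR_sum_left)
        finally have z_eq': "z = - r *\<^sub>R u p x + ?w v1 + (\<Sum>v\<in>S. b v *\<^sub>R (?w v - ?w v1))"
          using z_eq by simp
        \<comment> \<open>For \<open>s = 0\<close> the coordinate meant for \<open>r\<close> is
          \<open>e 0\<close> itself, which must be 0; this is why \<open>r = 0\<close> is demanded
          in that case.\<close>
        define w where "w j = (if j = 0 then 0 else if j < s then p $ e j else if j = s then r
            else b (inv_into S (\<iota> S) (j - Suc s)))" for j
        define P :: "real^'k" where "P = (\<chi> i. w (inv_into {..<CARD('k)} e i))"
        have P: "P $ e j = w j" if "j < CARD('k)" for j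
          using that bij_betw_inv_into_left[OF e] unfolding P_def by simp
        have "P $ e j = p $ e j" if "1 \<le> j" "j < s" for j
          using P[of j] that k unfolding w_def by simp
        then have uP: "u P = u p" using dep[OF u] by blast
        have Ps: "P $ e s = r" using P[of s] k r unfolding w_def by auto
        have Pv: "P $ e (Suc s + \<iota> S v) = b v" if "v \<in> S" for v
        proof -
          have "\<iota> S v < card S" using bij_betwE[OF \<iota>[OF S(1)]] that by blast
          moreover have "inv_into S (\<iota> S) (\<iota> S v) = v"
            using bij_betw_inv_into_left[OF \<iota>[OF S(1)] that] .
          ultimately show ?thesis using P[of "Suc s + \<iota> S v"] k cS unfolding w_def by simp
        qed
        have "F u v1 S P = z"
          unfolding F_def z_eq' uP Ps using Pv by simp
        moreover have "P \<in> H" using P[of 0] unfolding H_def w_def by simp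
        ultimately have "z \<in> Bad" unfolding Bad_def using u v1(1) S(1) by blast
        then show False using z by blast
      qed
    qed
  qed
qed auto

section \<open>Fibrewise approximation\<close>

abbreviation unit_cube :: "(real^'k) set" where
  "unit_cube \<equiv> cbox 0 1"

lemma finite_pos_lower_bound:
  fixes \<epsilon> :: "'a \<Rightarrow> real"
  assumes "finite T" "\<And>q. q \<in> T \<Longrightarrow> 0 < \<epsilon> q"
  shows "\<exists>d>0. \<forall>q\<in>T. d \<le> \<epsilon> q"
  using assms
proof (induction T)
  case (insert q T)
  then obtain d where "d > 0" "\<forall>q\<in>T. d \<le> \<epsilon> q" by auto
  then show ?case using insert.prems[of q]
    by (intro exI[of _ "min d (\<epsilon> q)"]) (auto simp: min_le_iff_disj)
qed (auto intro: exI[of _ 1])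

lemma convex_sum_dist_less:
  fixes c :: "'b::real_normed_vector"
  assumes "finite V" "(\<Sum>v\<in>V. k v) = 1" "\<And>v. v \<in> V \<Longrightarrow> 0 \<le> (k v :: real)"
    and "\<And>v. \<lbrakk>v \<in> V; k v \<noteq> 0\<rbrakk> \<Longrightarrow> dist (b v) c < d"
  shows "dist (\<Sum>v\<in>V. k v *\<^sub>R b v) c < d"
proof -
  let ?W = "{v \<in> V. k v \<noteq> 0}"
  have "(\<Sum>v\<in>?W. k v) = (\<Sum>v\<in>V. k v)"
    using assms(1) by (intro sum.mono_neutral_left) auto
  then have "(\<Sum>v\<in>?W. k v *\<^sub>R b v) \<in> ball c d"
    using assms by (intro convex_sum) (auto simp: dist_commute)
  moreover have "(\<Sum>v\<in>V. k v *\<^sub>R b v) = (\<Sum>v\<in>?W. k v *\<^sub>R b v)"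
    using assms(1) by (intro sum.mono_neutral_right) auto
  ultimately show ?thesis by (simp add: dist_commute)
qed

text \<open>The cube contains 0, so a coefficient sum below 1 does no harm; such sums occur off the
  fibre for which the coefficients were built.\<close>

lemma subconvex_sum_mem_unit_cube:
  fixes b :: "'v \<Rightarrow> real^'k"
  assumes "(\<Sum>v\<in>V. k v) \<le> (1::real)" "\<And>v. v \<in> V \<Longrightarrow> 0 \<le> k v" "\<And>v. v \<in> V \<Longrightarrow> b v \<in> unit_cube"
  shows "(\<Sum>v\<in>V. k v *\<^sub>R b v) \<in> unit_cube"
proof -
  have b: "0 \<le> b v $ i" "b v $ i \<le> 1" if "v \<in> V" for v i
    using assms(3)[OF that] by (auto simp: mem_box_cart)
  have "0 \<le> (\<Sum>v\<in>V. k v * b v $ i)" for i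
    using assms(2) b by (intro sum_nonneg mult_nonneg_nonneg)
  moreover have "(\<Sum>v\<in>V. k v * b v $ i) \<le> 1" for i
  proof -
    have "(\<Sum>v\<in>V. k v * b v $ i) \<le> (\<Sum>v\<in>V. k v * 1)"
      using assms(2) b by (intro sum_mono mult_left_mono)
    then show ?thesis using assms(1) by simp
  qed
  ultimately show ?thesis by (simp add: mem_box_cart)
qed

lemma continuous_map_scaleR [continuous_intros]:
  fixes g :: "'a \<Rightarrow> 'b::real_normed_vector"
  assumes "continuous_map X euclideanreal f" "continuous_map X euclidean g"
  shows "continuous_map X euclidean (\<lambda>x. f x *\<^sub>R g x)"
  using assms by (simp add: continuous_map_atin tendsto_scaleR)

lemma continuous_map_dist_real:
  fixes g :: "'a \<Rightarrow> 'b::real_normed_vector"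
  assumes "continuous_map X euclidean f" "continuous_map X euclidean g"
  shows "continuous_map X euclideanreal (\<lambda>x. dist (f x) (g x))"
  unfolding dist_norm using assms by (intro continuous_intros)

definition interpolate :: "'v set \<Rightarrow> ('v \<Rightarrow> 'a \<Rightarrow> real) \<Rightarrow> ('v \<Rightarrow> 'a) \<Rightarrow> ('a \<Rightarrow> 'c::real_vector) \<Rightarrow> 'a \<Rightarrow> 'c" where
  "interpolate V \<kappa> \<xi> q x = (\<Sum>v\<in>V. \<kappa> v x *\<^sub>R q (\<xi> v))"

text \<open>The space of the cube is used both as target and as parameter space, and
  \<open>e\<close> numbers its coordinates. Coordinate 0 is kept as a dummy for general position,
  and each later stage uses the next coordinate as the time of its deformation.\<close>

locale perfect_approximation =
  fixes X :: "'a topology" and Y :: "'b topology" and f :: "'a \<Rightarrow> 'b" and n :: nat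
    and \<omega> :: "'a set set" and g :: "'a \<Rightarrow> real^'k::finite" and \<alpha> :: "'a \<Rightarrow> real"
    and e :: "nat \<Rightarrow> 'k"
  assumes X: "paracompact_space X" and Y: "paracompact_space Y" and f: "perfect_map X Y f"
    and dim: "map_dim_le X Y f n" and \<omega>: "open_cover X \<omega>"
    and g: "continuous_map X euclidean g" and g_cube: "\<And>x. x \<in> topspace X \<Longrightarrow> g x \<in> unit_cube"
    and \<alpha>: "continuous_map X euclideanreal \<alpha>" and \<alpha>_pos: "\<And>x. x \<in> topspace X \<Longrightarrow> 0 < \<alpha> x"
    and e: "bij_betw e {..<CARD('k)} UNIV"
begin

definition F :: "'b \<Rightarrow> 'a set" where
  "F y = {x \<in> topspace X. f x = y}"

text \<open>The empty set is added so that the values \<open>t\<close> that are not attained need no special treatment.\<close>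

definition small_fibres :: "('a \<Rightarrow> real^'k) \<Rightarrow> 'b \<Rightarrow> bool" where
  "small_fibres h y \<longleftrightarrow> (\<forall>t. \<exists>U\<in>insert {} \<omega>. {x \<in> F y. h x = t} \<subseteq> U)"

definition good :: "('a \<Rightarrow> real^'k) \<Rightarrow> 'b \<Rightarrow> bool" where
  "good h y \<longleftrightarrow> small_fibres h y \<and> (\<forall>x\<in>F y. dist (h x) (g x) < \<alpha> x)"

abbreviation jointly_continuous :: "(real^'k \<Rightarrow> 'a \<Rightarrow> real^'k) \<Rightarrow> bool" where
  "jointly_continuous u \<equiv> continuous_map (prod_topology euclidean X) euclidean (\<lambda>(p, x). u p x)"

section \<open>Tubes around fibres and stability of goodness\<close>

lemma F_subset: "F y \<subseteq> topspace X" and F_iff: "x \<in> F y \<longleftrightarrow> x \<in> topspace X \<and> f x = y"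
  unfolding F_def by auto

lemma compactin_F: "y \<in> topspace Y \<Longrightarrow> compactin X (F y)"
  using f unfolding F_def perfect_map_def proper_map_def by blast

lemma f_in: "x \<in> topspace X \<Longrightarrow> f x \<in> topspace Y"
  using f unfolding perfect_map_def by blast

lemma openin_\<omega>: "U \<in> insert {} \<omega> \<Longrightarrow> openin X U"
  using \<omega> unfolding open_cover_def by auto

lemma fibre_neighbourhood:
  assumes "openin X U" "y \<in> topspace Y" "F y \<subseteq> U"
  obtains V where "openin Y V" "y \<in> V" "\<And>z. z \<in> V \<Longrightarrow> F z \<subseteq> U"
proof -
  have "closed_map X Y f" using f unfolding perfect_map_def proper_map_def by blast
  then obtain V where "openin Y V" "y \<in> V" "{x \<in> topspace X. f x \<in> V} \<subseteq> U"
    using assms unfolding closed_map_fibre_neighbourhood F_def by blast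
  then show ?thesis using that[of V] unfolding F_def by blast
qed

lemma jointly_continuous_comp:
  assumes "jointly_continuous u" "continuous_map Z euclidean a" "continuous_map Z X b"
  shows "continuous_map Z euclidean (\<lambda>z. u (a z) (b z))"
proof -
  have "continuous_map Z (prod_topology euclidean X) (\<lambda>z. (a z, b z))"
    using assms by (simp add: continuous_map_paired)
  from continuous_map_compose[OF this assms(1)] show ?thesis by (simp add: o_def)
qed

lemma jointly_continuous_const: "continuous_map X euclidean h \<Longrightarrow> jointly_continuous (\<lambda>_. h)"
  using continuous_map_compose[OF continuous_map_snd, of X euclidean h euclidean]
  by (simp add: o_def case_prod_unfold)

text \<open>On the compact part of the fibre outside \<open>U\<close>, \<open>u p\<close> stays away
  from \<open>t\<close>. The extra real coordinate in \<open>W\<close> stands for a lower bound of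
  this distance, so that the Wallace theorem at \<open>(p, 0)\<close> provides one bound valid for
  nearby parameters and near the fibre. Closedness of \<open>f\<close> turns the neighbourhood of
  the fibre into one of \<open>y\<close>.\<close>

lemma tube_fibres:
  assumes u: "jointly_continuous u" and y: "y \<in> topspace Y" and U: "U \<in> insert {} \<omega>"
    and sub: "{x \<in> F y. u p x = t} \<subseteq> U"
  shows "\<exists>\<epsilon>>0. \<exists>V. openin Y V \<and> y \<in> V \<and> (\<forall>z\<in>V. \<forall>p' t' x.
    dist p' p < \<epsilon> \<longrightarrow> dist t' t < \<epsilon> \<longrightarrow> x \<in> F z \<longrightarrow> dist (u p' x) t' < \<epsilon> \<longrightarrow> x \<in> U)"
proof -
  let ?Z = "prod_topology (euclidean :: ((real^'k) \<times> real) topology) X"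
  define W where "W = {q \<in> topspace ?Z. snd (fst q) < dist (u (fst (fst q)) (snd q)) t}"
  have c1: "continuous_map ?Z euclidean fst" and c2: "continuous_map ?Z X snd"
    by (rule continuous_map_fst, rule continuous_map_snd)
  have c3: "continuous_map ?Z euclidean (\<lambda>q. fst (fst q))" "continuous_map ?Z euclidean (\<lambda>q. snd (fst q))"
    using continuous_map_compose[OF c1, of euclidean fst] continuous_map_compose[OF c1, of euclidean snd]
    by (auto simp: o_def continuous_on_fst continuous_on_snd)
  have W: "openin ?Z W"
    unfolding W_def
    by (intro openin_less_continuous continuous_map_dist_real jointly_continuous_comp[OF u] c2 c3) simp
  have "compactin X (F y \<inter> (topspace X - U))"
    by (intro compact_Int_closedin compactin_F y) (use openin_\<omega>[OF U] in blast)
  moreover have "{(p, 0)} \<times> (F y \<inter> (topspace X - U)) \<subseteq> W"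
    using sub F_subset unfolding W_def by auto
  ultimately obtain N O' where NO: "openin euclidean N" "openin X O'" "(p, 0) \<in> N"
      "F y \<inter> (topspace X - U) \<subseteq> O'" "N \<times> O' \<subseteq> W"
    using Wallace_theorem_prod_topology[OF _ _ W, of "{(p, 0)}" "F y \<inter> (topspace X - U)"]
    by (metis compactin_sing UNIV_I insert_subset topspace_euclidean)
  then obtain d where d: "d > 0" "ball (p, 0) d \<subseteq> N"
    using open_contains_ball by (metis open_openin)
  have "openin X (O' \<union> U)" using NO openin_\<omega>[OF U] by blast
  moreover have "F y \<subseteq> O' \<union> U" using NO F_subset by blast
  ultimately obtain V where V: "openin Y V" "y \<in> V" "\<And>z. z \<in> V \<Longrightarrow> F z \<subseteq> O' \<union> U"
    using fibre_neighbourhood y by metis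
  \<comment> \<open>Thirds of \<open>d\<close>: the point \<open>(p', 2 * d / 3)\<close> is still
    within \<open>d\<close> of \<open>(p, 0)\<close>, which keeps the value more than
    \<open>2 * d / 3\<close> away from \<open>t\<close>, whereas the two errors add up to
    less.\<close>
  have "x \<in> U" if z: "z \<in> V" and p': "dist p' p < d / 3" and t': "dist t' t < d / 3"
    and x: "x \<in> F z" and ux: "dist (u p' x) t' < d / 3" for z p' t' x
  proof (rule ccontr)
    assume "x \<notin> U"
    then have "x \<in> O'" using V(3)[OF z] x by blast
    have "dist (p', 2 * d / 3) (p, 0) \<le> dist p' p + dist (2 * d / 3) 0"
      unfolding dist_Pair_Pair by (rule sqrt_sum_squares_le_sum) auto
    also have "\<dots> < d" using p' d by simp
    finally have "(p', 2 * d / 3) \<in> N"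
      using d(2) by (auto simp: dist_commute subset_iff)
    then have "((p', 2 * d / 3), x) \<in> W" using NO(5) \<open>x \<in> O'\<close> by blast
    then have "2 * d / 3 < dist (u p' x) t" unfolding W_def by simp
    moreover have "dist (u p' x) t \<le> dist (u p' x) t' + dist t' t" by (rule dist_triangle)
    ultimately show False using ux t' by simp
  qed
  then show ?thesis using V(1,2) d(1) by (intro exI[of _ "d / 3"] conjI exI[of _ V]) auto
qed

text \<open>The device of \<open>tube_fibres\<close> with the compact cube of all parameters in
  place of one parameter; the real coordinate now measures the slack below \<alpha>.\<close>

lemma tube_close:
  assumes u: "jointly_continuous u" and y: "y \<in> topspace Y"
    and close: "\<And>p x. \<lbrakk>p \<in> unit_cube; x \<in> F y\<rbrakk> \<Longrightarrow> dist (u p x) (g x) < \<alpha> x"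
  shows "\<exists>\<epsilon>>0. \<exists>V. openin Y V \<and> y \<in> V \<and>
    (\<forall>z\<in>V. \<forall>p\<in>unit_cube. \<forall>x\<in>F z. dist (u p x) (g x) + \<epsilon> < \<alpha> x)"
proof -
  let ?Z = "prod_topology (euclidean :: ((real^'k) \<times> real) topology) X"
  define W where "W = {q \<in> topspace ?Z. dist (u (fst (fst q)) (snd q)) (g (snd q)) + snd (fst q) < \<alpha> (snd q)}"
  have c1: "continuous_map ?Z euclidean fst" and c2: "continuous_map ?Z X snd"
    by (rule continuous_map_fst, rule continuous_map_snd)
  have c3: "continuous_map ?Z euclidean (\<lambda>q. fst (fst q))" "continuous_map ?Z euclidean (\<lambda>q. snd (fst q))"
    using continuous_map_compose[OF c1, of euclidean fst] continuous_map_compose[OF c1, of euclidean snd]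
    by (auto simp: o_def continuous_on_fst continuous_on_snd)
  have c4: "continuous_map ?Z euclidean (\<lambda>q. g (snd q))" "continuous_map ?Z euclideanreal (\<lambda>q. \<alpha> (snd q))"
    using continuous_map_compose[OF c2 g] continuous_map_compose[OF c2 \<alpha>] by (auto simp: o_def)
  have W: "openin ?Z W"
    unfolding W_def
    by (intro openin_less_continuous continuous_map_add continuous_map_dist_real
        jointly_continuous_comp[OF u] c2 c3 c4)
  have K: "compact (unit_cube \<times> {0::real} :: ((real^'k) \<times> real) set)"
    by (intro compact_Times compact_cbox) simp
  have sub: "(unit_cube \<times> {0}) \<times> F y \<subseteq> W"
    using close F_subset unfolding W_def by auto
  obtain N O' where NO: "openin euclidean N" "openin X O'" "unit_cube \<times> {0} \<subseteq> N"
      "F y \<subseteq> O'" "N \<times> O' \<subseteq> W"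
    by (rule Wallace_theorem_prod_topology[OF _ compactin_F[OF y] W sub]) (use K in auto)
  obtain d where d: "d > 0" "(\<Union>q\<in>unit_cube \<times> {0}. ball q d) \<subseteq> N"
    using compact_subset_open_imp_ball_epsilon_subset[OF K] NO by (metis open_openin)
  obtain V where V: "openin Y V" "y \<in> V" "\<And>z. z \<in> V \<Longrightarrow> F z \<subseteq> O'"
    using fibre_neighbourhood[OF NO(2) y NO(4)] by metis
  have "dist (u p x) (g x) + d / 2 < \<alpha> x" if "z \<in> V" "p \<in> unit_cube" "x \<in> F z" for z p x
  proof -
    have "(p, d / 2) \<in> ball (p, 0) d" using d(1) by (simp add: dist_Pair_Pair)
    then have "(p, d / 2) \<in> N" using d(2) that(2) by blast
    then have "((p, d / 2), x) \<in> W" using NO(5) V(3) that by blast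
    then show ?thesis unfolding W_def by simp
  qed
  then show ?thesis using V(1,2) d(1) by (intro exI[of _ "d / 2"] conjI exI[of _ V]) auto
qed

text \<open>\<open>tube_fibres\<close> works at one parameter and one value. Applied at all such
  pairs, it leaves finitely many by compactness of the product of two cubes, and the smallest of
  their bounds serves every parameter at once.\<close>

lemma good_tube:
  assumes u: "jointly_continuous u" and y: "y \<in> topspace Y"
    and cube: "\<And>p x. \<lbrakk>p \<in> unit_cube; x \<in> topspace X\<rbrakk> \<Longrightarrow> u p x \<in> unit_cube"
    and good: "\<And>p. p \<in> unit_cube \<Longrightarrow> good (u p) y"
  shows "\<exists>\<epsilon>>0. \<exists>V. openin Y V \<and> y \<in> V \<and> (\<forall>z\<in>V. \<forall>p\<in>unit_cube. \<forall>h.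
    (\<forall>x\<in>F z. dist (h x) (u p x) < \<epsilon>) \<longrightarrow> good h z)"
proof -
  let ?I = "unit_cube :: (real^'k) set"
  obtain \<epsilon>0 V0 where V0: "\<epsilon>0 > 0" "openin Y V0" "y \<in> V0"
      "\<And>z p x. \<lbrakk>z \<in> V0; p \<in> ?I; x \<in> F z\<rbrakk> \<Longrightarrow> dist (u p x) (g x) + \<epsilon>0 < \<alpha> x"
    using tube_close[OF u y] good unfolding good_def by metis
  have "\<exists>U \<epsilon> V. U \<in> insert {} \<omega> \<and> \<epsilon> > 0 \<and> openin Y V \<and> y \<in> V \<and> (\<forall>z\<in>V. \<forall>p' t' x.
      dist p' (fst q) < \<epsilon> \<longrightarrow> dist t' (snd q) < \<epsilon> \<longrightarrow> x \<in> F z \<longrightarrow> dist (u p' x) t' < \<epsilon> \<longrightarrow> x \<in> U)"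
    if "q \<in> ?I \<times> ?I" for q
  proof -
    have "small_fibres (u (fst q)) y" using good that unfolding good_def by force
    then obtain U where "U \<in> insert {} \<omega>" "{x \<in> F y. u (fst q) x = snd q} \<subseteq> U"
      unfolding small_fibres_def by blast
    then show ?thesis
      using tube_fibres[OF u y, of U "fst q" "snd q"] by (intro exI[of _ U]) simp
  qed
  then obtain U \<epsilon> V where q: "\<And>q. q \<in> ?I \<times> ?I \<Longrightarrow> U q \<in> insert {} \<omega> \<and> \<epsilon> q > 0 \<and> openin Y (V q) \<and> y \<in> V q \<and>
      (\<forall>z\<in>V q. \<forall>p' t' x. dist p' (fst q) < \<epsilon> q \<longrightarrow> dist t' (snd q) < \<epsilon> q \<longrightarrow> x \<in> F z \<longrightarrow>
        dist (u p' x) t' < \<epsilon> q \<longrightarrow> x \<in> U q)"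
    by metis
  have "compact (?I \<times> ?I)" by (intro compact_Times compact_cbox)
  then obtain T where T: "T \<subseteq> ?I \<times> ?I" "finite T"
      "?I \<times> ?I \<subseteq> (\<Union>q\<in>T. ball (fst q) (\<epsilon> q) \<times> ball (snd q) (\<epsilon> q))"
    by (rule compactE_image[where C = "?I \<times> ?I" and f = "\<lambda>q. ball (fst q) (\<epsilon> q) \<times> ball (snd q) (\<epsilon> q)"])
      (use q in \<open>auto intro!: open_Times\<close>)
  obtain \<epsilon>1 where \<epsilon>1: "\<epsilon>1 > 0" "\<And>q. q \<in> T \<Longrightarrow> \<epsilon>1 \<le> \<epsilon> q"
    using finite_pos_lower_bound[OF T(2), of \<epsilon>] T(1) q by blast
  define V' where "V' = V0 \<inter> {z \<in> topspace Y. \<forall>q\<in>T. z \<in> V q}"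
  have opq: "openin Y {z \<in> topspace Y. z \<in> V q}" if "q \<in> T" for q
  proof -
    have "{z \<in> topspace Y. z \<in> V q} = V q" using q[of q] T(1) that openin_subset by blast
    then show ?thesis using q[of q] T(1) that by auto
  qed
  have "openin Y V'" unfolding V'_def by (intro openin_Int V0 openin_finite_Ball T opq)
  moreover have "y \<in> V'" using V0 q T(1) y unfolding V'_def by blast
  moreover have "good h z" if z: "z \<in> V'" and p: "p \<in> ?I"
    and h: "\<And>x. x \<in> F z \<Longrightarrow> dist (h x) (u p x) < min \<epsilon>0 (\<epsilon>1 / 2)" for z p h
    unfolding good_def small_fibres_def
  proof (intro conjI allI ballI)
    fix x assume x: "x \<in> F z"
    have "dist (h x) (g x) \<le> dist (h x) (u p x) + dist (u p x) (g x)" by (rule dist_triangle)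
    then show "dist (h x) (g x) < \<alpha> x"
      using h[OF x] V0(4)[of z p x] z p x unfolding V'_def by auto
  next
    fix t
    show "\<exists>U\<in>insert {} \<omega>. {x \<in> F z. h x = t} \<subseteq> U"
    proof (cases "{x \<in> F z. h x = t} = {}")
      case False
      then obtain x0 where x0: "x0 \<in> F z" "h x0 = t" by blast
      \<comment> \<open>The value of \<open>u p\<close> is used instead of \<open>t\<close>, which
        may lie outside the cube and so outside the compact set. Two points with the same
        \<open>h\<close>-value have \<open>u p\<close>-values within twice
        \<open>\<epsilon>1 / 2\<close>.\<close>
      define s where "s = u p x0"
      have "s \<in> ?I" using cube p x0 F_subset unfolding s_def by blast
      then obtain q' where q': "q' \<in> T" "dist p (fst q') < \<epsilon> q'" "dist s (snd q') < \<epsilon> q'"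
        using T(3) p by (force simp: dist_commute)
      have "x \<in> U q'" if x: "x \<in> F z" "h x = t" for x
      proof -
        have "dist (u p x) s \<le> dist (u p x) t + dist t s" by (rule dist_triangle)
        also have "\<dots> < \<epsilon>1"
          using h[OF x(1)] h[OF x0(1)] x(2) x0(2) unfolding s_def by (simp add: dist_commute)
        finally have "dist (u p x) s < \<epsilon> q'" using \<epsilon>1(2)[OF q'(1)] by simp
        then show ?thesis using q[of q'] q' T(1) x(1) z unfolding V'_def by blast
      qed
      then show ?thesis using q[of q'] T(1) q'(1) by blast
    qed blast
  qed
  ultimately show ?thesis using V0(1) \<epsilon>1(1)
    by (intro exI[of _ "min \<epsilon>0 (\<epsilon>1 / 2)"] conjI exI[of _ V'] ballI allI impI) auto
qed

text \<open>The tube lemma, applied to \<open>h\<close> as a family constant in its parameter,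
  spreads the inclusion of one fibre to a product neighbourhood of
  \<open>(f x, h x)\<close>.\<close>

lemma small_fibres_imp_omega_map:
  assumes h: "continuous_map X (top_of_set unit_cube) h"
    and small: "\<And>y. y \<in> topspace Y \<Longrightarrow> small_fibres h y"
  shows "omega_map X (prod_topology Y (top_of_set unit_cube)) \<omega> (\<lambda>x. (f x, h x))"
  unfolding omega_map_def
proof (intro conjI ballI)
  have hc: "continuous_map X euclidean h" using h by (simp add: continuous_map_in_subtopology)
  show "continuous_map X (prod_topology Y (top_of_set unit_cube)) (\<lambda>x. (f x, h x))"
    using h f by (simp add: continuous_map_paired perfect_map_def)
  fix x assume x: "x \<in> topspace X"
  then have y: "f x \<in> topspace Y" by (rule f_in)
  obtain U where U: "U \<in> insert {} \<omega>" "{x' \<in> F (f x). h x' = h x} \<subseteq> U"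
    using small[OF y] unfolding small_fibres_def by blast
  obtain \<epsilon> V where V: "\<epsilon> > 0" "openin Y V" "f x \<in> V" "\<And>z p' t' x'. \<lbrakk>z \<in> V; dist p' (0::real^'k) < \<epsilon>;
      dist t' (h x) < \<epsilon>; x' \<in> F z; dist (h x') t' < \<epsilon>\<rbrakk> \<Longrightarrow> x' \<in> U"
    using tube_fibres[OF jointly_continuous_const[OF hc] y U] by metis
  let ?W = "V \<times> (unit_cube \<inter> ball (h x) \<epsilon>)"
  have xW: "(f x, h x) \<in> ?W" using V(1,3) h x by (auto simp: continuous_map_in_subtopology)
  have sub: "{x' \<in> topspace X. (f x', h x') \<in> ?W} \<subseteq> U"
    using V(4)[of _ 0] V(1) by (auto simp: F_iff dist_commute)
  then have "x \<in> U" using x xW by blast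
  then have "U \<in> \<omega>" using U by auto
  moreover have "openin (prod_topology Y (top_of_set unit_cube)) ?W"
    by (simp add: openin_prod_Times_iff V openin_open_Int)
  ultimately show "\<exists>V. openin (prod_topology Y (top_of_set unit_cube)) V \<and> (f x, h x) \<in> V \<and>
      (\<exists>U\<in>\<omega>. {x' \<in> topspace X. (f x', h x') \<in> V} \<subseteq> U)"
    using xW sub by blast
qed

section \<open>Partitions of unity on a fibre\<close>

definition averaging :: "'v set \<Rightarrow> ('v \<Rightarrow> 'a \<Rightarrow> real) \<Rightarrow> ('v \<Rightarrow> 'a) \<Rightarrow> bool" where
  "averaging V \<kappa> \<xi> \<longleftrightarrow> finite V \<and> \<xi> ` V \<subseteq> topspace X \<and>
    (\<forall>v\<in>V. continuous_map X euclideanreal (\<kappa> v) \<and> (\<forall>x\<in>topspace X. 0 \<le> \<kappa> v x)) \<and>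
    (\<forall>x\<in>topspace X. (\<Sum>v\<in>V. \<kappa> v x) \<le> 1)"

lemma small_oscillation_neighbourhood:
  assumes u: "jointly_continuous u" and x: "x \<in> topspace X" and \<epsilon>: "\<epsilon> > 0"
  shows "\<exists>U. openin X U \<and> x \<in> U \<and> (\<forall>x'\<in>U. \<forall>p\<in>unit_cube. dist (u p x') (u p x) < \<epsilon>)"
proof -
  let ?Z = "prod_topology (euclidean :: (real^'k) topology) X"
  define W where "W = {q \<in> topspace ?Z. dist (u (fst q) (snd q)) (u (fst q) x) < \<epsilon>}"
  have W: "openin ?Z W"
    unfolding W_def
    by (intro openin_less_continuous continuous_map_dist_real jointly_continuous_comp[OF u]
        continuous_map_fst continuous_map_snd) (use x in auto)
  have K: "compactin euclidean (unit_cube :: (real^'k) set)" by simp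
  have "compactin X {x}" using x by simp
  moreover have "unit_cube \<times> {x} \<subseteq> W" using x \<epsilon> unfolding W_def by auto
  ultimately obtain N O' where "openin X O'" "unit_cube \<subseteq> N" "{x} \<subseteq> O'" "N \<times> O' \<subseteq> W"
    using Wallace_theorem_prod_topology[OF K _ W] by metis
  then show ?thesis unfolding W_def by (intro exI[of _ O']) force
qed

text \<open>Compactness of the fibre makes a cover by sets of small oscillation finite, which is
  what the definition of its dimension requires. Oscillation below \<open>\<epsilon> / 2\<close>
  about a centre gives \<epsilon> between any two points.\<close>

lemma fine_cover_of_fibre:
  assumes y: "y \<in> topspace Y" and \<U>: "finite \<U>" "\<forall>u\<in>\<U>. jointly_continuous u" and \<epsilon>: "\<epsilon> > 0"
  shows "\<exists>V. finite V \<and> open_cover (subtopology X (F y)) V \<and>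
    (\<forall>x\<in>F y. card {v \<in> V. x \<in> v} \<le> n + 1) \<and> (\<forall>v\<in>V. (\<exists>U\<in>\<omega>. v \<subseteq> U) \<and>
      (\<forall>x\<in>v. \<forall>x'\<in>v. \<forall>u\<in>\<U>. \<forall>p\<in>unit_cube. dist (u p x') (u p x) < \<epsilon>))"
proof -
  let ?S = "subtopology X (F y)"
  have topS: "topspace ?S = F y" using F_subset by auto
  have "\<exists>O'. openin X O' \<and> x \<in> O' \<and> (\<exists>U\<in>\<omega>. O' \<subseteq> U) \<and>
      (\<forall>u\<in>\<U>. \<forall>x'\<in>O'. \<forall>p\<in>unit_cube. dist (u p x') (u p x) < \<epsilon> / 2)" if "x \<in> F y" for x
  proof -
    have x: "x \<in> topspace X" using that F_subset by blast
    obtain U where U: "U \<in> \<omega>" "openin X U" "x \<in> U"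
      using x \<omega> unfolding open_cover_def by blast
    obtain N where N: "\<And>u. u \<in> \<U> \<Longrightarrow> openin X (N u) \<and> x \<in> N u \<and>
        (\<forall>x'\<in>N u. \<forall>p\<in>unit_cube. dist (u p x') (u p x) < \<epsilon> / 2)"
      using small_oscillation_neighbourhood[OF \<U>(2)[rule_format] x, of _ "\<epsilon> / 2"] \<epsilon> by (metis half_gt_zero)
    define O' where "O' = U \<inter> {z \<in> topspace X. \<forall>u\<in>\<U>. z \<in> N u}"
    have "{z \<in> topspace X. z \<in> N u} = N u" if "u \<in> \<U>" for u
      using N[OF that] openin_subset by blast
    then have "openin X O'"
      unfolding O'_def using N by (intro openin_Int U openin_finite_Ball \<U>) simp
    moreover have "x \<in> O'" using U N x unfolding O'_def by blast
    moreover have "\<forall>u\<in>\<U>. \<forall>x'\<in>O'. \<forall>p\<in>unit_cube. dist (u p x') (u p x) < \<epsilon> / 2"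
      using N unfolding O'_def by blast
    moreover have "O' \<subseteq> U" unfolding O'_def by blast
    ultimately show ?thesis using U(1) by blast
  qed
  then obtain O' where O': "\<And>x. x \<in> F y \<Longrightarrow> openin X (O' x) \<and> x \<in> O' x \<and> (\<exists>U\<in>\<omega>. O' x \<subseteq> U) \<and>
      (\<forall>u\<in>\<U>. \<forall>x'\<in>O' x. \<forall>p\<in>unit_cube. dist (u p x') (u p x) < \<epsilon> / 2)"
    by metis
  have "compact_space ?S" using compactin_F[OF y] compactin_subspace by blast
  moreover have "openin ?S (F y \<inter> O' x)" if "x \<in> F y" for x
    using O'[OF that] by (simp add: openin_subtopology_Int2)
  moreover have "topspace ?S \<subseteq> \<Union>((\<lambda>x. F y \<inter> O' x) ` F y)"
    unfolding topS using O' by blast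
  ultimately obtain \<C> where \<C>: "finite \<C>" "\<C> \<subseteq> (\<lambda>x. F y \<inter> O' x) ` F y" "topspace ?S \<subseteq> \<Union>\<C>"
    unfolding compact_space_alt by (smt (verit, best) imageE)
  then have "open_cover ?S \<C>"
    unfolding open_cover_def topS using \<open>\<And>x. x \<in> F y \<Longrightarrow> openin ?S (F y \<inter> O' x)\<close> by blast
  moreover have "covering_dim_le ?S n" using dim y unfolding map_dim_le_def F_def by blast
  ultimately have "\<exists>\<V>. finite \<V> \<and> open_cover ?S \<V> \<and> refines \<V> \<C> \<and>
      (\<forall>x\<in>topspace ?S. card {v \<in> \<V>. x \<in> v} \<le> n + 1)"
    using \<C>(1) unfolding covering_dim_le_def by blast
  then obtain \<V> where \<V>: "finite \<V>" "open_cover ?S \<V>" "refines \<V> \<C>"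
      "\<forall>x\<in>F y. card {v \<in> \<V>. x \<in> v} \<le> n + 1"
    unfolding topS by blast
  have "(\<exists>U\<in>\<omega>. v \<subseteq> U) \<and> (\<forall>x\<in>v. \<forall>x'\<in>v. \<forall>u\<in>\<U>. \<forall>p\<in>unit_cube. dist (u p x') (u p x) < \<epsilon>)"
    if "v \<in> \<V>" for v
  proof -
    obtain C where C: "C \<in> \<C>" "v \<subseteq> C" using \<V>(3) \<open>v \<in> \<V>\<close> unfolding refines_def by blast
    then obtain z where "z \<in> F y" "C = F y \<inter> O' z" using \<C>(2) by blast
    then have z: "z \<in> F y" "v \<subseteq> O' z" using C by auto
    have osc: "\<forall>u\<in>\<U>. \<forall>x'\<in>O' z. \<forall>p\<in>unit_cube. dist (u p x') (u p z) < \<epsilon> / 2"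
      using O'[OF z(1)] by (elim conjE)
    have "dist (u p x') (u p x) < \<epsilon>" if "x \<in> v" "x' \<in> v" "u \<in> \<U>" "p \<in> unit_cube" for x x' u p
    proof (rule dist_triangle_half_l)
      show "dist (u p x') (u p z) < \<epsilon> / 2" "dist (u p x) (u p z) < \<epsilon> / 2"
        using osc that z(2) by (simp_all add: subset_iff)
    qed
    moreover have "\<exists>U\<in>\<omega>. v \<subseteq> U" using O'[OF z(1)] z(2) by (meson subset_trans)
    ultimately show ?thesis by simp
  qed
  then show ?thesis using \<V> by (intro exI[of _ \<V>]) simp
qed

text \<open>The partition of unity lives on one fibre, but the deformations built from it are used
  over a neighbourhood of \<open>y\<close>, so the coefficients are needed on all of
  \<open>X\<close>. Tietze extends them, and division by the maximum of 1 and their sum makes the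
  sum at most 1 without changing them on \<open>F y\<close>. Off this fibre the order bound is lost;
  goodness there will come from stability instead.\<close>

lemma fine_averaging:
  assumes y: "y \<in> topspace Y" and \<U>: "finite \<U>" "\<forall>u\<in>\<U>. jointly_continuous u" and \<epsilon>: "\<epsilon> > 0"
  shows "\<exists>V \<kappa> \<xi>. averaging (V :: 'a set set) \<kappa> \<xi> \<and>
    (\<forall>x\<in>F y. (\<Sum>v\<in>V. \<kappa> v x) = 1 \<and> card {v \<in> V. \<kappa> v x \<noteq> 0} \<le> n + 1) \<and>
    (\<forall>v\<in>V. (\<exists>U\<in>\<omega>. {x \<in> F y. \<kappa> v x \<noteq> 0} \<subseteq> U) \<and>
      (\<forall>x\<in>F y. \<kappa> v x \<noteq> 0 \<longrightarrow> (\<forall>u\<in>\<U>. \<forall>p\<in>unit_cube. dist (u p (\<xi> v)) (u p x) < \<epsilon>)))"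
proof -
  let ?S = "subtopology X (F y)"
  have topS: "topspace ?S = F y" using F_subset by auto
  obtain \<V> where \<V>: "finite \<V>" "open_cover ?S \<V>" "\<forall>x\<in>F y. card {v \<in> \<V>. x \<in> v} \<le> n + 1"
      and \<V>': "\<forall>v\<in>\<V>. (\<exists>U\<in>\<omega>. v \<subseteq> U) \<and>
        (\<forall>x\<in>v. \<forall>x'\<in>v. \<forall>u\<in>\<U>. \<forall>p\<in>unit_cube. dist (u p x') (u p x) < \<epsilon>)"
    using fine_cover_of_fibre[OF y \<U> \<epsilon>] by (elim exE conjE)
  have HX: "Hausdorff_space X" using X by (simp add: paracompact_space_def)
  have S: "paracompact_space ?S"
    using compactin_F[OF y] compactin_subspace Hausdorff_space_subtopology[OF HX]
    by (intro compact_Hausdorff_imp_paracompact_space) auto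
  have "locally_finite_in ?S \<V>"
    using finite_imp_locally_finite_in[OF \<V>(1)] \<V>(2) unfolding open_cover_def by simp
  then obtain \<phi> where \<phi>c: "\<And>v. v \<in> \<V> \<Longrightarrow> continuous_map ?S euclideanreal (\<phi> v)"
    and \<phi>pos: "\<And>v x. \<lbrakk>v \<in> \<V>; x \<in> F y\<rbrakk> \<Longrightarrow> 0 \<le> \<phi> v x"
    and \<phi>0: "\<And>v x. \<lbrakk>v \<in> \<V>; x \<in> F y; x \<notin> v\<rbrakk> \<Longrightarrow> \<phi> v x = 0"
    and \<phi>1: "\<And>x. x \<in> F y \<Longrightarrow> (\<Sum>v\<in>{v\<in>\<V>. x \<in> v}. \<phi> v x) = (1::real)"
    using paracompact_partition_of_unity[OF S \<V>(2)] unfolding topS by blast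
  have fin: "finite {v\<in>\<V>. x \<in> v}" for x using \<V>(1) by simp
  have clF: "closedin X (F y)" using compactin_imp_closedin[OF HX compactin_F[OF y]] .
  have le1: "\<phi> v x \<le> 1" if "v \<in> \<V>" "x \<in> F y" for v x
  proof (cases "x \<in> v")
    case True
    then have "\<phi> v x \<le> (\<Sum>v\<in>{v\<in>\<V>. x \<in> v}. \<phi> v x)"
      using that \<phi>pos fin by (intro member_le_sum) auto
    then show ?thesis using \<phi>1[OF that(2)] by simp
  qed (use \<phi>0 that in simp)
  have "\<exists>k. continuous_map X euclideanreal k \<and> (\<forall>x\<in>F y. k x = \<phi> v x) \<and> k ` topspace X \<subseteq> {0..1}"
    if v: "v \<in> \<V>" for v
  proof -
    have "\<phi> v ` F y \<subseteq> {0..1}" using \<phi>pos le1 v by auto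
    then show ?thesis
      using Tietze_extension_closed_real_interval[OF paracompact_imp_normal_space[OF X] clF \<phi>c[OF v]]
      by (metis zero_le_one)
  qed
  then have "\<exists>k. \<forall>v\<in>\<V>. continuous_map X euclideanreal (k v) \<and>
      (\<forall>x\<in>F y. k v x = \<phi> v x) \<and> k v ` topspace X \<subseteq> {0..1}"
    by (intro bchoice ballI)
  then obtain k where "\<forall>v\<in>\<V>. continuous_map X euclideanreal (k v) \<and>
      (\<forall>x\<in>F y. k v x = \<phi> v x) \<and> k v ` topspace X \<subseteq> {0..1}" ..
  then have kc: "\<And>v. v \<in> \<V> \<Longrightarrow> continuous_map X euclideanreal (k v)"
    and kF: "\<And>v x. \<lbrakk>v \<in> \<V>; x \<in> F y\<rbrakk> \<Longrightarrow> k v x = \<phi> v x"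
    and k01: "\<And>v. v \<in> \<V> \<Longrightarrow> k v ` topspace X \<subseteq> {0..1}"
    by simp_all
  \<comment> \<open>Without the empty set every member contains a sample point
    \<open>\<xi> v\<close>.\<close>
  define V where "V = \<V> - {{}}"
  have V: "finite V" "V \<subseteq> \<V>" using \<V>(1) unfolding V_def by auto
  have kpos: "0 \<le> k v x" if "v \<in> V" "x \<in> topspace X" for v x
    using k01[of v] V(2) that by (auto simp: image_subset_iff)
  define N where "N x = max 1 (\<Sum>v\<in>V. k v x)" for x
  define \<kappa> where "\<kappa> v x = k v x / N x" for v x
  define \<xi> where "\<xi> v = (SOME x. x \<in> v)" for v :: "'a set"
  have \<xi>: "\<xi> v \<in> v" if "v \<in> V" for v
    using that unfolding V_def \<xi>_def by (simp add: some_in_eq)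
  have vF: "v \<subseteq> F y" if "v \<in> V" for v
    using that V(2) \<V>(2) unfolding open_cover_def topS by blast
  have N: "N x \<ge> 1" "(\<Sum>v\<in>V. k v x) \<le> N x" for x unfolding N_def by auto
  have Nc: "continuous_map X euclideanreal N"
    unfolding N_def using kc V by (intro continuous_map_real_max continuous_map_sum) auto
  have sum1: "(\<Sum>v\<in>V. k v x) = 1" if x: "x \<in> F y" for x
  proof -
    have "(\<Sum>v\<in>V. k v x) = (\<Sum>v\<in>V. \<phi> v x)"
      using kF V(2) x by (intro sum.cong) auto
    also have "\<dots> = (\<Sum>v\<in>{v\<in>\<V>. x \<in> v}. \<phi> v x)"
      using V \<phi>0 x by (intro sum.mono_neutral_right) (auto simp: V_def)
    finally show ?thesis using \<phi>1[OF x] by simp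
  qed
  have \<kappa>F: "\<kappa> v x = \<phi> v x" if "v \<in> V" "x \<in> F y" for v x
    using kF[of v x] V(2) that sum1[OF that(2)] unfolding \<kappa>_def N_def by auto
  have supp: "x \<in> v" if "v \<in> V" "x \<in> F y" "\<kappa> v x \<noteq> 0" for v x
    using \<kappa>F[OF that(1,2)] \<phi>0[of v x] V(2) that by auto
  have "averaging V \<kappa> \<xi>"
    unfolding averaging_def
  proof (intro conjI ballI V)
    show "\<xi> ` V \<subseteq> topspace X" using \<xi> vF F_subset by blast
    show "continuous_map X euclideanreal (\<kappa> v)" if "v \<in> V" for v
      unfolding \<kappa>_def using kc V(2) that Nc N(1)
      by (intro continuous_map_real_divide) (auto, metis not_one_le_zero)
    show "0 \<le> \<kappa> v x" if "v \<in> V" "x \<in> topspace X" for v x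
      unfolding \<kappa>_def using kpos[OF that] N(1)[of x] by simp
    show "(\<Sum>v\<in>V. \<kappa> v x) \<le> 1" for x
      unfolding \<kappa>_def sum_divide_distrib[symmetric] using N[of x] by simp
  qed
  moreover have "(\<Sum>v\<in>V. \<kappa> v x) = 1 \<and> card {v \<in> V. \<kappa> v x \<noteq> 0} \<le> n + 1" if x: "x \<in> F y" for x
  proof
    show "(\<Sum>v\<in>V. \<kappa> v x) = 1"
      unfolding \<kappa>_def sum_divide_distrib[symmetric] N_def using sum1[OF x] by simp
    have "card {v \<in> V. \<kappa> v x \<noteq> 0} \<le> card {v \<in> \<V>. x \<in> v}"
      using supp[OF _ x] V fin by (intro card_mono) auto
    then show "card {v \<in> V. \<kappa> v x \<noteq> 0} \<le> n + 1" using \<V>(3) x by force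
  qed
  moreover have "(\<exists>U\<in>\<omega>. {x \<in> F y. \<kappa> v x \<noteq> 0} \<subseteq> U) \<and>
      (\<forall>x\<in>F y. \<kappa> v x \<noteq> 0 \<longrightarrow> (\<forall>u\<in>\<U>. \<forall>p\<in>unit_cube. dist (u p (\<xi> v)) (u p x) < \<epsilon>))" if v: "v \<in> V" for v
  proof (intro conjI ballI impI)
    have "{x \<in> F y. \<kappa> v x \<noteq> 0} \<subseteq> v" using supp[OF v] by blast
    moreover obtain U where "U \<in> \<omega>" "v \<subseteq> U" using \<V>' V(2) v by blast
    ultimately show "\<exists>U\<in>\<omega>. {x \<in> F y. \<kappa> v x \<noteq> 0} \<subseteq> U" by blast
    have "\<forall>x\<in>v. \<forall>x'\<in>v. \<forall>u\<in>\<U>. \<forall>p\<in>unit_cube. dist (u p x') (u p x) < \<epsilon>"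
      using \<V>' V(2) v by blast
    then show "dist (u p (\<xi> v)) (u p x) < \<epsilon>"
      if "x \<in> F y" "\<kappa> v x \<noteq> 0" "u \<in> \<U>" "p \<in> unit_cube" for x u p
      using supp[OF v that(1,2)] \<xi>[OF v] that(3,4) by blast
  qed
  ultimately show ?thesis by (intro exI[of _ V] exI[of _ \<kappa>] exI[of _ \<xi>]) blast
qed

text \<open>Only the coordinates number \<open>1, \<dots>, s - 1\<close> of the parameter matter, so that coordinate number
  \<open>s\<close> is free to serve as the time of a deformation.\<close>

definition admissible :: "nat \<Rightarrow> (real^'k \<Rightarrow> 'a \<Rightarrow> real^'k) \<Rightarrow> bool" where
  "admissible s u \<longleftrightarrow> jointly_continuous u \<and>
    (\<forall>p\<in>unit_cube. \<forall>x\<in>topspace X. u p x \<in> unit_cube) \<and>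
    (\<forall>x\<in>topspace X. (\<lambda>p. u p x) differentiable_on UNIV) \<and>
    (\<forall>p q. (\<forall>i. 1 \<le> i \<longrightarrow> i < s \<longrightarrow> p $ e i = q $ e i) \<longrightarrow> u p = u q)"

section \<open>Contraction of finitely many families of good maps\<close>

definition slide where
  "slide V \<kappa> \<xi> s u p x = (1 - p $ e s) *\<^sub>R u p x + (p $ e s) *\<^sub>R interpolate V \<kappa> \<xi> (u p) x"
  for u :: "real^'k \<Rightarrow> 'a \<Rightarrow> real^'k"

definition apex_cone where
  "apex_cone V \<kappa> \<xi> a s u p x = (1 - p $ e s) *\<^sub>R interpolate V \<kappa> \<xi> (u p) x + (p $ e s) *\<^sub>R a x"
  for u :: "real^'k \<Rightarrow> 'a \<Rightarrow> real^'k"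

text \<open>All points of one fibre of \<open>h\<close> share their coefficients, so the fibre lies
  in the support of any coefficient that is nonzero at one of its points, and these supports are
  small.\<close>

lemma coefficients_determine_fibres:
  assumes \<kappa>: "\<And>x. x \<in> F y \<Longrightarrow> (\<Sum>v\<in>V. \<kappa> v x) = (1::real)"
    "\<And>v. v \<in> V \<Longrightarrow> \<exists>U\<in>\<omega>. {x \<in> F y. \<kappa> v x \<noteq> 0} \<subseteq> U"
    and inj: "\<And>x x' v. \<lbrakk>x \<in> F y; x' \<in> F y; h x = h x'; v \<in> V\<rbrakk> \<Longrightarrow> \<kappa> v x = \<kappa> v x'"
  shows "small_fibres h y"
  unfolding small_fibres_def
proof
  fix t
  show "\<exists>U\<in>insert {} \<omega>. {x \<in> F y. h x = t} \<subseteq> U"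
  proof (cases "{x \<in> F y. h x = t} = {}")
    case False
    then obtain x0 where x0: "x0 \<in> F y" "h x0 = t" by blast
    obtain v where v: "v \<in> V" "\<kappa> v x0 \<noteq> 0"
      using \<kappa>(1)[OF x0(1)] by (metis sum.neutral zero_neq_one)
    have "{x \<in> F y. h x = t} \<subseteq> {x \<in> F y. \<kappa> v x \<noteq> 0}"
      using inj[OF _ x0(1) _ v(1)] x0(2) v(2) by auto
    then show ?thesis using \<kappa>(2)[OF v(1)] by blast
  qed blast
qed

text \<open>The slide stays so close to \<open>u p\<close> that stability of goodness suffices. Only
  the cone moves far: there convexity of balls preserves the closeness to \<open>g\<close>, and
  general position of the vectors \<open>b v\<close> makes equal values have equal coefficients. At
  the base of the cone general position says nothing, but the base is the interpolation, which is
  again close to \<open>u p\<close>.\<close>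

lemma improving_step:
  assumes y: "y \<in> topspace Y" and \<U>: "finite \<U>"
    and adm: "\<And>u. u \<in> \<U> \<Longrightarrow> admissible s u"
    and s: "\<U> \<noteq> {} \<Longrightarrow> 1 \<le> s" and k: "s + 2 * n < CARD('k)"
    and good: "\<And>u p. \<lbrakk>u \<in> \<U>; p \<in> unit_cube\<rbrakk> \<Longrightarrow> good (u p) y"
  shows "\<exists>V \<kappa> \<xi> a. averaging (V :: 'a set set) \<kappa> \<xi> \<and> continuous_map X euclidean a \<and>
    a ` topspace X \<subseteq> unit_cube \<and> good a y \<and>
    (\<forall>u\<in>\<U>. \<forall>p\<in>unit_cube. good (slide V \<kappa> \<xi> s u p) y \<and> good (apex_cone V \<kappa> \<xi> a s u p) y)"
proof -
  have jc: "jointly_continuous u" if "u \<in> \<U>" for u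
    using adm[OF that] unfolding admissible_def by (elim conjE)
  have cube: "u p x \<in> unit_cube" if "u \<in> \<U>" "p \<in> unit_cube" "x \<in> topspace X" for u p x
    using adm[OF that(1)] that(2,3) unfolding admissible_def by simp
  have "\<exists>\<epsilon>>0. \<forall>p\<in>unit_cube. \<forall>h. (\<forall>x\<in>F y. dist (h x) (u p x) < \<epsilon>) \<longrightarrow> good h y"
    if u: "u \<in> \<U>" for u
  proof -
    have "\<exists>\<epsilon>>0. \<exists>V. openin Y V \<and> y \<in> V \<and> (\<forall>z\<in>V. \<forall>p\<in>unit_cube. \<forall>h.
        (\<forall>x\<in>F z. dist (h x) (u p x) < \<epsilon>) \<longrightarrow> good h z)"
      using jc u y cube good by (intro good_tube) simp_all
    then show ?thesis by blast
  qed
  then have "\<exists>\<epsilon>. \<forall>u\<in>\<U>. 0 < \<epsilon> u \<and> (\<forall>p\<in>unit_cube. \<forall>h.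
      (\<forall>x\<in>F y. dist (h x) (u p x) < \<epsilon> u) \<longrightarrow> good h y)"
    by (intro bchoice ballI)
  then obtain \<epsilon>' where \<epsilon>': "\<forall>u\<in>\<U>. 0 < \<epsilon>' u \<and> (\<forall>p\<in>unit_cube. \<forall>h.
      (\<forall>x\<in>F y. dist (h x) (u p x) < \<epsilon>' u) \<longrightarrow> good h y)" ..
  obtain \<epsilon>1 where \<epsilon>1_le: "\<epsilon>1 > 0" "\<forall>u\<in>\<U>. \<epsilon>1 \<le> \<epsilon>' u"
    using finite_pos_lower_bound[OF \<U>, of \<epsilon>'] \<epsilon>' by blast
  have \<epsilon>1: "good h y" if "u \<in> \<U>" "p \<in> unit_cube" "\<And>x. x \<in> F y \<Longrightarrow> dist (h x) (u p x) < \<epsilon>1" for u p h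
  proof -
    have "\<forall>x\<in>F y. dist (h x) (u p x) < \<epsilon>' u"
      using that(3) \<epsilon>1_le(2) that(1) by (metis order_less_le_trans)
    then show ?thesis using \<epsilon>' that(1,2) by blast
  qed
  have jg: "jointly_continuous (\<lambda>_. g)" by (rule jointly_continuous_const[OF g])
  have zero_cube: "(0 :: real^'k) \<in> unit_cube" by (simp add: mem_box_cart)
  have "\<exists>\<epsilon>>0. \<exists>V. openin Y V \<and> y \<in> V \<and>
      (\<forall>z\<in>V. \<forall>p\<in>unit_cube :: (real^'k) set. \<forall>x\<in>F z. dist (g x) (g x) + \<epsilon> < \<alpha> x)"
    by (rule tube_close[OF jg y]) (use \<alpha>_pos F_subset in auto)
  then obtain \<epsilon>2 V2 where "\<epsilon>2 > 0" "y \<in> V2"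
      "\<forall>z\<in>V2. \<forall>p\<in>unit_cube :: (real^'k) set. \<forall>x\<in>F z. dist (g x) (g x) + \<epsilon>2 < \<alpha> x"
    by (elim exE conjE)
  then have \<epsilon>2: "\<epsilon>2 > 0" "\<And>x. x \<in> F y \<Longrightarrow> \<epsilon>2 < \<alpha> x" using zero_cube by auto
  define \<epsilon> where "\<epsilon> = min \<epsilon>1 \<epsilon>2 / 2"
  have \<epsilon>: "\<epsilon> > 0" "\<epsilon> < \<epsilon>1" "2 * \<epsilon> \<le> \<epsilon>2" using \<epsilon>1_le(1) \<epsilon>2(1) unfolding \<epsilon>_def by auto
  \<comment> \<open>The map \<open>g\<close> joins as a constant family so that the averaging is
    fine for it as well: then the apex is within \<open>2 * \<epsilon>\<close> of \<open>g\<close>,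
    hence within \<alpha>.\<close>
  have U1: "finite (insert (\<lambda>_. g) \<U>)" "\<forall>u\<in>insert (\<lambda>_. g) \<U>. jointly_continuous u"
    using \<U> jg jc by simp_all
  from fine_averaging[OF y U1 \<epsilon>(1)]
  obtain V :: "'a set set" and \<kappa> \<xi> where avg: "averaging V \<kappa> \<xi>"
    and V1: "\<forall>x\<in>F y. (\<Sum>v\<in>V. \<kappa> v x) = 1 \<and> card {v \<in> V. \<kappa> v x \<noteq> 0} \<le> n + 1"
    and V2: "\<forall>v\<in>V. (\<exists>U\<in>\<omega>. {x \<in> F y. \<kappa> v x \<noteq> 0} \<subseteq> U) \<and> (\<forall>x\<in>F y. \<kappa> v x \<noteq> 0 \<longrightarrow>
        (\<forall>u\<in>insert (\<lambda>_. g) \<U>. \<forall>p\<in>unit_cube. dist (u p (\<xi> v)) (u p x) < \<epsilon>))"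
    by (elim exE conjE)
  have fin: "finite V" and \<xi>: "\<And>v. v \<in> V \<Longrightarrow> \<xi> v \<in> topspace X"
    and \<kappa>c: "\<And>v. v \<in> V \<Longrightarrow> continuous_map X euclideanreal (\<kappa> v)"
    and \<kappa>0: "\<And>v x. \<lbrakk>v \<in> V; x \<in> topspace X\<rbrakk> \<Longrightarrow> 0 \<le> \<kappa> v x"
    and \<kappa>1: "\<And>x. x \<in> topspace X \<Longrightarrow> (\<Sum>v\<in>V. \<kappa> v x) \<le> 1"
    using avg unfolding averaging_def by auto
  have FX: "x \<in> topspace X" if "x \<in> F y" for x using that F_subset by blast
  have osc: "dist (u p (\<xi> v)) (u p x) < \<epsilon>"
    if "v \<in> V" "x \<in> F y" "\<kappa> v x \<noteq> 0" "u \<in> \<U>" "p \<in> unit_cube" for v x u p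
    using V2 that by simp
  have oscg: "dist (g (\<xi> v)) (g x) < \<epsilon>" if "v \<in> V" "x \<in> F y" "\<kappa> v x \<noteq> 0" for v x
  proof -
    have "\<forall>u\<in>insert (\<lambda>_. g) \<U>. \<forall>p\<in>unit_cube. dist (u p (\<xi> v)) (u p x) < \<epsilon>"
      using V2 that by simp
    from bspec[OF bspec[OF this insertI1] zero_cube] show ?thesis .
  qed
  \<comment> \<open>The open cube keeps the range of choice for \<open>b v\<close> open while its
    values stay in the cube; \<open>g (\<xi> v)\<close> lies in its closure, so there are such
    points nearby.\<close>
  define G where "G v = ball (g (\<xi> v)) \<epsilon> \<inter> box 0 1" for v
  have G: "open (G v) \<and> G v \<noteq> {}" if "v \<in> V" for v
  proof
    show "open (G v)" unfolding G_def by (intro open_Int open_ball open_box)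
    have "((\<chi> i. 1 / 2) :: real^'k) \<in> box 0 1" by (simp add: mem_box_cart)
    then have "box 0 1 \<noteq> ({} :: (real^'k) set)" by blast
    then have "g (\<xi> v) \<in> closure (box 0 1)"
      using g_cube[OF \<xi>[OF that]] closure_box by blast
    then obtain z where "z \<in> box 0 1" "dist z (g (\<xi> v)) < \<epsilon>"
      using \<epsilon>(1) unfolding closure_approachable by blast
    then show "G v \<noteq> {}" unfolding G_def by (auto simp: dist_commute)
  qed
  \<comment> \<open>The zero family stands for the apex alone, with \<open>r = 0\<close>; it is the
    only one at the start, when there is nothing to contract.\<close>
  define \<U>' where "\<U>' = insert (\<lambda>_ _. 0) ((\<lambda>u p v. u p (\<xi> v)) ` \<U>)"
  have "\<exists>b. (\<forall>v\<in>V. b v \<in> G v) \<and>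
    (\<forall>c. (\<Sum>v\<in>V. c v) = 0 \<and> (\<exists>v\<in>V. c v \<noteq> 0) \<and> card {v \<in> V. c v \<noteq> 0} \<le> 2 * n + 2 \<longrightarrow>
      (\<forall>u\<in>\<U>'. \<forall>p r. (s = 0 \<longrightarrow> r = 0) \<longrightarrow> (\<Sum>v\<in>V. c v *\<^sub>R (b v + r *\<^sub>R u p v)) \<noteq> 0))"
  proof (rule general_position[OF e k _ _ _ fin G])
    show "finite \<U>'" unfolding \<U>'_def using \<U> by simp
    show "(\<lambda>p. u p v) differentiable_on UNIV" if "u \<in> \<U>'" "v \<in> V" for u v
      using that(1) adm \<xi>[OF that(2)] unfolding \<U>'_def admissible_def by auto
    show "u p = u q" if u: "u \<in> \<U>'" and pq: "\<And>i. \<lbrakk>1 \<le> i; i < s\<rbrakk> \<Longrightarrow> p $ e i = q $ e i" for u p q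
    proof (cases "u = (\<lambda>_ _. 0)")
      case False
      then obtain u' where "u' \<in> \<U>" "u = (\<lambda>p v. u' p (\<xi> v))" using u unfolding \<U>'_def by blast
      moreover have "u' p = u' q"
        using adm[OF \<open>u' \<in> \<U>\<close>] pq unfolding admissible_def by blast
      ultimately show ?thesis by simp
    qed simp
  qed
  then obtain b where b: "\<forall>v\<in>V. b v \<in> G v"
    and gp: "\<forall>c. (\<Sum>v\<in>V. c v) = 0 \<and> (\<exists>v\<in>V. c v \<noteq> 0) \<and> card {v \<in> V. c v \<noteq> 0} \<le> 2 * n + 2 \<longrightarrow>
      (\<forall>u\<in>\<U>'. \<forall>p r. (s = 0 \<longrightarrow> r = 0) \<longrightarrow> (\<Sum>v\<in>V. c v *\<^sub>R (b v + r *\<^sub>R u p v)) \<noteq> 0)"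
    by (elim exE conjE)
  have coeff: "\<kappa> v x = \<kappa> v x'"
    if "x \<in> F y" "x' \<in> F y" "v \<in> V" "w \<in> \<U>'" "s = 0 \<longrightarrow> r = 0"
      and eq: "(\<Sum>v\<in>V. \<kappa> v x *\<^sub>R (b v + r *\<^sub>R w p v)) = (\<Sum>v\<in>V. \<kappa> v x' *\<^sub>R (b v + r *\<^sub>R w p v))"
    for x x' v w p and r :: real
  proof (rule ccontr)
    assume ne: "\<kappa> v x \<noteq> \<kappa> v x'"
    let ?c = "\<lambda>v. \<kappa> v x - \<kappa> v x'"
    have "(\<Sum>v\<in>V. ?c v) = 0" using V1 that(1,2) by (simp add: sum_subtractf)
    moreover have "\<exists>v\<in>V. ?c v \<noteq> 0" using ne \<open>v \<in> V\<close> by auto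
    moreover have "card {v \<in> V. ?c v \<noteq> 0} \<le> 2 * n + 2"
    proof -
      have "card {v \<in> V. ?c v \<noteq> 0} \<le> card ({v \<in> V. \<kappa> v x \<noteq> 0} \<union> {v \<in> V. \<kappa> v x' \<noteq> 0})"
        using fin by (intro card_mono) auto
      also have "\<dots> \<le> card {v \<in> V. \<kappa> v x \<noteq> 0} + card {v \<in> V. \<kappa> v x' \<noteq> 0}" by (rule card_Un_le)
      also have "\<dots> \<le> (n + 1) + (n + 1)" using V1 that(1,2) by (intro add_mono) auto
      finally show ?thesis by simp
    qed
    ultimately have "(\<Sum>v\<in>V. ?c v *\<^sub>R (b v + r *\<^sub>R w p v)) \<noteq> 0"
      using gp[rule_format, of ?c w r p] that(4,5) by blast
    then show False using eq by (simp add: scaleR_diff_left sum_subtractf)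
  qed
  define a where "a x = (\<Sum>v\<in>V. \<kappa> v x *\<^sub>R b v)" for x
  have ac: "continuous_map X euclidean a"
    unfolding a_def using fin \<kappa>c by (intro continuous_map_sum continuous_map_scaleR) auto
  have a_cube: "a x \<in> unit_cube" if "x \<in> topspace X" for x
    unfolding a_def
    by (rule subconvex_sum_mem_unit_cube)
      (use \<kappa>0 \<kappa>1 that b box_subset_cbox[of 0 1] in \<open>auto simp: G_def subset_iff\<close>)
  have a_close: "dist (a x) (g x) < \<alpha> x" if x: "x \<in> F y" for x
    unfolding a_def
  proof (rule convex_sum_dist_less[OF fin])
    show "dist (b v) (g x) < \<alpha> x" if v: "v \<in> V" "\<kappa> v x \<noteq> 0" for v
    proof -
      have "dist (b v) (g (\<xi> v)) < \<epsilon>" using b v(1) unfolding G_def by (simp add: dist_commute)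
      moreover have "dist (b v) (g x) \<le> dist (b v) (g (\<xi> v)) + dist (g (\<xi> v)) (g x)"
        by (rule dist_triangle)
      ultimately show ?thesis using oscg[OF v(1) x v(2)] \<epsilon>(3) \<epsilon>2(2)[OF x] by linarith
    qed
  qed (use V1 x \<kappa>0 FX in auto)
  have good_a: "good a y"
    unfolding good_def
  proof (intro conjI ballI a_close)
    show "small_fibres a y"
    proof (rule coefficients_determine_fibres)
      show "\<kappa> v x = \<kappa> v x'" if "x \<in> F y" "x' \<in> F y" "a x = a x'" "v \<in> V" for x x' v
        using that(3) unfolding a_def
        by (intro coeff[OF that(1,2,4), of "\<lambda>_ _. 0" 0 undefined]) (auto simp: \<U>'_def)
    qed (use V1 V2 in auto)
  qed
  have near: "dist (interpolate V \<kappa> \<xi> (u p) x) (u p x) < \<epsilon>"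
    if "u \<in> \<U>" "p \<in> unit_cube" "x \<in> F y" for u p x
    unfolding interpolate_def
    by (rule convex_sum_dist_less[OF fin]) (use V1 that \<kappa>0 FX osc in auto)
  have good_P: "good (interpolate V \<kappa> \<xi> (u p)) y" if "u \<in> \<U>" "p \<in> unit_cube" for u p
    using near[OF that] \<epsilon>(2) by (intro \<epsilon>1[OF that]) force
  have p01: "0 \<le> p $ i" "p $ i \<le> 1" if "p \<in> unit_cube" for p :: "real^'k" and i
    using that by (auto simp: mem_box_cart)
  have good_slide: "good (slide V \<kappa> \<xi> s u p) y" if u: "u \<in> \<U>" and p: "p \<in> unit_cube" for u p
  proof (rule \<epsilon>1[OF that])
    fix x assume x: "x \<in> F y"
    have "slide V \<kappa> \<xi> s u p x - u p x = p $ e s *\<^sub>R (interpolate V \<kappa> \<xi> (u p) x - u p x)"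
      unfolding slide_def by (simp add: algebra_simps)
    then have "dist (slide V \<kappa> \<xi> s u p x) (u p x) = p $ e s * dist (interpolate V \<kappa> \<xi> (u p) x) (u p x)"
      using p01[OF p, of "e s"] by (simp add: dist_norm)
    also have "\<dots> \<le> dist (interpolate V \<kappa> \<xi> (u p) x) (u p x)"
      using p01[OF p, of "e s"] by (simp add: mult_left_le_one_le)
    finally show "dist (slide V \<kappa> \<xi> s u p x) (u p x) < \<epsilon>1" using near[OF u p x] \<epsilon>(2) by linarith
  qed
  have good_apex_cone: "good (apex_cone V \<kappa> \<xi> a s u p) y" if u: "u \<in> \<U>" and p: "p \<in> unit_cube" for u p
  proof (cases "p $ e s = 0")
    case True
    then have "apex_cone V \<kappa> \<xi> a s u p = interpolate V \<kappa> \<xi> (u p)" unfolding apex_cone_def by (simp add: fun_eq_iff)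
    then show ?thesis using good_P[OF u p] by simp
  next
    case False
    define \<sigma> where "\<sigma> = p $ e s"
    have \<sigma>: "0 < \<sigma>" "\<sigma> \<le> 1" using False p01[OF p, of "e s"] unfolding \<sigma>_def by auto
    define r where "r = (1 - \<sigma>) / \<sigma>"
    have cone_eq: "apex_cone V \<kappa> \<xi> a s u p x = \<sigma> *\<^sub>R (\<Sum>v\<in>V. \<kappa> v x *\<^sub>R (b v + r *\<^sub>R u p (\<xi> v)))" for x
    proof -
      have "\<sigma> * r = 1 - \<sigma>" using \<sigma> unfolding r_def by simp
      then have "apex_cone V \<kappa> \<xi> a s u p x =
          \<sigma> *\<^sub>R (r *\<^sub>R interpolate V \<kappa> \<xi> (u p) x + a x)"
        unfolding apex_cone_def \<sigma>_def[symmetric] by (simp add: scaleR_add_right)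
      also have "r *\<^sub>R interpolate V \<kappa> \<xi> (u p) x + a x = (\<Sum>v\<in>V. \<kappa> v x *\<^sub>R (b v + r *\<^sub>R u p (\<xi> v)))"
        unfolding interpolate_def a_def
        by (simp add: scaleR_add_right sum.distrib scaleR_sum_right mult.commute)
      finally show ?thesis .
    qed
    show ?thesis
      unfolding good_def
    proof (intro conjI ballI)
      fix x assume x: "x \<in> F y"
      have "interpolate V \<kappa> \<xi> (u p) x \<in> ball (g x) (\<alpha> x)" "a x \<in> ball (g x) (\<alpha> x)"
        using good_P[OF u p] good_a x unfolding good_def by (simp_all add: dist_commute)
      then have "apex_cone V \<kappa> \<xi> a s u p x \<in> ball (g x) (\<alpha> x)"
        unfolding apex_cone_def \<sigma>_def[symmetric] using \<sigma> convex_ball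
        by (intro convexD) auto
      then show "dist (apex_cone V \<kappa> \<xi> a s u p x) (g x) < \<alpha> x" by (simp add: dist_commute)
    next
      show "small_fibres (apex_cone V \<kappa> \<xi> a s u p) y"
      proof (rule coefficients_determine_fibres)
        show "\<kappa> v x = \<kappa> v x'"
          if "x \<in> F y" "x' \<in> F y" "apex_cone V \<kappa> \<xi> a s u p x = apex_cone V \<kappa> \<xi> a s u p x'" "v \<in> V" for x x' v
        proof (rule coeff[OF that(1,2,4), of "\<lambda>p v. u p (\<xi> v)" r p])
          show "(\<lambda>p v. u p (\<xi> v)) \<in> \<U>'" unfolding \<U>'_def using u by blast
          show "s = 0 \<longrightarrow> r = 0" using s u by auto
        qed (use that(3) \<sigma> in \<open>simp add: cone_eq\<close>)
      qed (use V1 V2 in auto)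
    qed
  qed
  show ?thesis
    by (intro exI[of _ V] exI[of _ \<kappa>] exI[of _ \<xi>] exI[of _ a] conjI ballI avg ac good_a good_slide good_apex_cone)
      (use a_cube in blast)
qed

lemma admissible_const:
  assumes "continuous_map X euclidean a" "a ` topspace X \<subseteq> unit_cube"
  shows "admissible s (\<lambda>_. a)"
  using assms jointly_continuous_const[OF assms(1)] unfolding admissible_def by auto

lemma admissible_mono: "admissible s u \<Longrightarrow> s \<le> s' \<Longrightarrow> admissible s' u"
  unfolding admissible_def by (meson order_less_le_trans)

lemma interpolate_cube:
  assumes "averaging V \<kappa> \<xi>" "q ` topspace X \<subseteq> unit_cube" "x \<in> topspace X"
  shows "interpolate V \<kappa> \<xi> q x \<in> (unit_cube :: (real^'k) set)"
  unfolding interpolate_def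
  by (rule subconvex_sum_mem_unit_cube) (use assms in \<open>auto simp: averaging_def\<close>)

lemma unit_cube_convex_combination:
  assumes "a \<in> unit_cube" "b \<in> unit_cube" "0 \<le> \<sigma>" "\<sigma> \<le> 1"
  shows "(1 - \<sigma>) *\<^sub>R a + \<sigma> *\<^sub>R b \<in> (unit_cube :: (real^'k) set)"
  using convexD_alt[OF convex_box(1) assms] .

lemma continuous_map_interpolate:
  fixes q :: "'z \<Rightarrow> 'a \<Rightarrow> 'c::real_normed_vector"
  assumes avg: "averaging V \<kappa> \<xi>" and b: "continuous_map Z X b"
    and q: "\<And>x. x \<in> topspace X \<Longrightarrow> continuous_map Z euclidean (\<lambda>z. q z x)"
  shows "continuous_map Z euclidean (\<lambda>z. interpolate V \<kappa> \<xi> (q z) (b z))"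
  unfolding interpolate_def
proof (intro continuous_map_sum continuous_map_scaleR q)
  show "finite V" using avg unfolding averaging_def by blast
  fix v assume v: "v \<in> V"
  then show "\<xi> v \<in> topspace X" using avg unfolding averaging_def by blast
  have "continuous_map X euclideanreal (\<kappa> v)" using avg v unfolding averaging_def by blast
  from continuous_map_compose[OF b this] show "continuous_map Z euclideanreal (\<lambda>z. \<kappa> v (b z))"
    by (simp add: o_def)
qed

lemma continuous_map_coordinate:
  "continuous_map (prod_topology (euclidean :: (real^'k) topology) X) euclideanreal (\<lambda>q. fst q $ i)"
  using continuous_map_compose[OF continuous_map_fst, of euclidean euclideanreal "\<lambda>p :: real^'k. p $ i" X]
  by (simp add: o_def continuous_on_component)

lemma differentiable_coordinate: "(\<lambda>p :: real^'k. p $ i) differentiable_on UNIV"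
  unfolding differentiable_on_def
  by (intro ballI bounded_linear_imp_differentiable[OF bounded_linear_vec_nth])

text \<open>The time enters affinely through coordinate \<open>e s\<close>, which \<open>u\<close>
  does not read. With \<open>1 \<le> s\<close> this coordinate is one that a family of the next
  stage may depend on.\<close>

lemma
  assumes u: "admissible s u" and avg: "averaging V \<kappa> \<xi>" and s: "1 \<le> s"
  shows admissible_slide: "admissible (Suc s) (slide V \<kappa> \<xi> s u)"
    and admissible_apex_cone: "\<lbrakk>continuous_map X euclidean a; a ` topspace X \<subseteq> unit_cube\<rbrakk> \<Longrightarrow>
      admissible (Suc s) (apex_cone V \<kappa> \<xi> a s u)"
proof -
  let ?Z = "prod_topology (euclidean :: (real^'k) topology) X"
  have jc: "jointly_continuous u"
    and cube: "\<And>p x. \<lbrakk>p \<in> unit_cube; x \<in> topspace X\<rbrakk> \<Longrightarrow> u p x \<in> unit_cube"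
    and diff: "\<And>x. x \<in> topspace X \<Longrightarrow> (\<lambda>p. u p x) differentiable_on UNIV"
    and dep: "\<And>p q. (\<And>i. \<lbrakk>1 \<le> i; i < s\<rbrakk> \<Longrightarrow> p $ e i = q $ e i) \<Longrightarrow> u p = u q"
    using u unfolding admissible_def by blast+
  have fin: "finite V" and \<xi>: "\<And>v. v \<in> V \<Longrightarrow> \<xi> v \<in> topspace X"
    using avg unfolding averaging_def by blast+
  have c2: "continuous_map ?Z X snd" by (rule continuous_map_snd)
  have cu: "continuous_map ?Z euclidean (\<lambda>q. u (fst q) (b q))" if "continuous_map ?Z X b" for b
    by (rule jointly_continuous_comp[OF jc continuous_map_fst that])
  have ci: "continuous_map ?Z euclidean (\<lambda>q. interpolate V \<kappa> \<xi> (u (fst q)) (snd q))"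
    by (rule continuous_map_interpolate[OF avg c2]) (rule cu, simp)
  have di: "(\<lambda>p. interpolate V \<kappa> \<xi> (u p) x) differentiable_on UNIV" if "x \<in> topspace X" for x
    unfolding interpolate_def using diff \<xi> fin unfolding differentiable_on_def
    by (intro ballI differentiable_sum differentiable_scaleR differentiable_const) auto
  have icube: "interpolate V \<kappa> \<xi> (u p) x \<in> unit_cube" if "p \<in> unit_cube" "x \<in> topspace X" for p x
    using cube that by (intro interpolate_cube[OF avg]) auto
  have p01: "0 \<le> p $ i" "p $ i \<le> 1" if "p \<in> unit_cube" for p :: "real^'k" and i
    using that by (auto simp: mem_box_cart)
  have dep': "u p = u q \<and> p $ e s = q $ e s" if "\<forall>i. 1 \<le> i \<longrightarrow> i < Suc s \<longrightarrow> p $ e i = q $ e i" for p q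
    using dep[of p q] that s by simp
  show "admissible (Suc s) (slide V \<kappa> \<xi> s u)"
    unfolding admissible_def
  proof (intro conjI ballI allI impI)
    show "jointly_continuous (slide V \<kappa> \<xi> s u)"
      unfolding slide_def case_prod_unfold
      by (intro continuous_map_add continuous_map_scaleR continuous_map_diff continuous_map_coordinate
          cu c2 ci) simp
    show "slide V \<kappa> \<xi> s u p x \<in> unit_cube" if "p \<in> unit_cube" "x \<in> topspace X" for p x
      unfolding slide_def using that p01 by (intro unit_cube_convex_combination cube icube)
    show "(\<lambda>p. slide V \<kappa> \<xi> s u p x) differentiable_on UNIV" if "x \<in> topspace X" for x
      unfolding slide_def using diff[OF that] di[OF that] differentiable_coordinate
      unfolding differentiable_on_def
      by (intro ballI differentiable_add differentiable_scaleR differentiable_diff differentiable_const) auto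
    show "slide V \<kappa> \<xi> s u p = slide V \<kappa> \<xi> s u q"
      if "\<forall>i. 1 \<le> i \<longrightarrow> i < Suc s \<longrightarrow> p $ e i = q $ e i" for p q
      using dep'[OF that] unfolding slide_def by simp
  qed
  assume a: "continuous_map X euclidean a" "a ` topspace X \<subseteq> unit_cube"
  have ca: "continuous_map ?Z euclidean (\<lambda>q. a (snd q))"
    using continuous_map_compose[OF c2 a(1)] by (simp add: o_def)
  show "admissible (Suc s) (apex_cone V \<kappa> \<xi> a s u)"
    unfolding admissible_def
  proof (intro conjI ballI allI impI)
    show "jointly_continuous (apex_cone V \<kappa> \<xi> a s u)"
      unfolding apex_cone_def case_prod_unfold
      by (intro continuous_map_add continuous_map_scaleR continuous_map_diff continuous_map_coordinate
          ca ci) simp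
    show "apex_cone V \<kappa> \<xi> a s u p x \<in> unit_cube" if "p \<in> unit_cube" "x \<in> topspace X" for p x
      unfolding apex_cone_def using that p01 a(2) by (intro unit_cube_convex_combination icube) auto
    show "(\<lambda>p. apex_cone V \<kappa> \<xi> a s u p x) differentiable_on UNIV" if "x \<in> topspace X" for x
      unfolding apex_cone_def using di[OF that] differentiable_coordinate
      unfolding differentiable_on_def
      by (intro ballI differentiable_add differentiable_scaleR differentiable_diff differentiable_const) auto
    show "apex_cone V \<kappa> \<xi> a s u p = apex_cone V \<kappa> \<xi> a s u q"
      if "\<forall>i. 1 \<le> i \<longrightarrow> i < Suc s \<longrightarrow> p $ e i = q $ e i" for p q
      using dep'[OF that] unfolding apex_cone_def by simp
  qed
qed

text \<open>\<open>\<U> y\<close> collects the candidates for \<open>\<theta>(y)\<close>. The last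
  clause is upper semicontinuity: an improvement made for all of \<open>\<U> y\<close> also applies
  to every candidate at nearby points.\<close>

definition stage :: "nat \<Rightarrow> ('b \<Rightarrow> (real^'k \<Rightarrow> 'a \<Rightarrow> real^'k) set) \<Rightarrow> bool" where
  "stage s \<U> \<longleftrightarrow> (\<forall>y\<in>topspace Y. finite (\<U> y) \<and> (s = 0 \<longrightarrow> \<U> y = {}) \<and>
    (\<forall>u\<in>\<U> y. admissible s u \<and> (\<forall>p\<in>unit_cube. good (u p) y)) \<and>
    (\<exists>N. openin Y N \<and> y \<in> N \<and> (\<forall>z\<in>N. \<U> z \<subseteq> \<U> y)))"

definition improvement where
  "improvement s \<U> y V \<kappa> \<xi> a N \<longleftrightarrow> averaging (V :: 'a set set) \<kappa> \<xi> \<and> continuous_map X euclidean a \<and>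
    a ` topspace X \<subseteq> unit_cube \<and> openin Y N \<and> y \<in> N \<and> (\<forall>z\<in>N. \<U> z \<subseteq> \<U> y \<and> good a z \<and>
      (\<forall>u\<in>\<U> y. \<forall>p\<in>unit_cube. good (slide V \<kappa> \<xi> s u p) z \<and> good (apex_cone V \<kappa> \<xi> a s u p) z))"

lemma good_neighbourhood:
  assumes y: "y \<in> topspace Y" and \<U>: "finite \<U>"
    and adm: "\<And>u. u \<in> \<U> \<Longrightarrow> admissible s u" and good: "\<And>u p. \<lbrakk>u \<in> \<U>; p \<in> unit_cube\<rbrakk> \<Longrightarrow> good (u p) y"
  shows "\<exists>N. openin Y N \<and> y \<in> N \<and> (\<forall>z\<in>N. \<forall>u\<in>\<U>. \<forall>p\<in>unit_cube. good (u p) z)"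
proof -
  have "\<exists>N. openin Y N \<and> y \<in> N \<and> (\<forall>z\<in>N. \<forall>p\<in>unit_cube. good (u p) z)" if u: "u \<in> \<U>" for u
  proof -
    have "\<exists>\<epsilon>>0. \<exists>V. openin Y V \<and> y \<in> V \<and> (\<forall>z\<in>V. \<forall>p\<in>unit_cube. \<forall>h.
        (\<forall>x\<in>F z. dist (h x) (u p x) < \<epsilon>) \<longrightarrow> good h z)"
      using adm[OF u] u y good unfolding admissible_def by (intro good_tube) simp_all
    then obtain \<epsilon> N where "\<epsilon> > 0" "openin Y N" "y \<in> N" "\<forall>z\<in>N. \<forall>p\<in>unit_cube. \<forall>h.
        (\<forall>x\<in>F z. dist (h x) (u p x) < \<epsilon>) \<longrightarrow> good h z"
      by blast
    then show ?thesis by (intro exI[of _ N]) simp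
  qed
  then have "\<exists>N. \<forall>u\<in>\<U>. openin Y (N u) \<and> y \<in> N u \<and> (\<forall>z\<in>N u. \<forall>p\<in>unit_cube. good (u p) z)"
    by (intro bchoice ballI)
  then obtain N where N: "\<forall>u\<in>\<U>. openin Y (N u) \<and> y \<in> N u \<and> (\<forall>z\<in>N u. \<forall>p\<in>unit_cube. good (u p) z)" ..
  let ?N = "{z \<in> topspace Y. \<forall>u\<in>\<U>. z \<in> N u}"
  have "openin Y {z \<in> topspace Y. z \<in> N u}" if "u \<in> \<U>" for u
  proof -
    have "{z \<in> topspace Y. z \<in> N u} = N u" using N that openin_subset[of Y "N u"] by blast
    then show ?thesis using N that by simp
  qed
  then have "openin Y ?N" by (rule openin_finite_Ball[OF \<U>])
  moreover have "y \<in> ?N" using N y by simp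
  moreover have "\<forall>z\<in>?N. \<forall>u\<in>\<U>. \<forall>p\<in>unit_cube. good (u p) z" using N by simp
  ultimately show ?thesis by (intro exI[of _ ?N]) simp
qed

lemma improvement_exists:
  assumes st: "stage s \<U>" and k: "s + 2 * n < CARD('k)" and y: "y \<in> topspace Y"
  shows "\<exists>V \<kappa> \<xi> a N. improvement s \<U> y V \<kappa> \<xi> a N"
proof -
  have fin: "finite (\<U> y)" and s0: "s = 0 \<longrightarrow> \<U> y = {}"
    and adm: "\<And>u. u \<in> \<U> y \<Longrightarrow> admissible s u"
    and gd: "\<And>u p. \<lbrakk>u \<in> \<U> y; p \<in> unit_cube\<rbrakk> \<Longrightarrow> good (u p) y"
    and loc: "\<exists>N. openin Y N \<and> y \<in> N \<and> (\<forall>z\<in>N. \<U> z \<subseteq> \<U> y)"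
    using st y unfolding stage_def by blast+
  have s: "1 \<le> s" if "\<U> y \<noteq> {}" using s0 that by (cases s) auto
  obtain N1 where N1: "openin Y N1" "y \<in> N1" "\<forall>z\<in>N1. \<U> z \<subseteq> \<U> y" using loc by blast
  have "\<exists>V \<kappa> \<xi> a. averaging (V :: 'a set set) \<kappa> \<xi> \<and> continuous_map X euclidean a \<and>
    a ` topspace X \<subseteq> unit_cube \<and> good a y \<and>
    (\<forall>u\<in>\<U> y. \<forall>p\<in>unit_cube. good (slide V \<kappa> \<xi> s u p) y \<and> good (apex_cone V \<kappa> \<xi> a s u p) y)"
    by (rule improving_step[OF y fin _ s k]) (simp_all add: adm gd)
  then obtain V :: "'a set set" and \<kappa> \<xi> a where avg: "averaging V \<kappa> \<xi>" and a: "continuous_map X euclidean a"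
    "a ` topspace X \<subseteq> unit_cube" "good a y"
    and sc: "\<forall>u\<in>\<U> y. \<forall>p\<in>unit_cube. good (slide V \<kappa> \<xi> s u p) y \<and> good (apex_cone V \<kappa> \<xi> a s u p) y"
    by (elim exE conjE)
  define \<U>' where "\<U>' = insert (\<lambda>_. a) (slide V \<kappa> \<xi> s ` \<U> y \<union> apex_cone V \<kappa> \<xi> a s ` \<U> y)"
  have "\<exists>N. openin Y N \<and> y \<in> N \<and> (\<forall>z\<in>N. \<forall>u\<in>\<U>'. \<forall>p\<in>unit_cube. good (u p) z)"
  proof (rule good_neighbourhood[OF y, of _ "Suc s"])
    show "finite \<U>'" unfolding \<U>'_def using fin by simp
    show "admissible (Suc s) u" if "u \<in> \<U>'" for u
      using that admissible_const[OF a(1,2)] admissible_slide[OF adm avg s] admissible_apex_cone[OF adm avg s a(1,2)]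
      unfolding \<U>'_def by blast
    show "good (u p) y" if "u \<in> \<U>'" "p \<in> unit_cube" for u p
      using that a(3) sc unfolding \<U>'_def by blast
  qed
  then obtain N2 where N2: "openin Y N2" "y \<in> N2" "\<forall>z\<in>N2. \<forall>u\<in>\<U>'. \<forall>p\<in>unit_cube. good (u p) z"
    by blast
  have "improvement s \<U> y V \<kappa> \<xi> a (N1 \<inter> N2)"
    unfolding improvement_def
  proof (intro conjI ballI avg a(1,2) openin_Int N1(1) N2(1))
    show "y \<in> N1 \<inter> N2" using N1 N2 by blast
    fix z assume z: "z \<in> N1 \<inter> N2"
    have g: "good (u p) z" if "u \<in> \<U>'" "p \<in> unit_cube" for u p using N2(3) z that by blast
    show "\<U> z \<subseteq> \<U> y" using N1(3) z by blast
    have "(0 :: real^'k) \<in> unit_cube" by (simp add: mem_box_cart)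
    from g[OF _ this, of "\<lambda>_. a"] show "good a z" unfolding \<U>'_def by simp
    show "good (slide V \<kappa> \<xi> s u p) z" if "u \<in> \<U> y" "p \<in> unit_cube" for u p
      by (rule g[OF _ that(2)]) (simp add: \<U>'_def that)
    show "good (apex_cone V \<kappa> \<xi> a s u p) z" if "u \<in> \<U> y" "p \<in> unit_cube" for u p
      by (rule g[OF _ that(2)]) (simp add: \<U>'_def that)
  qed
  then show ?thesis by blast
qed

section \<open>Selections and the induction over the disjoint families\<close>

abbreviation YX :: "('b \<times> 'a) topology" where
  "YX \<equiv> prod_topology Y X"

text \<open>The family \<open>u\<close> and the parameter \<open>p\<close> may jump with
  \<open>y\<close>; only the resulting map has to be jointly continuous, since mere membership
  already yields goodness.\<close>

definition selection where
  "selection \<U> B \<theta> \<longleftrightarrow> continuous_map (subtopology YX (B \<times> UNIV)) euclidean (\<lambda>q. \<theta> (fst q) (snd q)) \<and>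
    (\<forall>y\<in>B. \<exists>u\<in>\<U> y. \<exists>p\<in>unit_cube. \<forall>x\<in>topspace X. \<theta> y x = u p x)"
  for \<U> :: "'b \<Rightarrow> (real^'k \<Rightarrow> 'a \<Rightarrow> real^'k) set"

definition disjoint_refinement :: "'b set set \<Rightarrow> 'b set set \<Rightarrow> bool" where
  "disjoint_refinement D \<Gamma> \<longleftrightarrow> (\<forall>V\<in>D. openin Y V) \<and> disjoint D \<and> refines D \<Gamma>"

text \<open>The cover is quantified before the families, so that later stages can pass to a finer
  cover and the families can be chosen after all stages.\<close>

definition selectable :: "nat \<Rightarrow> ('b \<Rightarrow> (real^'k \<Rightarrow> 'a \<Rightarrow> real^'k) set) \<Rightarrow> bool" where
  "selectable s \<U> \<longleftrightarrow> (\<exists>\<Gamma>. open_cover Y \<Gamma> \<and> (\<forall>D. (\<forall>i<s. disjoint_refinement (D i) \<Gamma>) \<longrightarrow>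
    (\<forall>B. closedin Y B \<and> B \<subseteq> (\<Union>i<s. \<Union>(D i)) \<longrightarrow> (\<exists>\<theta>. selection \<U> B \<theta>))))"

text \<open>First \<open>q\<close> slides to its interpolation, which then moves along the cone with apex \<open>a\<close>.\<close>

definition deform where
  "deform V \<kappa> \<xi> a t q x = (1 - max 0 (2 * t - 1)) *\<^sub>R
      ((1 - min 1 (2 * t)) *\<^sub>R q x + min 1 (2 * t) *\<^sub>R interpolate V \<kappa> \<xi> q x) + max 0 (2 * t - 1) *\<^sub>R a x"
  for t :: real and q :: "'a \<Rightarrow> real^'k"

lemma deform_0 [simp]: "deform V \<kappa> \<xi> a 0 q x = q x"
  and deform_1 [simp]: "deform V \<kappa> \<xi> a 1 q x = a x"
  unfolding deform_def by simp_all

text \<open>\<open>u\<close> ignores coordinate \<open>e s\<close>, so the time can be written there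
  without changing the map; each moment of the deformation is then a member of one of the two new
  families.\<close>

lemma deform_cases:
  assumes u: "admissible s u" and s: "s < CARD('k)" and p: "p \<in> unit_cube" and avg: "averaging V \<kappa> \<xi>"
    and t: "0 \<le> t" "t \<le> 1" and q: "\<forall>x\<in>topspace X. q x = u p x"
  shows "\<exists>p'\<in>unit_cube. (\<forall>x\<in>topspace X. deform V \<kappa> \<xi> a t q x = slide V \<kappa> \<xi> s u p' x) \<or>
    (\<forall>x\<in>topspace X. deform V \<kappa> \<xi> a t q x = apex_cone V \<kappa> \<xi> a s u p' x)"
proof -
  define P where "P \<sigma> = (\<chi> i. if i = e s then \<sigma> else p $ i)" for \<sigma>
  have Pcube: "P \<sigma> \<in> unit_cube" if "0 \<le> \<sigma>" "\<sigma> \<le> 1" for \<sigma>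
    using p that unfolding P_def by (simp add: mem_box_cart)
  have Ps: "P \<sigma> $ e s = \<sigma>" for \<sigma> unfolding P_def by simp
  have "e i \<noteq> e s" if "i < s" for i
    using e s that unfolding bij_betw_def inj_on_def by (metis lessThan_iff less_irrefl order_less_trans)
  then have "P \<sigma> $ e i = p $ e i" if "i < s" for \<sigma> i using that unfolding P_def by simp
  then have uP: "u (P \<sigma>) = u p" for \<sigma> using u unfolding admissible_def by blast
  have iq: "interpolate V \<kappa> \<xi> q x = interpolate V \<kappa> \<xi> (u p) x" for x
    unfolding interpolate_def using avg q unfolding averaging_def
    by (intro sum.cong) auto
  show ?thesis
  proof (cases "t \<le> 1 / 2")
    case True
    then have "deform V \<kappa> \<xi> a t q x = slide V \<kappa> \<xi> s u (P (2 * t)) x" if "x \<in> topspace X" for x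
      using that q unfolding deform_def slide_def Ps uP iq by simp
    then show ?thesis using Pcube[of "2 * t"] True t by auto
  next
    case False
    then have "deform V \<kappa> \<xi> a t q x = apex_cone V \<kappa> \<xi> a s u (P (2 * t - 1)) x" if "x \<in> topspace X" for x
      unfolding deform_def apex_cone_def Ps uP iq by simp
    then show ?thesis using Pcube[of "2 * t - 1"] False t by auto
  qed
qed

lemma continuous_map_deform:
  fixes Q :: "('b \<times> 'a) set"
  assumes avg: "averaging V \<kappa> \<xi>" and a: "continuous_map X euclidean a" and \<tau>: "continuous_map Y euclideanreal \<tau>"
    and \<theta>: "continuous_map (subtopology YX (C \<times> UNIV)) euclidean (\<lambda>q. \<theta> (fst q) (snd q))"
    and Q: "Q \<subseteq> C \<times> UNIV"
  shows "continuous_map (subtopology YX Q) euclidean (\<lambda>q. deform V \<kappa> \<xi> a (\<tau> (fst q)) (\<theta> (fst q)) (snd q))"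
proof -
  let ?S = "subtopology YX Q"
  have c1: "continuous_map ?S Y fst" and c2: "continuous_map ?S X snd"
    by (auto intro: continuous_map_from_subtopology continuous_map_fst continuous_map_snd)
  have ct: "continuous_map ?S euclideanreal (\<lambda>q. \<tau> (fst q))"
    using continuous_map_compose[OF c1 \<tau>] by (simp add: o_def)
  have ca: "continuous_map ?S euclidean (\<lambda>q. a (snd q))"
    using continuous_map_compose[OF c2 a] by (simp add: o_def)
  have c\<theta>: "continuous_map ?S euclidean (\<lambda>q. \<theta> (fst q) (b q))" if b: "continuous_map ?S X b" for b
  proof -
    have "continuous_map ?S YX (\<lambda>q. (fst q, b q))"
      using c1 b by (simp add: continuous_map_paired)
    then have "continuous_map ?S (subtopology YX (C \<times> UNIV)) (\<lambda>q. (fst q, b q))"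
      unfolding continuous_map_in_subtopology using Q by auto
    from continuous_map_compose[OF this \<theta>] show ?thesis by (simp add: o_def)
  qed
  have ci: "continuous_map ?S euclidean (\<lambda>q. interpolate V \<kappa> \<xi> (\<theta> (fst q)) (snd q))"
    by (rule continuous_map_interpolate[OF avg c2]) (rule c\<theta>, simp)
  show ?thesis
    unfolding deform_def
    by (intro continuous_map_add continuous_map_scaleR continuous_map_diff continuous_map_real_max
        continuous_map_real_min continuous_map_real_mult ct ca c\<theta> c2 ci) simp_all
qed

lemma stage_0: "stage 0 (\<lambda>_. {})" "selectable 0 (\<lambda>_. {})"
proof -
  show "stage 0 (\<lambda>_. {})" unfolding stage_def by auto
  have "selection (\<lambda>_. {}) {} \<theta>" for \<theta>
    unfolding selection_def by (simp add: continuous_map_on_empty2)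
  moreover have "open_cover Y {topspace Y}" unfolding open_cover_def by simp
  ultimately show "selectable 0 (\<lambda>_. {})" unfolding selectable_def by (intro exI[of _ "{topspace Y}"]) auto
qed

text \<open>The local improvements are attached to a locally finite cover of \<open>Y\<close>, and
  every candidate is contracted by each improvement available at its point. A selection over the
  earlier families is extended over the members of \<open>D s\<close> by contracting it, with
  growing distance from the part that \<open>D s\<close> leaves uncovered, to an apex that no longer
  involves it.\<close>

lemma stage_Suc:
  assumes st: "stage s \<U>" and sel: "selectable s \<U>" and k: "s + 2 * n < CARD('k)"
  shows "\<exists>\<U>'. stage (Suc s) \<U>' \<and> selectable (Suc s) \<U>'"
proof -
  have "\<exists>V \<kappa> \<xi> a N. \<forall>y\<in>topspace Y. improvement s \<U> y (V y) (\<kappa> y) (\<xi> y) (a y) (N y)"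
    using improvement_exists[OF st k] by metis
  then obtain V \<kappa> \<xi> a N where imp: "\<And>y. y \<in> topspace Y \<Longrightarrow> improvement s \<U> y (V y) (\<kappa> y) (\<xi> y) (a y) (N y)"
    by blast
  have "open_cover Y (N ` topspace Y)"
    using imp openin_subset unfolding open_cover_def improvement_def by fast
  then obtain \<gamma> where \<gamma>: "open_cover Y \<gamma>" "locally_finite_in Y \<gamma>"
      "\<And>W. W \<in> \<gamma> \<Longrightarrow> \<exists>U\<in>N ` topspace Y. Y closure_of W \<subseteq> U"
    using paracompact_closure_refinement[OF Y] by blast
  have "\<forall>W\<in>\<gamma>. \<exists>y. y \<in> topspace Y \<and> Y closure_of W \<subseteq> N y" using \<gamma>(3) by blast
  then obtain c where c: "\<And>W. W \<in> \<gamma> \<Longrightarrow> c W \<in> topspace Y \<and> Y closure_of W \<subseteq> N (c W)"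
    by metis
  define fam where "fam W z = insert (\<lambda>_. a (c W)) (slide (V (c W)) (\<kappa> (c W)) (\<xi> (c W)) s ` \<U> z \<union>
      apex_cone (V (c W)) (\<kappa> (c W)) (\<xi> (c W)) (a (c W)) s ` \<U> z)" for W z
  \<comment> \<open>Closures are taken for upper semicontinuity: the closures that miss
    \<open>y\<close> have a closed union, so near \<open>y\<close> no further index appears.\<close>
  define \<gamma>c where "\<gamma>c z = {W \<in> \<gamma>. z \<in> Y closure_of W}" for z
  define \<U>' where "\<U>' z = \<U> z \<union> (\<Union>W\<in>\<gamma>c z. fam W z)" for z
  have avg: "averaging (V (c W)) (\<kappa> (c W)) (\<xi> (c W))" and ac: "continuous_map X euclidean (a (c W))"
    and a_cube: "a (c W) ` topspace X \<subseteq> unit_cube" if "W \<in> \<gamma>" for W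
    using imp[of "c W"] c[OF that] unfolding improvement_def by blast+
  have imp_cl: "\<U> z \<subseteq> \<U> (c W) \<and> good (a (c W)) z \<and> (\<forall>u\<in>\<U> (c W). \<forall>p\<in>unit_cube.
      good (slide (V (c W)) (\<kappa> (c W)) (\<xi> (c W)) s u p) z \<and>
      good (apex_cone (V (c W)) (\<kappa> (c W)) (\<xi> (c W)) (a (c W)) s u p) z)" if "W \<in> \<gamma>c z" for W z
  proof -
    have W: "W \<in> \<gamma>" "z \<in> Y closure_of W" using that unfolding \<gamma>c_def by auto
    then have "z \<in> N (c W)" using c by blast
    then show ?thesis using imp[of "c W"] c[OF W(1)] unfolding improvement_def by simp
  qed
  have stU: "finite (\<U> y)" "s = 0 \<longrightarrow> \<U> y = {}"
      "\<And>u. u \<in> \<U> y \<Longrightarrow> admissible s u" "\<And>u p. \<lbrakk>u \<in> \<U> y; p \<in> unit_cube\<rbrakk> \<Longrightarrow> good (u p) y"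
      "\<exists>N. openin Y N \<and> y \<in> N \<and> (\<forall>z\<in>N. \<U> z \<subseteq> \<U> y)" if "y \<in> topspace Y" for y
    using st that unfolding stage_def by blast+
  have cl_lf: "locally_finite_in Y ((\<lambda>W. Y closure_of W) ` \<gamma>)"
    by (rule locally_finite_in_closure[OF \<gamma>(2)])
  have \<gamma>c_fin: "finite (\<gamma>c z)" if z: "z \<in> topspace Y" for z
  proof -
    obtain O' where O': "openin Y O'" "z \<in> O'" "finite {W \<in> \<gamma>. W \<inter> O' \<noteq> {}}"
      using \<gamma>(2) z unfolding locally_finite_in_def by blast
    have "\<gamma>c z \<subseteq> {W \<in> \<gamma>. W \<inter> O' \<noteq> {}}"
    proof
      fix W assume "W \<in> \<gamma>c z"
      then have "W \<in> \<gamma>" "z \<in> Y closure_of W" unfolding \<gamma>c_def by auto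
      then show "W \<in> {W \<in> \<gamma>. W \<inter> O' \<noteq> {}}"
        using O'(1,2) unfolding in_closure_of by blast
    qed
    then show ?thesis using O'(3) finite_subset by blast
  qed
  have "stage (Suc s) \<U>'"
    unfolding stage_def
  proof (intro ballI conjI)
    fix y assume y: "y \<in> topspace Y"
    show "finite (\<U>' y)" using stU(1)[OF y] \<gamma>c_fin[OF y] unfolding \<U>'_def fam_def by simp
    show "Suc s = 0 \<longrightarrow> \<U>' y = {}" by simp
    show "admissible (Suc s) u" if u: "u \<in> \<U>' y" for u
    proof (cases "u \<in> \<U> y")
      case True
      show ?thesis by (rule admissible_mono[OF stU(3)[OF y True]]) simp
    next
      case False
      then obtain W where W: "W \<in> \<gamma>c y" "u \<in> fam W y" using u unfolding \<U>'_def by blast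
      then have W\<gamma>: "W \<in> \<gamma>" unfolding \<gamma>c_def by blast
      have s: "1 \<le> s" if "w \<in> \<U> y" for w using stU(2)[OF y] that by (cases s) auto
      show ?thesis
        using W(2) admissible_const[OF ac[OF W\<gamma>] a_cube[OF W\<gamma>]]
          admissible_slide[OF stU(3)[OF y] avg[OF W\<gamma>] s]
          admissible_apex_cone[OF stU(3)[OF y] avg[OF W\<gamma>] s ac[OF W\<gamma>] a_cube[OF W\<gamma>]]
        unfolding fam_def by blast
    qed
    show "good (u p) y" if u: "u \<in> \<U>' y" and p: "p \<in> unit_cube" for u p
    proof (cases "u \<in> \<U> y")
      case True
      show ?thesis by (rule stU(4)[OF y True p])
    next
      case False
      then obtain W where W: "W \<in> \<gamma>c y" "u \<in> fam W y" using u unfolding \<U>'_def by blast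
      show ?thesis using imp_cl[OF W(1)] W(2) p unfolding fam_def by blast
    qed
    obtain M where M: "openin Y M" "y \<in> M" "\<forall>z\<in>M. \<U> z \<subseteq> \<U> y" using stU(5)[OF y] by blast
    let ?R = "\<Union>((\<lambda>W. Y closure_of W) ` (\<gamma> - \<gamma>c y))"
    have "locally_finite_in Y (\<gamma> - \<gamma>c y)" by (rule locally_finite_in_subset[OF \<gamma>(2)]) blast
    then have "closedin Y ?R" by (rule closedin_Union_locally_finite_closure)
    then have "openin Y (M - ?R)" using M(1) by blast
    moreover have "y \<in> M - ?R" using M(2) unfolding \<gamma>c_def by blast
    moreover have "\<U>' z \<subseteq> \<U>' y" if z: "z \<in> M - ?R" for z
    proof -
      have "\<gamma>c z \<subseteq> \<gamma>c y" using z unfolding \<gamma>c_def by blast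
      moreover have "\<U> z \<subseteq> \<U> y" using M(3) z by blast
      moreover then have "fam W z \<subseteq> fam W y" for W unfolding fam_def by blast
      ultimately show ?thesis unfolding \<U>'_def by blast
    qed
    ultimately show "\<exists>N. openin Y N \<and> y \<in> N \<and> (\<forall>z\<in>N. \<U>' z \<subseteq> \<U>' y)" by blast
  qed
  moreover have "selectable (Suc s) \<U>'"
  proof -
    obtain \<Gamma> where \<Gamma>: "open_cover Y \<Gamma>" and \<Gamma>_sel: "\<forall>D. (\<forall>i<s. disjoint_refinement (D i) \<Gamma>) \<longrightarrow>
        (\<forall>B. closedin Y B \<and> B \<subseteq> (\<Union>i<s. \<Union>(D i)) \<longrightarrow> (\<exists>\<theta>. selection \<U> B \<theta>))"
      using sel unfolding selectable_def by (elim exE conjE)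
    \<comment> \<open>Refining \<gamma> as well puts each member of \<open>D s\<close> into a single
      \<open>W\<close>, so one improvement serves over all of it.\<close>
    define \<Gamma>' where "\<Gamma>' = {G \<inter> W | G W. G \<in> \<Gamma> \<and> W \<in> \<gamma>}"
    have \<Gamma>': "open_cover Y \<Gamma>'"
      unfolding open_cover_def
    proof (intro conjI ballI subset_antisym subsetI)
      show op: "openin Y U" if "U \<in> \<Gamma>'" for U
        using that \<Gamma> \<gamma>(1) unfolding \<Gamma>'_def open_cover_def by blast
      show "y \<in> topspace Y" if "y \<in> \<Union>\<Gamma>'" for y using that op openin_subset by blast
      fix y assume "y \<in> topspace Y"
      then obtain G W where "G \<in> \<Gamma>" "y \<in> G" "W \<in> \<gamma>" "y \<in> W"
        using \<Gamma> \<gamma>(1) unfolding open_cover_def by blast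
      then show "y \<in> \<Union>\<Gamma>'" unfolding \<Gamma>'_def by blast
    qed
    have "\<exists>\<theta>. selection \<U>' B \<theta>"
      if D: "\<forall>i<Suc s. disjoint_refinement (D i) \<Gamma>'" and B: "closedin Y B" "B \<subseteq> (\<Union>i<Suc s. \<Union>(D i))" for D B
    proof -
      have "refines (D i) \<Gamma>" if "i < s" for i
      proof -
        have "disjoint_refinement (D i) \<Gamma>'" using D less_SucI[OF that] by blast
        then have "refines (D i) \<Gamma>'" unfolding disjoint_refinement_def by (elim conjE)
        show ?thesis
          unfolding refines_def
        proof
          fix V assume "V \<in> D i"
          then obtain U where "U \<in> \<Gamma>'" "V \<subseteq> U"
            using \<open>refines (D i) \<Gamma>'\<close> unfolding refines_def by blast
          then show "\<exists>G\<in>\<Gamma>. V \<subseteq> G" unfolding \<Gamma>'_def by blast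
        qed
      qed
      then have Ds: "\<forall>i<s. disjoint_refinement (D i) \<Gamma>"
        using D less_SucI unfolding disjoint_refinement_def by blast
      have "disjoint_refinement (D s) \<Gamma>'" using D lessI by blast
      then have DsY: "\<forall>V\<in>D s. openin Y V" "disjoint (D s)" "refines (D s) \<Gamma>'"
        unfolding disjoint_refinement_def by blast+
      have "\<forall>V\<in>D s. \<exists>W. W \<in> \<gamma> \<and> V \<subseteq> W"
      proof
        fix V assume "V \<in> D s"
        then obtain U where "U \<in> \<Gamma>'" "V \<subseteq> U" using DsY(3) unfolding refines_def by blast
        then show "\<exists>W. W \<in> \<gamma> \<and> V \<subseteq> W" unfolding \<Gamma>'_def by blast
      qed
      then obtain \<rho> where \<rho>: "\<And>V. V \<in> D s \<Longrightarrow> \<rho> V \<in> \<gamma> \<and> V \<subseteq> \<rho> V" by metis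
      define A where "A = B - \<Union>(D s)"
      have "openin Y (\<Union>(D s))" using DsY(1) by blast
      then have A: "closedin Y A" unfolding A_def using B(1) by blast
      define E where "E = (\<Union>i<s. \<Union>(D i))"
      have E: "openin Y E"
        unfolding E_def using Ds unfolding disjoint_refinement_def by (intro openin_Union ballI) auto
      have "B \<subseteq> \<Union>(D s) \<union> E" using B(2) unfolding E_def lessThan_Suc by simp
      then have AE: "A \<subseteq> E" unfolding A_def by blast
      have nor: "normal_space Y" by (rule paracompact_imp_normal_space[OF Y])
      have shrink: "\<exists>O'. openin Y O' \<and> A \<subseteq> O' \<and> Y closure_of O' \<subseteq> G" if "openin Y G" "A \<subseteq> G" for G
        using nor[unfolded normal_space_alt, rule_format, of A G] A that by blast
      \<comment> \<open>A collar around \<open>A\<close>. The old selection exists on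
        \<open>C\<close>, the closure of \<open>O1\<close>; it is kept on \<open>O2\<close> (\<tau>
        is 0) and fully contracted off \<open>O1\<close> (\<tau> is 1).\<close>
      obtain O1 where O1: "openin Y O1" "A \<subseteq> O1" "Y closure_of O1 \<subseteq> E"
        using shrink[OF E AE] by blast
      obtain O2 where O2: "openin Y O2" "A \<subseteq> O2" "Y closure_of O2 \<subseteq> O1"
        using shrink[OF O1(1,2)] by blast
      define C where "C = Y closure_of O1"
      have C: "closedin Y C" "O1 \<subseteq> C" "C \<subseteq> E"
        unfolding C_def using O1(3) closure_of_subset[OF openin_subset[OF O1(1)]] by simp_all
      have O2C: "O2 \<subseteq> Y closure_of O2" by (rule closure_of_subset[OF openin_subset[OF O2(1)]])
      have cl: "closedin Y (topspace Y - O1)" using O1(1) by blast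
      have dj: "disjnt (Y closure_of O2) (topspace Y - O1)" using O2(3) unfolding disjnt_def by blast
      obtain \<tau> where \<tau>: "continuous_map Y (top_of_set {0..1::real}) \<tau>" "\<tau> ` (Y closure_of O2) \<subseteq> {0}"
          "\<tau> ` (topspace Y - O1) \<subseteq> {1}"
        by (rule Urysohn_lemma[OF nor closedin_closure_of cl dj zero_le_one])
      have \<tau>c: "continuous_map Y euclideanreal \<tau>" using \<tau>(1) by (simp add: continuous_map_in_subtopology)
      have \<tau>01: "0 \<le> \<tau> y" "\<tau> y \<le> 1" if "y \<in> topspace Y" for y
        using \<tau>(1) that by (auto simp: continuous_map_in_subtopology Pi_iff image_subset_iff)
      obtain \<theta> where \<theta>: "selection \<U> C \<theta>"
        using \<Gamma>_sel[rule_format, of D C] Ds C unfolding E_def by blast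
      define m where "m y = (THE V. V \<in> D s \<and> y \<in> V)" for y
      have m: "m y = U" if "U \<in> D s" "y \<in> U" for y U
        unfolding m_def using that DsY(2) unfolding disjoint_def by (intro the_equality) blast+
      define def where "def U y = deform (V (c (\<rho> U))) (\<kappa> (c (\<rho> U))) (\<xi> (c (\<rho> U))) (a (c (\<rho> U))) (\<tau> y) (\<theta> y)" for U y
      \<comment> \<open>At time \<open>\<tau> y = 1\<close> the deformed map does not depend on \<open>\<theta> y\<close>, so it does not matter that
        \<open>\<theta>\<close> is not continuous outside \<open>C\<close>.\<close>
      define \<theta>' where "\<theta>' y = (if y \<in> \<Union>(D s) then def (m y) y else \<theta> y)" for y
      let ?h = "\<lambda>q. \<theta>' (fst q) (snd q)"
      have \<theta>'_O2: "\<theta>' y x = \<theta> y x" if "y \<in> O2" for y x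
      proof -
        have "\<tau> y = 0" using that O2C \<tau>(2) by blast
        then show ?thesis unfolding \<theta>'_def def_def by simp
      qed
      have \<theta>'_U: "\<theta>' y = def U y" if "U \<in> D s" "y \<in> U" for y U
        using m[OF that] that unfolding \<theta>'_def by auto
      have \<theta>'_out: "\<theta>' y x = a (c (\<rho> U)) x" if "U \<in> D s" "y \<in> U" "y \<in> topspace Y - O1" for y U x
      proof -
        have "\<tau> y = 1" using that \<tau>(3) by blast
        then show ?thesis using \<theta>'_U[OF that(1,2)] unfolding def_def by simp
      qed
      have BY: "B \<subseteq> topspace Y" using B(1) closedin_subset by blast
      have \<theta>c: "continuous_map (subtopology YX (C \<times> UNIV)) euclidean (\<lambda>q. \<theta> (fst q) (snd q))"
        using \<theta> unfolding selection_def by blast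
      have op_strip: "openin YX (U \<times> topspace X)" if "openin Y U" for U
        using that by (simp add: openin_prod_Times_iff)
      have cont_O2: "continuous_map (subtopology YX ((B \<inter> O2) \<times> UNIV)) euclidean ?h"
      proof (rule continuous_map_eq)
        show "continuous_map (subtopology YX ((B \<inter> O2) \<times> UNIV)) euclidean (\<lambda>q. \<theta> (fst q) (snd q))"
          by (rule continuous_map_from_subtopology_mono[OF \<theta>c]) (use O2 O2C C in blast)
      qed (simp add: \<theta>'_O2 mem_Times_iff)
      have cont_U: "continuous_map (subtopology YX ((B \<inter> U) \<times> UNIV)) euclidean ?h" if U: "U \<in> D s" for U
      proof -
        let ?S = "subtopology YX ((B \<inter> U) \<times> UNIV)"
        let ?T = "\<lambda>b. if b then C else topspace Y - O1"
        let ?Q = "\<lambda>b. topspace ?S \<inter> (?T b \<times> UNIV)"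
        have W: "\<rho> U \<in> \<gamma>" using \<rho>[OF U] by blast
        show ?thesis
        \<comment> \<open>Two closed pieces cover the strip: on \<open>C\<close> the deformation of
          a continuous \<theta> is continuous, and off \<open>O1\<close> only the apex is left. They
          overlap in the boundary of \<open>O1\<close>.\<close>
        proof (rule pasting_lemma_closed[where I = UNIV and T = ?Q and f = "\<lambda>_. ?h"])
          fix b :: bool
          have "closedin Y (?T b)" using C(1) O1(1) by auto
          then have "closedin YX (?T b \<times> topspace X)" by (simp add: closedin_prod_Times_iff)
          then have "closedin ?S (((B \<inter> U) \<times> UNIV) \<inter> (?T b \<times> topspace X))"
            by (rule closedin_subtopology_Int_closed)
          moreover have "?Q b = ((B \<inter> U) \<times> UNIV) \<inter> (?T b \<times> topspace X)" using BY by auto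
          ultimately show "closedin ?S (?Q b)" by simp
          show "continuous_map (subtopology ?S (?Q b)) euclidean ?h"
          proof (cases b)
            case True
            have "continuous_map (subtopology YX ((B \<inter> U) \<times> UNIV \<inter> ?Q b)) euclidean
                (\<lambda>q. def U (fst q) (snd q))"
              unfolding def_def
              by (rule continuous_map_deform[OF avg[OF W] ac[OF W] \<tau>c \<theta>c]) (use True in auto)
            then show ?thesis
              unfolding subtopology_subtopology
              by (rule continuous_map_eq) (use \<theta>'_U[OF U] in auto)
          next
            case False
            have "continuous_map (subtopology YX ((B \<inter> U) \<times> UNIV \<inter> ?Q b)) X snd"
              by (rule continuous_map_from_subtopology[OF continuous_map_snd])
            from continuous_map_compose[OF this ac[OF W]]
            have "continuous_map (subtopology YX ((B \<inter> U) \<times> UNIV \<inter> ?Q b)) euclidean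
                (\<lambda>q. a (c (\<rho> U)) (snd q))"
              by (simp only: o_def)
            then show ?thesis
              unfolding subtopology_subtopology
              by (rule continuous_map_eq) (use \<theta>'_out[OF U] False in auto)
          qed
        next
          fix q assume "q \<in> topspace ?S"
          then show "\<exists>b. b \<in> UNIV \<and> q \<in> ?Q b \<and> ?h q = ?h q"
            using C(2) by (cases "fst q \<in> C") (auto intro: exI[of _ True] exI[of _ False])
        qed auto
      qed
      have "continuous_map (subtopology YX (B \<times> UNIV)) euclidean ?h"
      proof (rule pasting_lemma[where I = "insert O2 (D s)" and f = "\<lambda>_. ?h"
            and T = "\<lambda>U. (B \<times> UNIV) \<inter> (U \<times> topspace X)"])
        fix U assume U: "U \<in> insert O2 (D s)"
        then have "openin Y U" using O2(1) DsY(1) by blast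
        then show "openin (subtopology YX (B \<times> UNIV)) ((B \<times> UNIV) \<inter> (U \<times> topspace X))"
          by (intro openin_subtopology_Int2 op_strip)
        have "continuous_map (subtopology YX ((B \<inter> U) \<times> UNIV)) euclidean ?h"
          using U cont_O2 cont_U by blast
        then show "continuous_map (subtopology (subtopology YX (B \<times> UNIV)) ((B \<times> UNIV) \<inter> (U \<times> topspace X)))
            euclidean ?h"
          unfolding subtopology_subtopology by (rule continuous_map_from_subtopology_mono) auto
      next
        fix q assume q: "q \<in> topspace (subtopology YX (B \<times> UNIV))"
        then have "fst q \<in> B" "snd q \<in> topspace X" by auto
        then have "fst q \<in> O2 \<or> (\<exists>U\<in>D s. fst q \<in> U)" using O2(2) unfolding A_def by blast
        then show "\<exists>U. U \<in> insert O2 (D s) \<and> q \<in> (B \<times> UNIV) \<inter> (U \<times> topspace X) \<and> ?h q = ?h q"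
          using \<open>fst q \<in> B\<close> \<open>snd q \<in> topspace X\<close> by (cases q) auto
      qed auto
      moreover have "\<exists>u\<in>\<U>' y. \<exists>p\<in>unit_cube. \<forall>x\<in>topspace X. \<theta>' y x = u p x" if y: "y \<in> B" for y
      proof (cases "y \<in> \<Union>(D s)")
        case False
        then have "y \<in> C" using y O1(2) C(2) unfolding A_def by blast
        then obtain u p where "u \<in> \<U> y" "p \<in> unit_cube" "\<forall>x\<in>topspace X. \<theta> y x = u p x"
          using \<theta> unfolding selection_def by blast
        moreover have "\<theta>' y = \<theta> y" using False unfolding \<theta>'_def by simp
        ultimately show ?thesis unfolding \<U>'_def by auto
      next
        case True
        then obtain U where U: "U \<in> D s" "y \<in> U" by blast
        have yY: "y \<in> topspace Y" using y BY by blast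
        have W: "\<rho> U \<in> \<gamma>" using \<rho>[OF U(1)] by blast
        have "\<rho> U \<subseteq> topspace Y" using W \<gamma>(1) unfolding open_cover_def by blast
        then have "y \<in> Y closure_of \<rho> U" using closure_of_subset[of "\<rho> U" Y] \<rho>[OF U(1)] U(2) by blast
        then have "\<rho> U \<in> \<gamma>c y" using W unfolding \<gamma>c_def by blast
        then have famU: "fam (\<rho> U) y \<subseteq> \<U>' y" unfolding \<U>'_def by blast
        show ?thesis
        proof (cases "y \<in> C")
          case True
          then obtain u p where u: "u \<in> \<U> y" "p \<in> unit_cube" "\<forall>x\<in>topspace X. \<theta> y x = u p x"
            using \<theta> unfolding selection_def by blast
          have "s < CARD('k)" using k by linarith
          from deform_cases[OF stU(3)[OF yY u(1)] this u(2) avg[OF W] \<tau>01[OF yY] u(3), of "a (c (\<rho> U))"]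
          obtain p' where p': "p' \<in> unit_cube" and cases:
            "(\<forall>x\<in>topspace X. def U y x = slide (V (c (\<rho> U))) (\<kappa> (c (\<rho> U))) (\<xi> (c (\<rho> U))) s u p' x) \<or>
             (\<forall>x\<in>topspace X. def U y x = apex_cone (V (c (\<rho> U))) (\<kappa> (c (\<rho> U))) (\<xi> (c (\<rho> U))) (a (c (\<rho> U))) s u p' x)"
            unfolding def_def by (elim bexE)
          have "slide (V (c (\<rho> U))) (\<kappa> (c (\<rho> U))) (\<xi> (c (\<rho> U))) s u \<in> \<U>' y"
            "apex_cone (V (c (\<rho> U))) (\<kappa> (c (\<rho> U))) (\<xi> (c (\<rho> U))) (a (c (\<rho> U))) s u \<in> \<U>' y"
            using famU u(1) unfolding fam_def by blast+
          then show ?thesis using p' cases unfolding \<theta>'_U[OF U] by blast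
        next
          case False
          then have "y \<in> topspace Y - O1" using yY C(2) by blast
          then have "\<theta>' y x = a (c (\<rho> U)) x" for x using \<theta>'_out[OF U] by blast
          moreover have "(\<lambda>_. a (c (\<rho> U))) \<in> \<U>' y" using famU unfolding fam_def by blast
          moreover have "(0 :: real^'k) \<in> unit_cube" by (simp add: mem_box_cart)
          ultimately show ?thesis by (metis (no_types, lifting))
        qed
      qed
      ultimately have "selection \<U>' B \<theta>'" unfolding selection_def by blast
      then show ?thesis by blast
    qed
    then show ?thesis using \<Gamma>' unfolding selectable_def by (intro exI[of _ \<Gamma>']) simp
  qed
  ultimately show ?thesis by blast
qed

lemma stage_exists: "s + 2 * n \<le> CARD('k) \<Longrightarrow> \<exists>\<U>. stage s \<U> \<and> selectable s \<U>"
proof (induction s)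
  case 0
  show ?case using stage_0 by blast
next
  case (Suc s)
  then show ?case using stage_Suc[of s] by (metis Suc_leD add_Suc less_eq_Suc_le)
qed

text \<open>The families are numbered from 0 to \<open>m\<close>, so stage \<open>Suc m\<close> is
  needed, and its existence asks exactly for \<open>Suc m + 2 * n \<le> CARD('k)\<close>. Since they
  cover \<open>Y\<close>, the selection can be taken over all of it.\<close>

theorem good_approximation:
  assumes dimY: "covering_dim_le Y m" and k: "2 * n + 1 + m \<le> CARD('k)"
  shows "\<exists>h. continuous_map X euclidean h \<and> h ` topspace X \<subseteq> unit_cube \<and> (\<forall>y\<in>topspace Y. good h y)"
proof -
  obtain \<U> where st: "stage (Suc m) \<U>" and sel: "selectable (Suc m) \<U>"
    using stage_exists[of "Suc m"] k by auto
  obtain \<Gamma> where \<Gamma>: "open_cover Y \<Gamma>" and \<Gamma>_sel: "\<forall>D. (\<forall>i<Suc m. disjoint_refinement (D i) \<Gamma>) \<longrightarrow>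
      (\<forall>B. closedin Y B \<and> B \<subseteq> (\<Union>i<Suc m. \<Union>(D i)) \<longrightarrow> (\<exists>\<theta>. selection \<U> B \<theta>))"
    using sel unfolding selectable_def by (elim exE conjE)
  obtain D :: "nat \<Rightarrow> 'b set set" where D: "\<And>i V. V \<in> D i \<Longrightarrow> openin Y V" "\<And>i. disjoint (D i)"
    "\<And>i. refines (D i) \<Gamma>" "topspace Y \<subseteq> (\<Union>i\<le>m. \<Union>(D i))"
    by (rule covering_dim_disjoint_families[OF Y dimY \<Gamma>]) blast
  have "\<forall>i<Suc m. disjoint_refinement (D i) \<Gamma>" using D(1-3) unfolding disjoint_refinement_def by blast
  moreover have "topspace Y \<subseteq> (\<Union>i<Suc m. \<Union>(D i))" using D(4) by (simp add: lessThan_Suc_atMost)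
  ultimately obtain \<theta> where \<theta>: "selection \<U> (topspace Y) \<theta>"
    using \<Gamma>_sel[rule_format, of D "topspace Y"] by auto
  define h where "h x = \<theta> (f x) x" for x
  have sub: "subtopology YX (topspace Y \<times> UNIV) = YX"
    by (rule subtopology_superset) auto
  have "continuous_map X YX (\<lambda>x. (f x, x))"
    using f by (simp add: continuous_map_paired perfect_map_def)
  moreover have "continuous_map YX euclidean (\<lambda>q. \<theta> (fst q) (snd q))"
    using \<theta> unfolding selection_def sub by blast
  ultimately have hc: "continuous_map X euclidean h"
    unfolding h_def using continuous_map_compose by (fastforce simp: o_def)
  have ex: "\<exists>u p. admissible (Suc m) u \<and> p \<in> unit_cube \<and> good (u p) y \<and> (\<forall>x\<in>F y. h x = u p x)"
    if y: "y \<in> topspace Y" for y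
  proof -
    obtain u p where u: "u \<in> \<U> y" "p \<in> unit_cube" "\<forall>x\<in>topspace X. \<theta> y x = u p x"
      using \<theta> y unfolding selection_def by blast
    then have "admissible (Suc m) u" "good (u p) y" using st y unfolding stage_def by blast+
    moreover have "\<forall>x\<in>F y. h x = u p x" using u(3) unfolding h_def F_def by auto
    ultimately show ?thesis using u(2) by blast
  qed
  have "good h y" if y: "y \<in> topspace Y" for y
  proof -
    obtain u p where up: "good (u p) y" "\<forall>x\<in>F y. h x = u p x" using ex[OF y] by blast
    have "{x \<in> F y. h x = t} = {x \<in> F y. u p x = t}" for t using up(2) by auto
    then show ?thesis using up unfolding good_def small_fibres_def by simp
  qed
  moreover have "h x \<in> unit_cube" if x: "x \<in> topspace X" for x
  proof -
    obtain u p where "admissible (Suc m) u" "p \<in> unit_cube" "\<forall>z\<in>F (f x). h z = u p z"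
      using ex[OF f_in[OF x]] by blast
    then show ?thesis using x unfolding admissible_def F_def by auto
  qed
  ultimately show ?thesis using hc by blast
qed

text \<open>Stability holds with a constant bound near each point of \<open>Y\<close>. A partition
  of unity averages these bounds to a continuous function on \<open>Y\<close>, which is pulled back
  along \<open>f\<close>.\<close>

lemma good_stable:
  assumes good: "\<And>y. y \<in> topspace Y \<Longrightarrow> good g y"
  shows "\<exists>\<beta>. continuous_map X euclideanreal \<beta> \<and> (\<forall>x\<in>topspace X. 0 < \<beta> x) \<and>
    (\<forall>h. (\<forall>x\<in>topspace X. dist (h x) (g x) \<le> \<beta> x) \<longrightarrow> (\<forall>y\<in>topspace Y. good h y))"
proof -
  have zero: "(0 :: real^'k) \<in> unit_cube" by (simp add: mem_box_cart)
  have "\<exists>\<epsilon> V. \<epsilon> > 0 \<and> openin Y V \<and> y \<in> V \<and>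
      (\<forall>z\<in>V. \<forall>h. (\<forall>x\<in>F z. dist (h x) (g x) < \<epsilon>) \<longrightarrow> good h z)" if y: "y \<in> topspace Y" for y
  proof -
    have "\<exists>\<epsilon>>0. \<exists>V. openin Y V \<and> y \<in> V \<and> (\<forall>z\<in>V. \<forall>p\<in>unit_cube :: (real^'k) set. \<forall>h.
        (\<forall>x\<in>F z. dist (h x) (g x) < \<epsilon>) \<longrightarrow> good h z)"
      by (rule good_tube[OF jointly_continuous_const[OF g] y]) (use g_cube good[OF y] in auto)
    then show ?thesis using zero by blast
  qed
  then obtain \<epsilon> V where \<epsilon>V: "\<And>y. y \<in> topspace Y \<Longrightarrow> \<epsilon> y > 0 \<and> openin Y (V y) \<and> y \<in> V y \<and>
      (\<forall>z\<in>V y. \<forall>h. (\<forall>x\<in>F z. dist (h x) (g x) < \<epsilon> y) \<longrightarrow> good h z)"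
    by metis
  have "open_cover Y (V ` topspace Y)"
    unfolding open_cover_def
  proof (intro conjI ballI subset_antisym)
    show op: "openin Y U" if "U \<in> V ` topspace Y" for U using that \<epsilon>V by blast
    show "\<Union>(V ` topspace Y) \<subseteq> topspace Y" using op by (intro Union_least openin_subset)
    show "topspace Y \<subseteq> \<Union>(V ` topspace Y)" using \<epsilon>V by blast
  qed
  then obtain \<W> where \<W>: "open_cover Y \<W>" "refines \<W> (V ` topspace Y)" "locally_finite_in Y \<W>"
    using paracompact_refinement[OF Y] by blast
  have "\<forall>W\<in>\<W>. \<exists>y. y \<in> topspace Y \<and> W \<subseteq> V y" using \<W>(2) unfolding refines_def by blast
  then obtain c where c: "\<And>W. W \<in> \<W> \<Longrightarrow> c W \<in> topspace Y \<and> W \<subseteq> V (c W)" by metis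
  \<comment> \<open>Halved because the ball is closed while the tube needs a strict
    inequality.\<close>
  define d where "d W = \<epsilon> (c W) / 2" for W
  have dpos: "0 < d W" if "W \<in> \<W>" for W using \<epsilon>V[of "c W"] c[OF that] unfolding d_def by simp
  obtain \<phi> where \<phi>c: "\<And>U. U \<in> \<W> \<Longrightarrow> continuous_map Y euclideanreal (\<phi> U)"
    and \<phi>pos: "\<And>U x. \<lbrakk>U \<in> \<W>; x \<in> topspace Y\<rbrakk> \<Longrightarrow> 0 \<le> \<phi> U x"
    and \<phi>0: "\<And>U x. \<lbrakk>U \<in> \<W>; x \<in> topspace Y; x \<notin> U\<rbrakk> \<Longrightarrow> \<phi> U x = 0"
    and \<phi>1: "\<And>x. x \<in> topspace Y \<Longrightarrow> (\<Sum>U\<in>{U\<in>\<W>. x \<in> U}. \<phi> U x) = (1::real)"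
    using paracompact_partition_of_unity[OF Y \<W>(1,3)] by blast
  define A where "A y = (\<Sum>W\<in>{W\<in>\<W>. y \<in> W}. \<phi> W y * d W)" for y
  have Ac: "continuous_map Y euclideanreal A"
    unfolding A_def
    by (rule continuous_map_locally_finite_sum[OF \<W>(3)]) (auto intro!: continuous_map_real_mult \<phi>c \<phi>0)
  have fin: "finite {W\<in>\<W>. y \<in> W}" if "y \<in> topspace Y" for y
    by (rule locally_finite_in_fibre[OF \<W>(3) that])
  have Apos: "0 < A y" if y: "y \<in> topspace Y" for y
  proof -
    obtain b where b: "b > 0" "\<forall>W\<in>{W\<in>\<W>. y \<in> W}. b \<le> d W"
      using finite_pos_lower_bound[OF fin[OF y], of d] dpos by auto
    have "(\<Sum>W\<in>{W\<in>\<W>. y \<in> W}. \<phi> W y * b) \<le> A y"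
      unfolding A_def using b(2) \<phi>pos y by (intro sum_mono mult_left_mono) auto
    then show ?thesis using b(1) \<phi>1[OF y] by (simp add: sum_distrib_right[symmetric])
  qed
  \<comment> \<open>An average does not exceed its largest term, so at each \<open>y\<close> a
    single tube accounts for the whole fibre.\<close>
  have Ale: "\<exists>W\<in>\<W>. y \<in> W \<and> A y \<le> d W" if y: "y \<in> topspace Y" for y
  proof -
    let ?F = "{W\<in>\<W>. y \<in> W}"
    have "?F \<noteq> {}" using \<phi>1[OF y] by (metis sum.empty zero_neq_one)
    then have ne: "d ` ?F \<noteq> {}" by blast
    have "Max (d ` ?F) \<in> d ` ?F" using fin[OF y] ne by (intro Max_in) auto
    then obtain W where W: "W \<in> ?F" "d W = Max (d ` ?F)" by auto
    have "A y \<le> (\<Sum>U\<in>?F. \<phi> U y * d W)"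
      unfolding A_def W(2) using fin[OF y] \<phi>pos y by (intro sum_mono mult_left_mono Max_ge) auto
    then show ?thesis using W(1) \<phi>1[OF y] by (auto simp: sum_distrib_right[symmetric])
  qed
  define \<beta> where "\<beta> x = A (f x)" for x
  have "continuous_map X euclideanreal \<beta>"
    unfolding \<beta>_def using continuous_map_compose[OF _ Ac, of X f] f
    by (simp add: o_def perfect_map_def)
  moreover have "\<forall>x\<in>topspace X. 0 < \<beta> x" using Apos f_in unfolding \<beta>_def by blast
  moreover have "good h y" if h: "\<forall>x\<in>topspace X. dist (h x) (g x) \<le> \<beta> x" and y: "y \<in> topspace Y" for h y
  proof -
    obtain W where W: "W \<in> \<W>" "y \<in> W" "A y \<le> d W" using Ale[OF y] by blast
    have "dist (h x) (g x) < \<epsilon> (c W)" if "x \<in> F y" for x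
    proof -
      have "dist (h x) (g x) \<le> A y" using h that unfolding \<beta>_def F_def by auto
      then show ?thesis using W(3) dpos[OF W(1)] unfolding d_def by simp
    qed
    then show ?thesis using \<epsilon>V[of "c W"] c[OF W(1)] W(2) by blast
  qed
  ultimately show ?thesis by blast
qed

lemma omega_map_imp_small_fibres:
  assumes "omega_map X Z \<omega> (\<lambda>x. (f x, h x))"
  shows "small_fibres h y"
  unfolding small_fibres_def
proof
  fix t
  show "\<exists>U\<in>insert {} \<omega>. {x \<in> F y. h x = t} \<subseteq> U"
  proof (cases "{x \<in> F y. h x = t} = {}")
    case False
    then obtain x0 where x0: "x0 \<in> topspace X" "f x0 = y" "h x0 = t" unfolding F_def by blast
    obtain V U where "(f x0, h x0) \<in> V" "U \<in> \<omega>" "{x' \<in> topspace X. (f x', h x') \<in> V} \<subseteq> U"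
      using assms x0(1) unfolding omega_map_def by blast
    then have "{x \<in> F y. h x = t} \<subseteq> U" using x0 unfolding F_def by auto
    then show ?thesis using \<open>U \<in> \<omega>\<close> by blast
  qed blast
qed

end

section \<open>Openness and density in the source limitation topology\<close>

lemma mtopology_of_cube: "mtopology_of (cube :: (real^'k) metric) = top_of_set unit_cube"
  and mdist_cube: "mdist (cube :: (real^'k) metric) = dist"
proof -
  have "{x :: real^'k. \<forall>i. 0 \<le> x $ i \<and> x $ i \<le> 1} = unit_cube" by (auto simp: mem_box_cart)
  then show "mtopology_of cube = top_of_set (unit_cube :: (real^'k) set)"
    unfolding cube_def by (simp add: mtopology_of_submetric)
  show "mdist cube = (dist :: real^'k \<Rightarrow> _)"
    unfolding cube_def by simp
qed

theorem theorem2p1: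
  fixes n m :: nat
    and X :: "'a topology" and Y :: "'b topology" and f :: "'a \<Rightarrow> 'b"
    and \<omega> :: "'a set set"
  assumes "CARD('k::finite) = 2 * n + 1 + m"
    and "paracompact_space X" and "paracompact_space Y"
    and "perfect_map X Y f"
    and "map_dim_le X Y f n"
    and "covering_dim_le Y m"
    and "open_cover X \<omega>"
  shows "let \<I> = cube :: (real ^ 'k) metric;
             \<C> = source_limitation_topology X \<I>;
             \<G> = {g \<in> cmaps X \<I>. omega_map X (prod_topology Y (mtopology_of \<I>)) \<omega> (\<lambda>x. (f x, g x))}
         in openin \<C> \<G> \<and> \<C> closure_of \<G> = cmaps X \<I>"
proof -
  let ?I = "cube :: (real^'k) metric"
  let ?Z = "prod_topology Y (top_of_set (unit_cube :: (real^'k) set))"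
  define \<G> where "\<G> = {g \<in> cmaps X ?I. omega_map X ?Z \<omega> (\<lambda>x. (f x, g x))}"
  obtain e :: "nat \<Rightarrow> 'k" where e: "bij_betw e {..<CARD('k)} UNIV"
    using ex_bij_betw_nat_finite[OF finite[of "UNIV :: 'k set"]] by (auto simp: atLeast0LessThan)
  have PA: "perfect_approximation X Y f n \<omega> g \<alpha> e"
    if g: "g \<in> cmaps X ?I" and "continuous_map X euclideanreal \<alpha>" "\<forall>x\<in>topspace X. 0 < \<alpha> x"
    for g :: "'a \<Rightarrow> real^'k" and \<alpha>
    using assms(2-7) that e
    unfolding perfect_approximation_def cmaps_def mtopology_of_cube
    by (auto simp: continuous_map_in_subtopology)
  have cm: "continuous_map X (top_of_set unit_cube) g" if "g \<in> cmaps X ?I" for g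
    using that unfolding cmaps_def mtopology_of_cube by blast
  have open_G: "sl_open X ?I \<G>"
  proof (rule sl_openI)
    show "\<G> \<subseteq> cmaps X ?I" unfolding \<G>_def by blast
    fix g assume "g \<in> \<G>"
    then have g_in: "g \<in> cmaps X ?I" and g_omega: "omega_map X ?Z \<omega> (\<lambda>x. (f x, g x))"
      unfolding \<G>_def by auto
    \<comment> \<open>With \<open>g\<close> as its own reference map and bound 1, goodness of
      \<open>g\<close> reduces to having small fibres, the distance being 0.\<close>
    interpret perfect_approximation X Y f n \<omega> g "\<lambda>_. 1" e
      by (rule PA[OF g_in]) simp_all
    have "good g y" for y
      using omega_map_imp_small_fibres[OF g_omega] unfolding good_def by simp
    then obtain \<beta> where \<beta>: "continuous_map X euclideanreal \<beta>" "\<forall>x\<in>topspace X. 0 < \<beta> x"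
      "\<forall>h. (\<forall>x\<in>topspace X. dist (h x) (g x) \<le> \<beta> x) \<longrightarrow> (\<forall>y\<in>topspace Y. good h y)"
      using good_stable by blast
    have "sl_cball X ?I g \<beta> \<subseteq> \<G>"
    proof
      fix h assume "h \<in> sl_cball X ?I g \<beta>"
      then have h: "h \<in> cmaps X ?I" "\<forall>x\<in>topspace X. dist (h x) (g x) \<le> \<beta> x"
        unfolding sl_cball_def mdist_cube by (auto simp: dist_commute)
      then have "\<forall>y\<in>topspace Y. good h y" using \<beta>(3) by blast
      then have "omega_map X ?Z \<omega> (\<lambda>x. (f x, h x))"
        by (intro small_fibres_imp_omega_map cm h(1)) (simp add: good_def)
      then show "h \<in> \<G>" unfolding \<G>_def using h(1) by blast
    qed
    then show "\<exists>\<beta>. continuous_map X euclideanreal \<beta> \<and> (\<forall>x\<in>topspace X. 0 < \<beta> x) \<and>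
        sl_cball X ?I g \<beta> \<subseteq> \<G>"
      using \<beta>(1,2) by blast
  qed
  have dense_G: "source_limitation_topology X ?I closure_of \<G> = cmaps X ?I"
  proof (intro subset_antisym subsetI)
    fix g assume "g \<in> source_limitation_topology X ?I closure_of \<G>"
    then show "g \<in> cmaps X ?I"
      using closure_of_subset_topspace[of "source_limitation_topology X ?I" \<G>] by auto
  next
    fix g assume g_in: "g \<in> cmaps X ?I"
    show "g \<in> source_limitation_topology X ?I closure_of \<G>"
      unfolding in_closure_of
    proof (intro conjI allI impI; (elim conjE)?)
      show "g \<in> topspace (source_limitation_topology X ?I)" using g_in by simp
      fix T assume T: "g \<in> T" "openin (source_limitation_topology X ?I) T"
      then have "sl_open X ?I T" by (simp add: openin_source_limitation_topology)
      then obtain \<alpha> where \<alpha>_in: "continuous_map X euclideanreal \<alpha>" "\<forall>x\<in>topspace X. 0 < \<alpha> x"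
          "sl_cball X ?I g \<alpha> \<subseteq> T"
        using T(1) by (rule sl_openD)
      interpret perfect_approximation X Y f n \<omega> g \<alpha> e
        by (rule PA[OF g_in \<alpha>_in(1,2)])
      obtain h where h: "continuous_map X euclidean h" "h ` topspace X \<subseteq> unit_cube"
          "\<forall>y\<in>topspace Y. good h y"
        using good_approximation[OF assms(6)] assms(1) by auto
      \<comment> \<open>Members of \<open>cmaps\<close> are extensional, whereas \<open>h\<close> is
        arbitrary off the carrier.\<close>
      define h' where "h' = restrict h (topspace X)"
      have h'h: "h' x = h x" if "x \<in> topspace X" for x using that unfolding h'_def by simp
      have h'c: "continuous_map X (top_of_set unit_cube) h'"
        by (rule continuous_map_eq[of _ _ h])
          (use h(1,2) h'h in \<open>auto simp: continuous_map_in_subtopology\<close>)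
      then have h'_cmaps: "h' \<in> cmaps X ?I"
        unfolding cmaps_def mtopology_of_cube h'_def by simp
      have eqF: "{x \<in> F y. h' x = t} = {x \<in> F y. h x = t}" for y t
        using h'h F_subset by force
      have "small_fibres h' y" if "y \<in> topspace Y" for y
        using h(3) that unfolding good_def small_fibres_def eqF by blast
      then have "omega_map X ?Z \<omega> (\<lambda>x. (f x, h' x))"
        by (intro small_fibres_imp_omega_map h'c)
      then have "h' \<in> \<G>" unfolding \<G>_def using h'_cmaps by blast
      moreover have "dist (g x) (h' x) \<le> \<alpha> x" if x: "x \<in> topspace X" for x
      proof -
        have "dist (h x) (g x) < \<alpha> x"
          using h(3) f_in[OF x] x unfolding good_def by (simp add: F_iff)
        then show ?thesis using h'h[OF x] by (simp add: dist_commute)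
      qed
      then have "h' \<in> sl_cball X ?I g \<alpha>" unfolding sl_cball_def mdist_cube using h'_cmaps by blast
      ultimately show "\<exists>h. h \<in> \<G> \<and> h \<in> T" using \<alpha>_in(3) by blast
    qed
  qed
  show ?thesis
    unfolding Let_def mtopology_of_cube \<G>_def[symmetric]
    using open_G dense_G by (simp add: openin_source_limitation_topology)
qed

end
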